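(* The function $F(w,\eta\,|\,a_1,a_2)$ has the following properties. (a) It is a single-valued, meromorphic function of $w,a_1,a_2\in\mathbb{C}^*\setminus\mathbb{R}_{<0}$ and $\eta\in\mathbb{C}$, provided that $\operatorname{Re}(a_2/a_1)>0$. It has no zeroes, and poles only at the points $w+\eta=n_1a_1+n_2a_2$ with $(n_1,n_2)\in\mathbb{Z}_{\le0}^2$. (b) It satisfies the symmetry relation $F(w,\eta\,|\,a_1,a_2)=F(w,\eta\,|\,a_2,a_1)$, and the homogeneity relation $$F(\lambda w,\lambda\eta\,|\,\lambda a_1,\lambda a_2)=F(w,\eta\,|\,a_1,a_2),$$ valid for $\lambda\in\mathbb{C}^*$ such that $\lambda w,\lambda a_i\in\mathbb{C}^*\setminus\mathbb{R}_{<0}$. (c) It satisfies the difference relation $$\frac{F(w,\eta+a_2\,|\,a_1,a_2)}{F(w,\eta\,|\,a_1,a_2)}=\Lambda(w,\eta\,|\,a_1)^{-1}.$$ (d) Consider fixed $a_1,a_2\in\mathbb{C}^*$ and $\eta\in\mathbb{C}$ and assume that $\operatorname{Re}(a_i)>0$. Then there is an asymptotic expansion $$\log F(w,\eta\,|\,a_1,a_2)\sim\sum_{k\ge1}\frac{(-1)^k\,B_{2,k+2}(\eta\,|\,a_1,a_2)}{k(k+1)(k+2)}\,w^{-k}$$ valid as $|w|\to\infty$ in any closed subsector of the half-plane $\operatorname{Re}(w)>0$.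
   Context: Multiple Bernoulli polynomials are defined by $\dfrac{t^Ne^{xt}}{\prod_{i=1}^N(e^{a_it}-1)}=\sum_{k\ge0}B_{N,k}(x\,|\,a_1,\dots,a_N)\dfrac{t^k}{k!}$. In particular $B_{2,2}(x\,|\,a_1,a_2)=\frac{x^2}{a_1a_2}-(\frac1{a_1}+\frac1{a_2})x+\frac16(\frac{a_2}{a_1}+\frac{a_1}{a_2})+\frac12$ and $B_{1,1}(x\,|\,a)=\frac{x}{a}-\frac12$. Double gamma function: for $\operatorname{Re}(a_1),\operatorname{Re}(a_2)>0$ let $\zeta_2(s,x\,|\,a_1,a_2)=\sum_{n_1,n_2\ge0}(x+n_1a_1+n_2a_2)^{-s}$, absolutely convergent for $\operatorname{Re}(s)>2$ and continued meromorphically in $s$, and let $\Gamma_2(x\,|\,a_1,a_2)=\exp\frac{\partial}{\partial s}\zeta_2(s,x\,|\,a_1,a_2)|_{s=0}$, a meromorphic function of $x\in\mathbb{C}$. It is analytically continued in the parameters to $a_1,a_2\in\mathbb{C}^*\setminus\mathbb{R}_{<0}$ with $\operatorname{Re}(a_2/a_1)>0$ by means of the homogeneity property $\Gamma_2(\lambda x\,|\,\lambda a_1,\lambda a_2)=\exp\big(-\tfrac12B_{2,2}(x\,|\,a_1,a_2)\log\lambda\big)\,\Gamma_2(x\,|\,a_1,a_2)$, where $\lambda\in\mathbb{C}^*\setminus\mathbb{R}_{<0}$ is such that $\operatorname{Re}(\lambda a_i)>0$ and $\log\lambda$ is the principal branch. For $a_1,a_2\in\mathbb{C}^*\setminus\mathbb{R}_{<0}$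 with $\operatorname{Re}(a_2/a_1)>0$, $w\in\mathbb{C}^*\setminus\mathbb{R}_{<0}$ and $\eta\in\mathbb{C}$, define, with the principal branch of $\log w$, $$F(w,\eta\,|\,a_1,a_2)=\Gamma_2(w+\eta\,|\,a_1,a_2)\exp\Big(\tfrac12B_{2,2}(w+\eta\,|\,a_1,a_2)\log w\Big)\exp\Big(-\frac{3w^2}{4a_1a_2}-\frac{\eta w}{a_1a_2}+\frac{w(a_1+a_2)}{2a_1a_2}\Big).$$ For $w,a\in\mathbb{C}^*\setminus\mathbb{R}_{<0}$ and $\eta\in\mathbb{C}$ define $\Lambda(w,\eta\,|\,a)=\Gamma_1(w+\eta\,|\,a)\,\exp\big(-B_{1,1}(w+\eta\,|\,a)\log w\big)\,e^{w/a}$, where $\Gamma_1(x\,|\,a)=(2\pi)^{-1/2}\,\Gamma(x/a)\,a^{\frac xa-\frac12}$, and principal branches of $\log w$ and $\log a$ are used.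
   Formalization: Γ₂ is ambiguous as continued, so log(a2/a1)=log a2−log a1 and log(λa_i)=log λ+log a_i are required; homogeneity fails for a1=a2=1, w=e^{3πi/4}, λ=i, so λ is restricted to the connected component of 1 in the set where λw, λa1, λa2 avoid the cut. *)

theory Defs
  imports "HOL-Complex_Analysis.Complex_Analysis" "HOL-Library.Landau_Symbols"
begin

text \<open>
  The generating function is read as a formal power series in \<open>t\<close>. For nonzero parameters the
  denominator has order exactly \<open>N\<close>, so the division of power series is exact.
\<close>

definition mult_bernoulli :: "nat \<Rightarrow> complex \<Rightarrow> complex list \<Rightarrow> complex" where
  "mult_bernoulli k x as =
     fact k * fps_nth ((fps_X ^ length as * fps_exp x) div (\<Prod>a\<leftarrow>as. fps_exp a - 1)) k"

definition slit :: "complex set" where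
  "slit = - \<real>\<^sub>\<le>\<^sub>0"

definition Gamma1 :: "complex \<Rightarrow> complex \<Rightarrow> complex" where
  "Gamma1 x a = of_real (1 / sqrt (2 * pi)) * Gamma (x / a) * a powr (x / a - 1 / 2)"

definition cone_lattice :: "complex \<Rightarrow> complex \<Rightarrow> complex set" where
  "cone_lattice a1 a2 = {of_int n1 * a1 + of_int n2 * a2 | n1 n2. n1 \<le> 0 \<and> n2 \<le> 0}"

text \<open>
  The meromorphic continuation in \<open>s\<close> of the double zeta series, for \<open>Re a1, Re a2 > 0\<close>; it is
  unique because \<open>nicely_meromorphic_on\<close> fixes the value \<open>0\<close> at poles. The powers are principal;
  all but finitely many of their bases lie in the right half-plane.
\<close>

definition zeta2 :: "complex \<Rightarrow> complex \<Rightarrow> complex \<Rightarrow> complex \<Rightarrow> complex" where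
  "zeta2 s x a1 a2 =
     (THE f. f nicely_meromorphic_on UNIV \<and>
        (\<forall>s. Re s > 2 \<longrightarrow>
           f s = (\<Sum>\<^sub>\<infinity>(n1, n2)\<in>(UNIV :: (nat \<times> nat) set).
                    (x + of_nat n1 * a1 + of_nat n2 * a2) powr (- s)))) s"

text \<open>
  The double gamma function for \<open>Re a1, Re a2 > 0\<close>. Another branch of the power in one of the
  terms changes the derivative at \<open>s = 0\<close> by a multiple of \<open>2 \<pi> i\<close>, so the formula is insensitive
  to the choice of branches and is valid for every \<open>x\<close> outside the set of poles. As with the
  library's \<open>Gamma\<close>, the value at a pole is \<open>0\<close>.
\<close>

definition Gamma2_rhp :: "complex \<Rightarrow> complex \<Rightarrow> complex \<Rightarrow> complex" where
  "Gamma2_rhp x a1 a2 =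
     (if x \<in> cone_lattice a1 a2 then 0 else exp (deriv (\<lambda>s. zeta2 s x a1 a2) 0))"

text \<open>
  The auxiliary factors \<open>\<lambda>\<close> that rotate the parameters into the right half-plane. The condition on
  logarithms selects the analytic continuation from the right half-plane: without it two choices
  of \<open>\<lambda>\<close> on different sides of the cut of the logarithm give different values, for example if
  \<open>a1\<close> and \<open>a2\<close> have argument \<open>3\<pi>/4\<close> and \<open>\<lambda>\<close> has argument \<open>-3\<pi>/4\<close> or \<open>7\<pi>/8\<close>.
\<close>

definition rotates_to_rhp :: "complex \<Rightarrow> complex \<Rightarrow> complex \<Rightarrow> bool" where
  "rotates_to_rhp l a1 a2 \<longleftrightarrow>
     l \<in> slit \<and> Re (l * a1) > 0 \<and> Re (l * a2) > 0 \<and>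
     Ln (l * a1) = Ln l + Ln a1 \<and> Ln (l * a2) = Ln l + Ln a2"

text \<open>The value at \<open>(x | a1, a2)\<close> that the homogeneity property prescribes by means of \<open>l\<close>.\<close>

definition Gamma2_via :: "complex \<Rightarrow> complex \<Rightarrow> complex \<Rightarrow> complex \<Rightarrow> complex" where
  "Gamma2_via l x a1 a2 =
     exp (mult_bernoulli 2 x [a1, a2] / 2 * Ln l) * Gamma2_rhp (l * x) (l * a1) (l * a2)"

definition Gamma2 :: "complex \<Rightarrow> complex \<Rightarrow> complex \<Rightarrow> complex" where
  "Gamma2 x a1 a2 =
     (if Re a1 > 0 \<and> Re a2 > 0 then Gamma2_rhp x a1 a2
      else Gamma2_via (SOME l. rotates_to_rhp l a1 a2) x a1 a2)"

text \<open>
  The last condition says that the cone spanned by \<open>a1\<close> and \<open>a2\<close> does not meet the negative real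
  axis. If it does (say \<open>a1\<close> is just above the axis and \<open>a2\<close> just below), no \<open>\<lambda>\<close> is compatible
  with both principal logarithms and \<open>Gamma2\<close> has no continuation to \<open>(a1, a2)\<close>.
\<close>

definition admissible_params :: "complex \<Rightarrow> complex \<Rightarrow> bool" where
  "admissible_params a1 a2 \<longleftrightarrow>
     a1 \<in> slit \<and> a2 \<in> slit \<and> Re (a2 / a1) > 0 \<and> Ln (a2 / a1) = Ln a2 - Ln a1"

definition F_fun :: "complex \<Rightarrow> complex \<Rightarrow> complex \<Rightarrow> complex \<Rightarrow> complex" where
  "F_fun w \<eta> a1 a2 =
     Gamma2 (w + \<eta>) a1 a2 *
     exp (mult_bernoulli 2 (w + \<eta>) [a1, a2] / 2 * Ln w) *
     exp (- (3 * w\<^sup>2 / (4 * a1 * a2)) - \<eta> * w / (a1 * a2) + w * (a1 + a2) / (2 * a1 * a2))"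

definition Lambda_fun :: "complex \<Rightarrow> complex \<Rightarrow> complex \<Rightarrow> complex" where
  "Lambda_fun w \<eta> a =
     Gamma1 (w + \<eta>) a * exp (- mult_bernoulli 1 (w + \<eta>) [a] * Ln w) * exp (w / a)"

text \<open>Used on open sets only: the total derivative exists and is complex linear.\<close>

definition mv_holomorphic_on :: "(complex ^ 'n \<Rightarrow> complex) \<Rightarrow> (complex ^ 'n) set \<Rightarrow> bool" where
  "mv_holomorphic_on f S \<longleftrightarrow>
     (\<forall>z\<in>S. \<exists>c :: complex ^ 'n. (f has_derivative (\<lambda>h. \<Sum>i\<in>UNIV. c $ i * h $ i)) (at z))"

text \<open>
  Locally a quotient of holomorphic functions whose denominator vanishes identically on no
  nonempty open set.
\<close>

definition mv_meromorphic_on :: "(complex ^ 'n \<Rightarrow> complex) \<Rightarrow> (complex ^ 'n) set \<Rightarrow> bool" where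
  "mv_meromorphic_on f S \<longleftrightarrow>
     (\<forall>z\<in>S. \<exists>U g h. open U \<and> z \<in> U \<and> U \<subseteq> S \<and>
        mv_holomorphic_on g U \<and> mv_holomorphic_on h U \<and>
        U \<subseteq> closure {p \<in> U. h p \<noteq> 0} \<and>
        (\<forall>p\<in>U. h p \<noteq> 0 \<longrightarrow> f p = g p / h p))"

text \<open>
  \<open>f\<close>, regarded as a meromorphic function (that is, up to its values on a nowhere dense closed
  set), is holomorphic near \<open>z\<close> with value \<open>v\<close> at \<open>z\<close>.
\<close>

definition mv_regular_value :: "(complex ^ 'n \<Rightarrow> complex) \<Rightarrow> complex ^ 'n \<Rightarrow> complex \<Rightarrow> bool" where
  "mv_regular_value f z v \<longleftrightarrow>
     (\<exists>U g. open U \<and> z \<in> U \<and> mv_holomorphic_on g U \<and> g z = v \<and>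
        U \<subseteq> closure (interior {p. f p = g p}))"

definition mv_pole :: "(complex ^ 'n \<Rightarrow> complex) \<Rightarrow> complex ^ 'n \<Rightarrow> bool" where
  "mv_pole f z \<longleftrightarrow> (\<nexists>v. mv_regular_value f z v)"

definition mv_zero :: "(complex ^ 'n \<Rightarrow> complex) \<Rightarrow> complex ^ 'n \<Rightarrow> bool" where
  "mv_zero f z \<longleftrightarrow> mv_regular_value f z 0"

text \<open>The coordinates are \<open>w, \<eta>, a1, a2\<close> in this order.\<close>

definition F_vec :: "complex ^ 4 \<Rightarrow> complex" where
  "F_vec p = F_fun (p $ 1) (p $ 2) (p $ 3) (p $ 4)"

definition F_domain :: "(complex ^ 4) set" where
  "F_domain = {p. p $ 1 \<in> slit \<and> admissible_params (p $ 3) (p $ 4)}"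

definition F_polar_set :: "(complex ^ 4) set" where
  "F_polar_set = {p. p $ 1 + p $ 2 \<in> cone_lattice (p $ 3) (p $ 4)}"

definition closed_sector :: "real \<Rightarrow> real \<Rightarrow> complex set" where
  "closed_sector \<alpha> \<beta> = {w. w \<noteq> 0 \<and> \<alpha> \<le> Arg w \<and> Arg w \<le> \<beta>}"

text \<open>\<open>f(w) \<sim> \<Sum>\<^sub>k\<^sub>\<ge>\<^sub>1 c\<^sub>k w\<^sup>-\<^sup>k\<close> in the sense of Poincare as \<open>|w| \<rightarrow> \<infinity>\<close> within \<open>S\<close>.\<close>

definition asymp_expansion_in ::
  "(complex \<Rightarrow> complex) \<Rightarrow> (nat \<Rightarrow> complex) \<Rightarrow> complex set \<Rightarrow> bool" where
  "asymp_expansion_in f c S \<longleftrightarrow>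
     (\<forall>K. (\<lambda>w. f w - (\<Sum>k=1..K. c k / w ^ k))
            \<in> O[inf at_infinity (principal S)](\<lambda>w. 1 / w ^ Suc K))"

end

theory Submission
  imports Defs "HOL-Real_Asymp.Real_Asymp"
begin

text \<open>
  Put \<open>p = 2 - s\<close> and \<open>\<partial> = d/dy\<close>. The mixed difference of a function \<open>f\<close> over the
  parallelogram spanned by \<open>a1\<close> and \<open>a2\<close> is \<open>(exp(a1 \<partial>) - 1) (exp(a2 \<partial>) - 1) f\<close>. Hence the
  generating series of the \<open>B\<^bsub>2,k\<^esub>(\<eta>)\<close>, evaluated at \<open>\<partial>\<close> and applied to \<open>y\<^sup>p\<close>, is a formal
  solution \<open>f\<close> of \<open>D f(y) = p (p - 1) (y + \<eta>)\<^bsup>p-2\<^esup>\<close>, where \<open>D\<close> is the mixed difference. Cutting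
  the series off after \<open>K\<close> terms leaves a remainder of order \<open>\<bar>y\<bar>\<^bsup>Re p - K - 2\<^esup>\<close>, and summing over
  the points \<open>w + n1 a1 + n2 a2\<close>, where mixed differences telescope, gives the double zeta function
  of \<open>w + \<eta>\<close> for \<open>Re s > 2 - K\<close> as an elementary function of \<open>w\<close> plus a convergent series of
  remainders. Only \<open>w\<close> has to lie in the right half-plane, \<open>\<eta>\<close> is arbitrary.

  Differentiation at \<open>s = 0\<close> writes \<open>log \<Gamma>\<^sub>2\<close> in the same way. The elementary part for \<open>K = 3\<close> is
  cancelled exactly by the exponential factors of \<open>F\<close>, so \<open>1 / F\<close> is an infinite product with
  the zeros \<open>w + \<eta> + n1 a1 + n2 a2 = 0\<close>, and the elementary parts for larger \<open>K\<close> are the partial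
  sums of the asymptotic expansion. The difference relation comes from telescoping in one of the
  two directions, which leaves Gauss's product for \<open>\<Gamma>\<close> together with Stirling's constant.
\<close>

section \<open>Formal solution of the mixed difference equation\<close>

text \<open>The formal identity becomes an estimate in the variable \<open>u = 1 / y\<close>: there
  the remainder is analytic at \<open>0\<close> and its power series vanishes below order
  \<open>K + 2\<close>, so Cauchy's estimates bound it by a constant that depends only on bounds for
  \<open>p\<close>, the shifts and the coefficients. Constants are explicit because uniformity is
  needed twice: in \<open>p\<close>, to differentiate termwise at \<open>p = 2\<close>, and in all
  parameters, for joint holomorphy.

  \<open>K = 3\<close> is the least cut-off that reaches \<open>s = 0\<close>, since convergence
  over the lattice needs \<open>Re p < K\<close>. The terms of index at least 3 are exactly those
  whose falling factorial vanishes at \<open>p = 2\<close>; after differentiation they are pure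
  negative powers of \<open>w\<close>.

  The obstacle is the principal branch. As \<eta> is arbitrary, \<open>Ln (y + \<eta>)\<close> may
  cross the cut at finitely many lattice points. Identities are therefore proved for exponentials of
  terms, and holomorphy for the reciprocal with finitely many factors kept without logarithms. Other
  parameters are reached by a rotation whose choice the conditions on logarithms make
  immaterial.\<close>

lemma vanishing_order_bound:
  fixes h :: "complex \<Rightarrow> complex"
  assumes hol: "h holomorphic_on ball 0 (2 * r)" and r: "r > 0"
    and bound: "\<And>u. norm u < 2 * r \<Longrightarrow> norm (h u) \<le> M"
    and F: "h has_fps_expansion F" and F0: "\<And>j. j < m \<Longrightarrow> fps_nth F j = 0"
    and u: "norm u \<le> r / 2"
  shows "norm (h u) \<le> 2 * M * (norm u / r) ^ m"
proof -
  define c where "c = (\<lambda>n. (deriv ^^ n) h 0 / fact n)"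
  have "M \<ge> norm (h 0)" using bound[of 0] r by simp
  then have M0: "M \<ge> 0" using norm_ge_zero order_trans by blast
  have c0: "c j = 0" if "j < m" for j
    using F0[OF that] fps_nth_fps_expansion[OF F, of j] by (simp add: c_def)
  have cb: "norm (c n) \<le> M / r ^ n" for n
  proof -
    have "norm ((deriv ^^ n) h 0) \<le> fact n * M / r ^ n"
      by (rule Cauchy_inequality)
         (use r bound in \<open>auto intro!: holomorphic_on_subset[OF hol] holomorphic_on_imp_continuous_on\<close>)
    then show ?thesis by (simp add: c_def norm_divide field_simps)
  qed
  have s: "(\<lambda>n. c n * u ^ n) sums h u"
    using holomorphic_power_series[OF hol, of u] u r by (simp add: c_def)
  define x where "x = norm u / r"
  have x: "0 \<le> x" "x \<le> 1/2" using u r by (auto simp: x_def field_simps)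
  \<comment> \<open>The Cauchy bounds on the circle of radius \<open>r\<close> dominate the tail by
    a geometric series of ratio \<open>x \<le> 1/2\<close>, whose sum supplies the factor 2 of the
    claim.\<close>
  have g: "(\<lambda>n. M * x ^ m * x ^ n) sums (M * x ^ m * (1 / (1 - x)))"
    by (intro sums_mult geometric_sums) (use x in auto)
  have s': "(\<lambda>n. c (n + m) * u ^ (n + m)) sums h u"
    using sums_split_initial_segment[OF s, of m] c0 by simp
  have "norm (h u) \<le> M * x ^ m * (1 / (1 - x))"
  proof -
    have tb: "norm (c (n + m) * u ^ (n + m)) \<le> M * x ^ m * x ^ n" for n
    proof -
      have "norm (c (n + m) * u ^ (n + m)) \<le> M / r ^ (n + m) * norm u ^ (n + m)"
        unfolding norm_mult norm_power by (intro mult_right_mono cb) auto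
      also have "\<dots> = M * x ^ m * x ^ n"
        by (simp add: x_def power_divide power_add mult_ac)
      finally show ?thesis .
    qed
    have "norm (h u) = norm (\<Sum>n. c (n + m) * u ^ (n + m))" using s' by (simp add: sums_iff)
    also have "\<dots> \<le> (\<Sum>n. M * x ^ m * x ^ n)"
      by (rule norm_suminf_le) (use tb g in \<open>auto simp: sums_iff\<close>)
    finally show ?thesis using g by (simp add: sums_iff)
  qed
  also have "\<dots> \<le> M * x ^ m * 2"
    by (intro mult_left_mono mult_nonneg_nonneg M0) (use x in \<open>auto simp: field_simps\<close>)
  finally show ?thesis by (simp add: x_def mult_ac)
qed

section \<open>Coefficients of the generating series\<close>

definition todd_coeff :: "nat \<Rightarrow> complex \<Rightarrow> complex \<Rightarrow> complex \<Rightarrow> complex" where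
  "todd_coeff k \<eta> a1 a2 = mult_bernoulli k \<eta> [a1, a2] / fact k"

text \<open>Falling factorial: \<open>ffact p k * y powr (p - of_nat k)\<close> is the k-th
  derivative of \<open>y powr p\<close>, so \<open>todd_sum\<close> is the truncated generating
  series evaluated at the derivation.\<close>

definition ffact :: "complex \<Rightarrow> nat \<Rightarrow> complex" where
  "ffact p k = (\<Prod>i<k. p - of_nat i)"

definition cross_diff :: "complex \<Rightarrow> complex \<Rightarrow> (complex \<Rightarrow> complex) \<Rightarrow> complex \<Rightarrow> complex" where
  "cross_diff a1 a2 f y = f (y + a1 + a2) - f (y + a1) - f (y + a2) + f y"

definition todd_sum :: "nat \<Rightarrow> complex \<Rightarrow> complex \<Rightarrow> complex \<Rightarrow> complex \<Rightarrow> complex \<Rightarrow> complex" where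
  "todd_sum K \<eta> a1 a2 p y = (\<Sum>k<K. todd_coeff k \<eta> a1 a2 * ffact p k * y powr (p - of_nat k))"

text \<open>The leading term is the numerator of the generating function, evaluated at the
  derivation and applied to \<open>y powr p\<close>: two derivatives followed by the shift by
  \<eta>.\<close>

definition todd_rem :: "nat \<Rightarrow> complex \<Rightarrow> complex \<Rightarrow> complex \<Rightarrow> complex \<Rightarrow> complex \<Rightarrow> complex" where
  "todd_rem K \<eta> a1 a2 p y = p * (p - 1) * (y + \<eta>) powr (p - 2) - cross_diff a1 a2 (todd_sum K \<eta> a1 a2 p) y"

lemma ffact_0 [simp]: "ffact p 0 = 1" and ffact_Suc: "ffact p (Suc k) = ffact p k * (p - of_nat k)"
  by (simp_all add: ffact_def)

lemma ffact_gbinomial: "ffact p k * ((p - of_nat k) gchoose j) = ffact p (k + j) / fact j"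
proof -
  have "ffact p (k + j) = ffact p k * (\<Prod>i<j. p - of_nat (k + i))"
    unfolding ffact_def by (induction j) (simp_all add: mult_ac)
  moreover have "((p - of_nat k) gchoose j) = (\<Prod>i<j. p - of_nat (k + i)) / fact j"
    by (simp add: gbinomial_prod_rev atLeast0LessThan diff_diff_eq)
  ultimately show ?thesis by simp
qed

lemma norm_ffact_le: "norm (ffact p k) \<le> (norm p + k) ^ k"
proof -
  have "norm (ffact p k) = (\<Prod>i<k. norm (p - of_nat i))" by (simp add: ffact_def prod_norm)
  also have "\<dots> \<le> (\<Prod>i<k. norm p + k)"
  proof (rule prod_mono, safe)
    fix i assume "i < k"
    have "norm (p - of_nat i) \<le> norm p + norm (of_nat i :: complex)" by (rule norm_triangle_ineq4)
    also have "\<dots> \<le> norm p + k" using \<open>i < k\<close> by simp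
    finally show "norm (p - of_nat i) \<le> norm p + k" .
  qed auto
  finally show ?thesis by simp
qed

text \<open>These are the Taylor coefficients, times \<open>fact j\<close>, of
  \<open>(exp (a1 * t) - 1) * (exp (a2 * t) - 1)\<close>. The summand \<open>0 ^ j\<close> is the
  constant 1 of the product, present only for \<open>j = 0\<close>.\<close>

definition cross_diff_coeff :: "complex \<Rightarrow> complex \<Rightarrow> nat \<Rightarrow> complex" where
  "cross_diff_coeff a1 a2 j = (a1 + a2) ^ j - a1 ^ j - a2 ^ j + 0 ^ j"

lemma cross_diff_coeff_simps [simp]: "cross_diff_coeff a1 a2 0 = 0" "cross_diff_coeff a1 a2 (Suc 0) = 0"
  by (simp_all add: cross_diff_coeff_def)

lemma fps_exp_minus_1_prod_nth:
  "fps_nth ((fps_exp a1 - 1) * (fps_exp a2 - 1)) j = cross_diff_coeff a1 a2 j / fact j"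
proof -
  have "(fps_exp a1 - 1) * (fps_exp a2 - 1) = fps_exp (a1 + a2) - fps_exp a1 - fps_exp a2 + 1"
    by (simp add: fps_exp_add_mult algebra_simps)
  then show ?thesis by (simp add: cross_diff_coeff_def diff_divide_distrib add_divide_distrib)
qed

lemma subdegree_fps_exp_minus_1:
  assumes "a \<noteq> (0 :: complex)" shows "subdegree (fps_exp a - 1) = 1" "fps_exp a - 1 \<noteq> 0"
proof -
  have n: "fps_nth (fps_exp a - 1) 1 \<noteq> 0" using assms by simp
  show "fps_exp a - 1 \<noteq> 0" using n by force
  show "subdegree (fps_exp a - 1) = 1"
    by (rule subdegreeI) (use n in auto)
qed

text \<open>Compares coefficients in quotient times denominator equals numerator; the division is
  exact because the denominator has order 2. The recursion drives the cancellation in the remainder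
  and determines the low coefficients.\<close>

lemma todd_coeff_convolution:
  assumes "a1 \<noteq> 0" "a2 \<noteq> 0"
  shows "(\<Sum>k\<le>m. todd_coeff k \<eta> a1 a2 * (cross_diff_coeff a1 a2 (m - k) / fact (m - k))) =
           (if m \<ge> 2 then \<eta> ^ (m - 2) / fact (m - 2) else 0)"
proof -
  define D where "D = (fps_exp a1 - 1) * (fps_exp a2 - 1)"
  define N where "N = fps_X ^ 2 * fps_exp \<eta>"
  have D0: "D \<noteq> 0" "subdegree D = 2"
    using subdegree_fps_exp_minus_1[OF assms(1)] subdegree_fps_exp_minus_1[OF assms(2)]
    by (simp_all add: D_def)
  have "D dvd N"
    using fps_dvd_iff[of D N] D0 by (auto simp: N_def subdegree_mult)
  then have e: "N div D * D = N" by simp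
  have b: "todd_coeff k \<eta> a1 a2 = fps_nth (N div D) k" for k
    by (simp add: todd_coeff_def mult_bernoulli_def N_def D_def numeral_2_eq_2)
  have Dn: "fps_nth D j = cross_diff_coeff a1 a2 j / fact j" for j
    unfolding D_def by (rule fps_exp_minus_1_prod_nth)
  have "fps_nth (N div D * D) m = (\<Sum>k\<le>m. todd_coeff k \<eta> a1 a2 * (cross_diff_coeff a1 a2 (m - k) / fact (m - k)))"
    by (simp add: fps_mult_nth b Dn atLeast0AtMost)
  moreover have "fps_nth N m = (if m \<ge> 2 then \<eta> ^ (m - 2) / fact (m - 2) else 0)"
    by (simp add: N_def fps_X_power_mult_nth)
  ultimately show ?thesis using e by simp
qed

definition todd_coeff1 :: "complex \<Rightarrow> complex \<Rightarrow> complex \<Rightarrow> complex" where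
  "todd_coeff1 \<eta> a1 a2 = (\<eta> - (a1 + a2) / 2) / (a1 * a2)"

definition todd_coeff2 :: "complex \<Rightarrow> complex \<Rightarrow> complex \<Rightarrow> complex" where
  "todd_coeff2 \<eta> a1 a2 = (\<eta>\<^sup>2 / 2 - \<eta> * (a1 + a2) / 2 + (a1\<^sup>2 + a2\<^sup>2) / 12 + a1 * a2 / 4) / (a1 * a2)"

lemma todd_coeff_explicit:
  assumes a: "a1 \<noteq> 0" "a2 \<noteq> 0"
  shows "todd_coeff 0 \<eta> a1 a2 = 1 / (a1 * a2)" "todd_coeff 1 \<eta> a1 a2 = todd_coeff1 \<eta> a1 a2" "todd_coeff 2 \<eta> a1 a2 = todd_coeff2 \<eta> a1 a2"
proof -
  note c = todd_coeff_convolution[OF a, of \<eta>]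
  have d2: "cross_diff_coeff a1 a2 2 = 2 * a1 * a2" by (simp add: cross_diff_coeff_def power2_eq_square algebra_simps)
  have d3: "cross_diff_coeff a1 a2 3 = 3 * a1 * a2 * (a1 + a2)"
    by (simp add: cross_diff_coeff_def power3_eq_cube algebra_simps)
  have d4: "cross_diff_coeff a1 a2 4 = 4 * a1 * a2 * (a1\<^sup>2 + a2\<^sup>2) + 6 * a1\<^sup>2 * a2\<^sup>2"
    by (simp add: cross_diff_coeff_def power4_eq_xxxx power2_eq_square algebra_simps)
  \<comment> \<open>The denominator starts with \<open>a1 * a2 * t ^ 2\<close>, so the recursion at
    \<open>m = k + 2\<close> isolates coefficient \<open>k\<close>.\<close>
  have 0: "todd_coeff 0 \<eta> a1 a2 * (a1 * a2) = 1"
    using c[of 2] by (simp add: numeral_2_eq_2 d2[unfolded numeral_2_eq_2])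
  then show "todd_coeff 0 \<eta> a1 a2 = 1 / (a1 * a2)" using a by (simp add: field_simps)
  have "todd_coeff 0 \<eta> a1 a2 * (cross_diff_coeff a1 a2 3 / 6) + todd_coeff 1 \<eta> a1 a2 * (cross_diff_coeff a1 a2 2 / 2) = \<eta>"
    using c[of 3] by (simp add: numeral_3_eq_3 numeral_2_eq_2 eval_nat_numeral)
  then have 1: "todd_coeff 1 \<eta> a1 a2 * (a1 * a2) = \<eta> - (a1 + a2) / 2"
  proof -
    assume "todd_coeff 0 \<eta> a1 a2 * (cross_diff_coeff a1 a2 3 / 6) + todd_coeff 1 \<eta> a1 a2 * (cross_diff_coeff a1 a2 2 / 2) = \<eta>"
    moreover have "todd_coeff 0 \<eta> a1 a2 * (cross_diff_coeff a1 a2 3 / 6) = (todd_coeff 0 \<eta> a1 a2 * (a1 * a2)) * ((a1 + a2) / 2)"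
      "todd_coeff 1 \<eta> a1 a2 * (cross_diff_coeff a1 a2 2 / 2) = todd_coeff 1 \<eta> a1 a2 * (a1 * a2)"
      unfolding d2 d3 by simp_all
    ultimately have "1 * ((a1 + a2) / 2) + todd_coeff 1 \<eta> a1 a2 * (a1 * a2) = \<eta>" by (simp only: 0)
    then show ?thesis by (simp add: eq_diff_eq add.commute)
  qed
  then show "todd_coeff 1 \<eta> a1 a2 = todd_coeff1 \<eta> a1 a2" using a by (simp add: todd_coeff1_def eq_divide_eq)
  have "todd_coeff 0 \<eta> a1 a2 * (cross_diff_coeff a1 a2 4 / 24) + todd_coeff 1 \<eta> a1 a2 * (cross_diff_coeff a1 a2 3 / 6)
           + todd_coeff 2 \<eta> a1 a2 * (cross_diff_coeff a1 a2 2 / 2) = \<eta>\<^sup>2 / 2"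
    using c[of 4] by (simp add: numeral_3_eq_3 numeral_2_eq_2 eval_nat_numeral)
  then have "todd_coeff 2 \<eta> a1 a2 * (a1 * a2) = \<eta>\<^sup>2 / 2 - \<eta> * (a1 + a2) / 2 + (a1\<^sup>2 + a2\<^sup>2) / 12 + a1 * a2 / 4"
    using 0 1 unfolding d2 d3 d4 by algebra
  then show "todd_coeff 2 \<eta> a1 a2 = todd_coeff2 \<eta> a1 a2" using a by (simp add: todd_coeff2_def eq_divide_eq)
qed

section \<open>Principal logarithms and powers under small perturbations\<close>

lemma one_plus_neq_0:
  fixes x :: complex assumes "norm x < 1" shows "1 + x \<noteq> 0"
proof
  assume "1 + x = 0"
  then have "x = - 1" by (simp add: add_eq_0_iff)
  then show False using assms by simp
qed

text \<open>Both logarithms on the right have imaginary part below \<pi>/2 in absolute value, so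
  their sum stays on the principal branch.\<close>

lemma Ln_add_rhp:
  assumes "Re y > 0" "norm (x / y) < 1"
  shows "Ln (y + x) = Ln y + Ln (1 + x / y)"
proof -
  have y0: "y \<noteq> 0" using assms by auto
  have "\<bar>Re (x / y)\<bar> < 1" using assms(2) abs_Re_le_cmod le_less_trans by blast
  then have r: "Re (1 + x / y) > 0" by simp
  then have nz: "1 + x / y \<noteq> 0" by force
  have "\<bar>Im (Ln y)\<bar> < pi / 2" using Re_Ln_pos_lt[OF y0] assms(1) by simp
  moreover have "\<bar>Im (Ln (1 + x / y))\<bar> < pi / 2" using Re_Ln_pos_lt[OF nz] r by simp
  ultimately have "Ln (y * (1 + x / y)) = Ln y + Ln (1 + x / y)"
    by (intro Ln_times_simple y0 nz) auto
  then show ?thesis using y0 by (simp add: distrib_left)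
qed

lemma add_powr_rhp:
  assumes "Re y > 0" "norm (x / y) < 1"
  shows "(y + x) powr q = y powr q * (1 + x / y) powr q"
proof -
  have y0: "y \<noteq> 0" using assms by auto
  have "1 + x / y \<noteq> 0" by (rule one_plus_neq_0[OF assms(2)])
  moreover from this have "y + x \<noteq> 0" using y0 by (simp add: field_simps)
  ultimately show ?thesis using y0 Ln_add_rhp[OF assms]
    by (simp add: powr_def exp_add [symmetric] algebra_simps)
qed

lemma norm_one_plus_powr_le:
  fixes x q :: complex
  assumes "norm x < 1 / 2" shows "norm ((1 + x) powr q) \<le> exp (norm q)"
proof -
  have "1 + x \<noteq> 0" using assms by (intro one_plus_neq_0) simp
  then have "norm ((1 + x) powr q) = exp (Re (q * Ln (1 + x)))" by (simp add: powr_def)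
  also have "Re (q * Ln (1 + x)) \<le> norm q * norm (Ln (1 + x))"
    using complex_Re_le_cmod[of "q * Ln (1 + x)"] by (simp add: norm_mult)
  also have "\<dots> \<le> norm q * 1"
    using norm_Ln_le[OF assms] assms by (intro mult_left_mono) auto
  finally show ?thesis by simp
qed

lemma norm_powr_le:
  assumes "y \<noteq> (0 :: complex)" shows "norm (y powr p) \<le> norm y powr Re p * exp (pi * norm p)"
proof -
  have "norm (y powr p) = exp (Re p * ln (norm y) - Im p * Im (Ln y))"
    using assms by (simp add: powr_def)
  also have "\<dots> \<le> exp (Re p * ln (norm y) + pi * norm p)"
  proof -
    have "\<bar>Im (Ln y)\<bar> \<le> pi" using mpi_less_Im_Ln[OF assms] Im_Ln_le_pi[OF assms] by linarith
    then have "\<bar>Im p * Im (Ln y)\<bar> \<le> norm p * pi"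
      unfolding abs_mult by (intro mult_mono abs_Im_le_cmod) auto
    then show ?thesis by (simp add: mult_ac)
  qed
  also have "\<dots> = norm y powr Re p * exp (pi * norm p)"
    using assms by (simp add: powr_def exp_add)
  finally show ?thesis .
qed

section \<open>The remainder in the variable \<open>1 / y\<close>\<close>

lemma one_plus_mult_powr_fps:
  fixes x q :: complex shows "(\<lambda>u. (1 + u * x) powr q) has_fps_expansion Abs_fps (\<lambda>j. (q gchoose j) * x ^ j)"
proof (rule has_fps_expansionI)
  have "((\<lambda>u. norm (u * x)) \<longlongrightarrow> norm (0 * x)) (nhds 0)"
    by (intro tendsto_intros filterlim_ident)
  then have "\<forall>\<^sub>F u in nhds 0. norm (u * x) < 1" by (rule order_tendstoD) auto
  then show "\<forall>\<^sub>F u in nhds 0. (\<lambda>n. fps_nth (Abs_fps (\<lambda>j. (q gchoose j) * x ^ j)) n * u ^ n)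
      sums (1 + u * x) powr q"
  proof eventually_elim
    case (elim u)
    then show ?case using gen_binomial_complex[of "u * x" q] by (simp add: power_mult_distrib mult_ac)
  qed
qed

text \<open>The remainder \<open>todd_rem\<close> at \<open>y\<close> is \<open>y\<^sup>p\<close> times this function at \<open>u = 1 / y\<close>.\<close>

definition scaled_rem :: "nat \<Rightarrow> complex \<Rightarrow> complex \<Rightarrow> complex \<Rightarrow> complex \<Rightarrow> complex \<Rightarrow> complex" where
  "scaled_rem K \<eta> a1 a2 p u = p * (p - 1) * (u ^ 2 * (1 + u * \<eta>) powr (p - 2)) -
     (\<Sum>k<K. todd_coeff k \<eta> a1 a2 * ffact p k * (u ^ k * ((1 + u * (a1 + a2)) powr (p - of_nat k)
        - (1 + u * a1) powr (p - of_nat k) - (1 + u * a2) powr (p - of_nat k)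
        + (1 + u * 0) powr (p - of_nat k))))"

text \<open>The coefficient of degree \<open>m\<close> carries the common factor
  \<open>ffact p m\<close>, and what is left is the recursion for the generating function.
  Truncation at \<open>K\<close> omits only indices \<open>k \<ge> K\<close>; there
  \<open>m - k \<le> 1\<close>, where the difference coefficients vanish. This is the source of the
  order \<open>K + 2\<close>.\<close>

lemma scaled_rem_vanishes:
  assumes "a1 \<noteq> 0" "a2 \<noteq> 0"
  obtains F where "scaled_rem K \<eta> a1 a2 p has_fps_expansion F" "\<And>j. j < K + 2 \<Longrightarrow> fps_nth F j = 0"
proof -
  define G where "G = (\<lambda>x q :: complex. Abs_fps (\<lambda>j. (q gchoose j) * x ^ j))"
  define F where "F = fps_const (p * (p - 1)) * (fps_X ^ 2 * G \<eta> (p - 2)) -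
    (\<Sum>k<K. fps_const (todd_coeff k \<eta> a1 a2 * ffact p k) * (fps_X ^ k * (G (a1 + a2) (p - of_nat k)
        - G a1 (p - of_nat k) - G a2 (p - of_nat k) + G 0 (p - of_nat k))))"
  \<comment> \<open>The trivial power of \<open>1 + u * 0\<close> in \<open>scaled_rem\<close> lets
    a single expansion rule treat all four corners of the parallelogram.\<close>
  have "scaled_rem K \<eta> a1 a2 p has_fps_expansion F"
    unfolding scaled_rem_def F_def G_def by (intro fps_expansion_intros one_plus_mult_powr_fps)
  moreover have "fps_nth F m = 0" if m: "m < K + 2" for m
  proof -
    have 1: "fps_nth (fps_const (p * (p - 1)) * (fps_X ^ 2 * G \<eta> (p - 2))) m =
        ffact p m * (if m \<ge> 2 then \<eta> ^ (m - 2) / fact (m - 2) else 0)"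
    proof (cases "m \<ge> 2")
      case True
      have "ffact p 2 = p * (p - 1)" by (simp add: numeral_2_eq_2 ffact_Suc)
      moreover have "2 + (m - 2) = m" using True by simp
      ultimately have "p * (p - 1) * ((p - 2) gchoose (m - 2)) = ffact p m / fact (m - 2)"
        using ffact_gbinomial[of p 2 "m - 2"] by (simp del: of_nat_numeral add: of_nat_numeral[where n="num.Bit0 num.One"])
      then have "p * (p - 1) * (((p - 2) gchoose (m - 2)) * \<eta> ^ (m - 2)) = ffact p m / fact (m - 2) * \<eta> ^ (m - 2)"
        by (simp only: mult.assoc[symmetric])
      then show ?thesis using True by (simp only: fps_mult_left_const_nth fps_X_power_mult_nth G_def fps_nth_Abs_fps) simp
    qed (simp add: fps_X_power_mult_nth)
    define t where "t = (\<lambda>k. todd_coeff k \<eta> a1 a2 * (cross_diff_coeff a1 a2 (m - k) / fact (m - k)))"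
    have 2: "fps_nth (fps_const (todd_coeff k \<eta> a1 a2 * ffact p k) * (fps_X ^ k * (G (a1 + a2) (p - of_nat k)
        - G a1 (p - of_nat k) - G a2 (p - of_nat k) + G 0 (p - of_nat k)))) m =
        (if k \<le> m then ffact p m * t k else 0)" for k
    proof (cases "k \<le> m")
      case True
      have "fps_nth (fps_const (todd_coeff k \<eta> a1 a2 * ffact p k) * (fps_X ^ k * (G (a1 + a2) (p - of_nat k)
        - G a1 (p - of_nat k) - G a2 (p - of_nat k) + G 0 (p - of_nat k)))) m =
         todd_coeff k \<eta> a1 a2 * (ffact p k * ((p - of_nat k) gchoose (m - k))) * cross_diff_coeff a1 a2 (m - k)"
        using True by (simp add: fps_X_power_mult_nth G_def cross_diff_coeff_def algebra_simps)
      then show ?thesis using True unfolding ffact_gbinomial by (simp add: t_def)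
    qed (simp add: fps_X_power_mult_nth)
    have "fps_nth F m = ffact p m * (if m \<ge> 2 then \<eta> ^ (m - 2) / fact (m - 2) else 0)
        - (\<Sum>k<K. if k \<le> m then ffact p m * t k else 0)"
      unfolding F_def fps_sub_nth fps_sum_nth 1 2 ..
    also have "(\<Sum>k<K. if k \<le> m then ffact p m * t k else 0) = (\<Sum>k\<le>m. ffact p m * t k)"
    proof -
      have "t k = 0" if "k \<ge> K" "k \<le> m" for k
      proof -
        have "m - k = 0 \<or> m - k = Suc 0" using that m by linarith
        then show ?thesis by (auto simp: t_def)
      qed
      then show ?thesis
        by (intro sum.mono_neutral_cong) (auto simp: not_less)
    qed
    also have "\<dots> = ffact p m * (if m \<ge> 2 then \<eta> ^ (m - 2) / fact (m - 2) else 0)"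
      unfolding sum_distrib_left [symmetric] t_def todd_coeff_convolution[OF assms] ..
    finally show ?thesis by simp
  qed
  ultimately show thesis using that by blast
qed

text \<open>One factor per loss in the next estimate: 2 from the vanishing order bound,
  \<open>exp (pi * P)\<close> from the argument of \<open>y\<close>, \<open>exp (P + K + 2)\<close>
  from the powers of \<open>1 + u * x\<close>, and 4 from the four corners. The shifts enter only
  through \<open>B\<close>.\<close>

definition rem_const :: "nat \<Rightarrow> real \<Rightarrow> real \<Rightarrow> real" where
  "rem_const K P B = 2 * exp (pi * P) * exp (P + K + 2) * (P * (P + 1) + 4 * K * (B * (P + K + 1) ^ K))"

lemma todd_rem_bound:
  assumes re: "Re a1 > 0" "Re a2 > 0" "Re y > 0"
    and A: "A \<ge> 1" "norm \<eta> \<le> A" "norm a1 \<le> A" "norm a2 \<le> A" "norm y \<ge> 16 * A"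
    and P: "norm p \<le> P" and B: "\<And>k. k < K \<Longrightarrow> norm (todd_coeff k \<eta> a1 a2) \<le> B"
  shows "norm (todd_rem K \<eta> a1 a2 p y) \<le> rem_const K P B * norm y powr Re p * (8 * A / norm y) ^ (K + 2)"
proof -
  define u where "u = 1 / y"
  \<comment> \<open>On the disc of radius \<open>2 * r = 1 / (4 * A)\<close> every shift of size at
    most \<open>2 * A\<close> gives \<open>norm (v * x) < 1 / 2\<close>, and
    \<open>norm y \<ge> 16 * A\<close> is exactly \<open>norm u \<le> r / 2\<close>.\<close>
  define r where "r = 1 / (8 * A)"
  have y0: "y \<noteq> 0" and a0: "a1 \<noteq> 0" "a2 \<noteq> 0" using re by auto
  have r0: "r > 0" using A by (simp add: r_def)
  have P0: "P \<ge> 0" using P norm_ge_zero order_trans by blast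
  have small: "norm (v * x) < 1 / 2" if "norm v < 2 * r" "norm x \<le> 2 * A" for v x :: complex
  proof -
    have "norm (v * x) \<le> norm v * (2 * A)"
      unfolding norm_mult by (intro mult_left_mono that) auto
    also have "\<dots> < 2 * r * (2 * A)" using that A by (intro mult_strict_right_mono) auto
    also have "\<dots> = 1 / 2" using A by (simp add: r_def)
    finally show ?thesis .
  qed
  have nb: "norm (a1 + a2) \<le> 2 * A" "norm a1 \<le> 2 * A" "norm a2 \<le> 2 * A" "norm \<eta> \<le> 2 * A"
    using A norm_triangle_ineq[of a1 a2] by linarith+
  have ur: "norm u \<le> r / 2" using A y0 by (auto simp: u_def r_def norm_divide field_simps)
  have u2: "norm u < 2 * r" using ur r0 by linarith
  have sp: "(y + x) powr q = y powr q * (1 + u * x) powr q" if "norm x \<le> 2 * A" for x q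
    using add_powr_rhp[OF re(3), of x q] small[OF u2 that] by (simp add: u_def)
  have yk: "y powr (p - of_nat k) = y powr p * u ^ k" for k
    using y0 by (simp add: powr_diff powr_nat u_def power_one_over)
  have e: "todd_rem K \<eta> a1 a2 p y = y powr p * scaled_rem K \<eta> a1 a2 p u"
  proof -
    have s3: "(y + a1 + a2) powr q = y powr q * (1 + u * (a1 + a2)) powr q" for q
      using sp[OF nb(1), of q] by (simp add: add.assoc)
    have DDs: "cross_diff a1 a2 (todd_sum K \<eta> a1 a2 p) y = (\<Sum>k<K. todd_coeff k \<eta> a1 a2 * ffact p k *
        ((y + a1 + a2) powr (p - of_nat k) - (y + a1) powr (p - of_nat k)
          - (y + a2) powr (p - of_nat k) + y powr (p - of_nat k)))"
      unfolding cross_diff_def todd_sum_def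
      by (simp add: sum.distrib [symmetric] sum_subtractf [symmetric] algebra_simps)
    show ?thesis
      unfolding todd_rem_def DDs scaled_rem_def s3 sp[OF nb(2)] sp[OF nb(3)] sp[OF nb(4)] yk
        yk[of 2, simplified]
      by (simp add: algebra_simps sum_distrib_left)
  qed
  define M where "M = exp (P + K + 2) * (P * (P + 1) + 4 * K * (B * (P + K + 1) ^ K))"
  have "norm (scaled_rem K \<eta> a1 a2 p u) \<le> 2 * M * (norm u / r) ^ (K + 2)"
  proof -
    obtain F where F: "scaled_rem K \<eta> a1 a2 p has_fps_expansion F" "\<And>j. j < K + 2 \<Longrightarrow> fps_nth F j = 0"
      using scaled_rem_vanishes[OF a0] by blast
    show ?thesis
    proof (rule vanishing_order_bound[OF _ r0 _ F ur])
      have "1 + v * x \<notin> \<real>\<^sub>\<le>\<^sub>0" if "norm v < 2 * r" "norm x \<le> 2 * A" for v x :: complex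
      proof -
        have "\<bar>Re (v * x)\<bar> < 1 / 2"
          using small[OF that] abs_Re_le_cmod[of "v * x"] by linarith
        then have "Re (1 + v * x) > 0" unfolding plus_complex.sel one_complex.sel by linarith
        then show ?thesis by (metis complex_nonpos_Reals_iff not_le)
      qed
      then show "scaled_rem K \<eta> a1 a2 p holomorphic_on ball 0 (2 * r)"
        unfolding scaled_rem_def using nb by (intro holomorphic_intros) auto
    next
      fix v :: complex assume v: "norm v < 2 * r"
      have "2 * r \<le> 1" using A(1) by (simp add: r_def field_simps)
      then have v1: "norm v \<le> 1" using v by linarith
      \<comment> \<open>The range goes up to \<open>K + 2\<close> so that the exponent
        \<open>p - 2\<close> of the leading term is covered for small \<open>K\<close> as
        well.\<close>
      have pw: "norm ((1 + v * x) powr (p - of_nat k)) \<le> exp (P + K + 2)"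
        if "norm x \<le> 2 * A" "k \<le> K + 2" for x k
      proof -
        have "norm (p - of_nat k) \<le> norm p + norm (of_nat k :: complex)" by (rule norm_triangle_ineq4)
        also have "\<dots> \<le> P + K + 2" using P that(2) by simp
        finally have "norm (p - of_nat k) \<le> P + K + 2" .
        with norm_one_plus_powr_le[OF small[OF v that(1)], of "p - of_nat k"]
        show ?thesis using order_trans exp_le_cancel_iff by blast
      qed
      let ?E = "exp (P + K + 2)"
      have 1: "norm (p * (p - 1) * (v ^ 2 * (1 + v * \<eta>) powr (p - 2))) \<le> P * (P + 1) * (1 * ?E)"
      proof -
        have "norm (p - 1) \<le> P + 1" using norm_triangle_ineq4[of p 1] P by simp
        then show ?thesis
          unfolding norm_mult norm_power
          using pw[OF nb(4), of 2] P P0 v1 by (intro mult_mono power_le_one) auto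
      qed
      have 2: "norm (todd_coeff k \<eta> a1 a2 * ffact p k * (v ^ k * ((1 + v * (a1 + a2)) powr (p - of_nat k)
        - (1 + v * a1) powr (p - of_nat k) - (1 + v * a2) powr (p - of_nat k)
        + (1 + v * 0) powr (p - of_nat k)))) \<le> B * (P + K + 1) ^ K * (1 * (4 * ?E))" if k: "k < K" for k
      proof -
        have "norm (ffact p k) \<le> (norm p + k) ^ k" by (rule norm_ffact_le)
        also have "\<dots> \<le> (P + K + 1) ^ k" using P k by (intro power_mono) auto
        also have "\<dots> \<le> (P + K + 1) ^ K" using P0 k by (intro power_increasing) auto
        finally have f: "norm (ffact p k) \<le> (P + K + 1) ^ K" .
        have k2: "k \<le> K + 2" using k by simp
        have q: "norm (b1 - b2 - b3 + b4) \<le> 4 * E"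
          if "norm b1 \<le> E" "norm b2 \<le> E" "norm b3 \<le> E" "norm b4 \<le> E" for b1 b2 b3 b4 :: complex and E
          using that norm_triangle_ineq[of "b1 - b2 - b3" b4] norm_triangle_ineq4[of "b1 - b2" b3]
            norm_triangle_ineq4[of b1 b2] by linarith
        have z: "norm (0 :: complex) \<le> 2 * A" using A by simp
        have g: "norm ((1 + v * (a1 + a2)) powr (p - of_nat k)
            - (1 + v * a1) powr (p - of_nat k) - (1 + v * a2) powr (p - of_nat k)
            + (1 + v * 0) powr (p - of_nat k)) \<le> 4 * ?E"
          by (intro q pw nb k2 z)
        have B0: "B \<ge> 0" using B[OF k] norm_ge_zero order_trans by blast
        show ?thesis
          unfolding norm_mult norm_power
          by (intro mult_mono f g B k power_le_one v1) (use B0 P0 in auto)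
      qed
      have "norm (scaled_rem K \<eta> a1 a2 p v) \<le> P * (P + 1) * (1 * ?E) + (\<Sum>k<K. B * (P + K + 1) ^ K * (1 * (4 * ?E)))"
        unfolding scaled_rem_def
        by (rule order_trans[OF norm_triangle_ineq4 add_mono[OF 1 order_trans[OF norm_sum sum_mono[OF 2]]]]) auto
      also have "\<dots> = M" by (simp add: M_def algebra_simps)
      finally show "norm (scaled_rem K \<eta> a1 a2 p v) \<le> M" .
    qed
  qed
  moreover have M0: "M \<ge> 0"
  proof (cases "K = 0")
    case False
    then have "B \<ge> 0" using B[of 0] norm_ge_zero order_trans by blast
    then show ?thesis using P0 by (simp add: M_def)
  qed (use P0 in \<open>simp add: M_def\<close>)
  moreover have "norm (y powr p) \<le> norm y powr Re p * exp (pi * P)"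
    using norm_powr_le[OF y0, of p] P
    by (smt (verit) exp_le_cancel_iff mult_left_mono pi_ge_zero powr_ge_zero)
  ultimately have "norm (todd_rem K \<eta> a1 a2 p y) \<le> norm y powr Re p * exp (pi * P) * (2 * M * (norm u / r) ^ (K + 2))"
    unfolding e norm_mult using r0 by (intro mult_mono) auto
  also have "norm u / r = 8 * A / norm y" by (simp add: u_def r_def norm_divide)
  finally show ?thesis by (simp add: rem_const_def M_def mult_ac)
qed

section \<open>Sums over the lattice\<close>

definition lat_pt :: "complex \<Rightarrow> complex \<Rightarrow> complex \<Rightarrow> nat \<times> nat \<Rightarrow> complex" where
  "lat_pt w a1 a2 n = w + of_nat (fst n) * a1 + of_nat (snd n) * a2"

definition lat_wt :: "nat \<times> nat \<Rightarrow> real" where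
  "lat_wt n = 1 + real (fst n) + real (snd n)"

lemma lat_wt_pos: "lat_wt n > 0" and lat_wt_nonneg [simp]: "lat_wt n \<ge> 0"
  by (simp_all add: lat_wt_def)

text \<open>Since \<open>(1 + i) * (1 + j) \<le> (1 + i + j)^2\<close>, the double series is
  dominated by a product of two simple series with exponent
  \<open>\<sigma> / 2 < - 1\<close>.\<close>

lemma lat_wt_powr_summable:
  assumes "\<sigma> < - 2" shows "(\<lambda>n. lat_wt n powr \<sigma>) summable_on UNIV"
proof -
  define g where "g = (\<lambda>i :: nat. (1 + real i) powr (\<sigma> / 2))"
  have "summable (\<lambda>i. real (Suc i) powr (\<sigma> / 2))"
    using assms by (subst summable_Suc_iff, subst summable_real_powr_iff) auto
  then have g: "summable g" by (simp add: g_def add.commute)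
  have g0: "g i \<ge> 0" for i by (simp add: g_def)
  have gs: "g summable_on UNIV" using g g0 by (simp add: summable_on_UNIV_nonneg_real_iff)
  have "(\<lambda>n. g (fst n) * g (snd n)) summable_on Sigma UNIV (\<lambda>_. UNIV)"
    by (rule summable_on_SigmaI[where g = "\<lambda>i. g i * infsum g UNIV"])
       (use gs g0 in \<open>auto intro!: has_sum_cmult_right has_sum_infsum summable_on_cmult_left\<close>)
  then have s: "(\<lambda>n. g (fst n) * g (snd n)) summable_on UNIV" by simp
  show ?thesis
  proof (rule summable_on_comparison_test[OF s])
    fix n :: "nat \<times> nat"
    have "(1 + real (fst n)) * (1 + real (snd n)) \<le> lat_wt n * lat_wt n"
      by (intro mult_mono) (auto simp: lat_wt_def)
    then have "(lat_wt n * lat_wt n) powr (\<sigma> / 2) \<le> ((1 + real (fst n)) * (1 + real (snd n))) powr (\<sigma> / 2)"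
      using assms by (intro powr_mono2') auto
    then show "lat_wt n powr \<sigma> \<le> g (fst n) * g (snd n)"
      by (simp add: g_def powr_mult powr_add [symmetric] lat_wt_nonneg)
  qed auto
qed

lemma finite_lat_wt_less:
  assumes "c > 0" shows "finite {n. c * lat_wt n < L}"
proof -
  have "{n. c * lat_wt n < L} \<subseteq> {..nat \<lceil>L / c\<rceil>} \<times> {..nat \<lceil>L / c\<rceil>}"
  proof
    fix n assume "n \<in> {n. c * lat_wt n < L}"
    then have "lat_wt n < L / c" using assms by (simp add: field_simps)
    then have "real (fst n) \<le> L / c" "real (snd n) \<le> L / c" by (auto simp: lat_wt_def)
    then have "fst n \<le> nat \<lceil>L / c\<rceil>" "snd n \<le> nat \<lceil>L / c\<rceil>" by linarith+
    then show "n \<in> {..nat \<lceil>L / c\<rceil>} \<times> {..nat \<lceil>L / c\<rceil>}" by (cases n) auto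
  qed
  then show ?thesis by (rule finite_subset) auto
qed

lemma lat_wt_dominated_abs_summable:
  fixes f :: "nat \<times> nat \<Rightarrow> complex"
  assumes "c > 0" "\<sigma> < - 2"
    and b: "\<And>n. c * lat_wt n \<ge> L \<Longrightarrow> norm (f n) \<le> C * lat_wt n powr \<sigma>"
  shows "(\<lambda>n. norm (f n)) summable_on UNIV"
proof -
  define F where "F = {n. c * lat_wt n < L}"
  have "(\<lambda>n. C * lat_wt n powr \<sigma>) summable_on (- F)"
    using summable_on_cmult_right[OF lat_wt_powr_summable[OF assms(2)]] summable_on_subset_banach by blast
  then have "(\<lambda>n. norm (f n)) summable_on (- F)"
    by (rule summable_on_comparison_test) (auto simp: F_def not_less b)
  moreover have "(\<lambda>n. norm (f n)) summable_on F"
    using finite_lat_wt_less[OF assms(1)] by (auto simp: F_def)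
  ultimately have "(\<lambda>n. norm (f n)) summable_on (- F \<union> F)" by (rule summable_on_Un_disjoint) auto
  then show ?thesis by simp
qed

text \<open>Telescoping needs unconditional sums over the lattice, whereas termwise differentiation
  and the infinite product are carried out for series over the naturals. Cantor's pairing function
  connects the two.\<close>

lemma sums_prod_decode:
  fixes f :: "nat \<times> nat \<Rightarrow> 'a :: banach"
  assumes "f summable_on UNIV"
  shows "(\<lambda>m. f (prod_decode m)) sums (\<Sum>\<^sub>\<infinity>n. f n)"
proof -
  have "((\<lambda>m. f (prod_decode m)) has_sum (\<Sum>\<^sub>\<infinity>n. f n)) UNIV"
    using assms has_sum_reindex_bij_betw[OF bij_prod_decode, of f "\<Sum>\<^sub>\<infinity>n. f n"] by simp
  then show ?thesis by (rule has_sum_imp_sums)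
qed

lemma lat_wt_prod_decode_summable:
  assumes "\<sigma> < - 2" shows "summable (\<lambda>m. lat_wt (prod_decode m) powr \<sigma>)"
  using sums_prod_decode[OF lat_wt_powr_summable[OF assms]] by (rule sums_summable)

lemma eventually_lat_wt_prod_decode:
  assumes "c > 0" shows "\<forall>\<^sub>F m in sequentially. c * lat_wt (prod_decode m) \<ge> L"
proof -
  have "finite {m. \<not> c * lat_wt (prod_decode m) \<ge> L}"
  proof (rule finite_subset)
    show "{m. \<not> c * lat_wt (prod_decode m) \<ge> L} \<subseteq> prod_encode ` {n. c * lat_wt n < L}"
      by (auto simp: not_le intro!: image_eqI[of _ _ "prod_decode _"])
  qed (use finite_lat_wt_less[OF assms] in auto)
  then have "\<forall>\<^sub>F m in cofinite. c * lat_wt (prod_decode m) \<ge> L" by (simp add: eventually_cofinite)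
  then show ?thesis by (simp add: cofinite_eq_sequentially)
qed

lemma lat_pt_lower:
  assumes "c \<le> Re w" "c \<le> Re a1" "c \<le> Re a2"
  shows "c * lat_wt n \<le> Re (lat_pt w a1 a2 n)"
proof -
  have "real (fst n) * c \<le> real (fst n) * Re a1" "real (snd n) * c \<le> real (snd n) * Re a2"
    by (intro mult_left_mono assms; simp)+
  then show ?thesis using assms by (simp add: lat_pt_def lat_wt_def algebra_simps)
qed

lemma norm_lat_pt_lower:
  assumes "c \<le> Re w" "c \<le> Re a1" "c \<le> Re a2"
  shows "c * lat_wt n \<le> norm (lat_pt w a1 a2 n)"
  using lat_pt_lower[OF assms] complex_Re_le_cmod order_trans by blast

lemma rem_const_nonneg:
  assumes "P \<ge> 0" "K = 0 \<or> B \<ge> 0" shows "rem_const K P B \<ge> 0"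
  using assms by (auto simp: rem_const_def)

text \<open>Uniform form of the estimate: \<open>Re p\<close> is raised to \<tau> and
  \<open>norm y\<close> lowered to \<open>L\<close>, the latter because the exponent
  \<open>\<tau> - K - 2\<close> is not positive.\<close>

lemma todd_rem_bound':
  assumes re: "Re a1 > 0" "Re a2 > 0" "Re y > 0"
    and A: "A \<ge> 1" "norm \<eta> \<le> A" "norm a1 \<le> A" "norm a2 \<le> A"
    and L: "16 * A \<le> L" "L \<le> norm y"
    and P: "norm p \<le> P" "Re p \<le> \<tau>" "\<tau> \<le> K + 2"
    and B: "\<And>k. k < K \<Longrightarrow> norm (todd_coeff k \<eta> a1 a2) \<le> B"
  shows "norm (todd_rem K \<eta> a1 a2 p y) \<le> rem_const K P B * (8 * A) ^ (K + 2) * L powr (\<tau> - real K - 2)"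
proof -
  have y1: "norm y \<ge> 1" "L > 0" using L A by auto
  have P0: "P \<ge> 0" using P norm_ge_zero order_trans by blast
  have B0: "K = 0 \<or> B \<ge> 0"
  proof (cases "K = 0")
    case False
    then show ?thesis using B[of 0] norm_ge_zero order_trans by blast
  qed simp
  have C0: "rem_const K P B \<ge> 0" by (rule rem_const_nonneg[OF P0 B0])
  have "norm (todd_rem K \<eta> a1 a2 p y) \<le> rem_const K P B * norm y powr Re p * (8 * A / norm y) ^ (K + 2)"
    using L by (intro todd_rem_bound re A P B) auto
  also have "\<dots> \<le> rem_const K P B * norm y powr \<tau> * (8 * A / norm y) ^ (K + 2)"
    using y1 A by (intro mult_right_mono mult_left_mono powr_mono P C0) auto
  also have "\<dots> = rem_const K P B * (8 * A) ^ (K + 2) * norm y powr (\<tau> - real (K + 2))"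
    using y1 by (simp only: powr_diff powr_realpow power_divide) (simp add: powr_realpow[symmetric] power_add)
  also have "\<dots> \<le> rem_const K P B * (8 * A) ^ (K + 2) * L powr (\<tau> - real (K + 2))"
    using y1 L A P by (intro mult_left_mono powr_mono2' mult_nonneg_nonneg C0) auto
  finally show ?thesis by (simp add: algebra_simps)
qed

lemma todd_rem_lat_pt_dominated:
  assumes c: "c > 0" "c \<le> Re w" "c \<le> Re a1" "c \<le> Re a2"
    and A: "A \<ge> 1" "norm \<eta> \<le> A" "norm a1 \<le> A" "norm a2 \<le> A"
    and n: "c * lat_wt n \<ge> 16 * A"
    and P: "norm p \<le> P" "Re p \<le> \<tau>" "\<tau> \<le> K + 2"
    and B: "\<And>k. k < K \<Longrightarrow> norm (todd_coeff k \<eta> a1 a2) \<le> B"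
  shows "norm (todd_rem K \<eta> a1 a2 p (lat_pt w a1 a2 n)) \<le>
      rem_const K P B * (8 * A) ^ (K + 2) * c powr (\<tau> - real K - 2) * lat_wt n powr (\<tau> - real K - 2)"
proof -
  have "Re (lat_pt w a1 a2 n) > 0" using lat_pt_lower[OF c(2-4), of n] c lat_wt_pos[of n]
    by (smt (verit) mult_pos_pos)
  then have "norm (todd_rem K \<eta> a1 a2 p (lat_pt w a1 a2 n)) \<le>
      rem_const K P B * (8 * A) ^ (K + 2) * (c * lat_wt n) powr (\<tau> - real K - 2)"
    using c norm_lat_pt_lower[OF c(2-4)] n by (intro todd_rem_bound' A P B) auto
  moreover have "(c * lat_wt n) powr (\<tau> - real K - 2) = c powr (\<tau> - real K - 2) * lat_wt n powr (\<tau> - real K - 2)"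
    using c by (simp add: powr_mult algebra_simps)
  ultimately show ?thesis by (simp only: mult.assoc)
qed

lemma lat_pt_constants:
  assumes "Re w > 0" "Re a1 > 0" "Re a2 > 0"
  obtains c A B where "c > 0" "c \<le> Re w" "c \<le> Re a1" "c \<le> Re a2"
    "A \<ge> 1" "norm \<eta> \<le> A" "norm a1 \<le> A" "norm a2 \<le> A" "\<And>k. k < K \<Longrightarrow> norm (todd_coeff k \<eta> a1 a2) \<le> B"
proof
  show "norm (todd_coeff k \<eta> a1 a2) \<le> (\<Sum>k<K. norm (todd_coeff k \<eta> a1 a2))" if "k < K" for k
    using that by (intro member_le_sum) auto
  show "0 < min (Re w) (min (Re a1) (Re a2))" using assms by simp
  show "1 \<le> Max {1, norm \<eta>, norm a1, norm a2}" "norm \<eta> \<le> Max {1, norm \<eta>, norm a1, norm a2}"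
    "norm a1 \<le> Max {1, norm \<eta>, norm a1, norm a2}" "norm a2 \<le> Max {1, norm \<eta>, norm a1, norm a2}"
    by (intro Max_ge; simp)+
qed auto

text \<open>The condition \<open>Re p < K\<close> pushes the exponent \<open>Re p - K - 2\<close>
  below \<open>- 2\<close>, the threshold for a two-dimensional lattice.\<close>

lemma todd_rem_abs_summable:
  assumes re: "Re w > 0" "Re a1 > 0" "Re a2 > 0" and p: "Re p < K"
  shows "(\<lambda>n. norm (todd_rem K \<eta> a1 a2 p (lat_pt w a1 a2 n))) summable_on UNIV"
proof -
  obtain c A B where *: "c > 0" "c \<le> Re w" "c \<le> Re a1" "c \<le> Re a2"
    "A \<ge> 1" "norm \<eta> \<le> A" "norm a1 \<le> A" "norm a2 \<le> A" "\<And>k. k < K \<Longrightarrow> norm (todd_coeff k \<eta> a1 a2) \<le> B"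
    by (rule lat_pt_constants[OF re, of \<eta> K]) (rule that)
  have "norm (todd_rem K \<eta> a1 a2 p (lat_pt w a1 a2 n)) \<le>
      rem_const K (norm p) B * (8 * A) ^ (K + 2) * c powr (Re p - real K - 2) * lat_wt n powr (Re p - real K - 2)"
    if "16 * A \<le> c * lat_wt n" for n
    by (rule todd_rem_lat_pt_dominated[OF *(1-8) that]) (use p *(9) in auto)
  moreover have "Re p - real K - 2 < - 2" using p by simp
  ultimately show ?thesis by (intro lat_wt_dominated_abs_summable[OF *(1), of "Re p - real K - 2"])
qed

section \<open>Telescoping over the lattice\<close>

lemma
  fixes f g :: "'i \<Rightarrow> 'b :: real_normed_vector"
  assumes f: "f summable_on A" and g: "g summable_on A"
  shows summable_on_diff: "(\<lambda>n. f n - g n) summable_on A"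
    and infsum_diff: "infsum (\<lambda>n. f n - g n) A = infsum f A - infsum g A"
proof -
  have m: "(\<lambda>n. - g n) summable_on A" using g by (simp add: summable_on_uminus)
  show "(\<lambda>n. f n - g n) summable_on A"
    using summable_on_add[OF f m] by simp
  show "infsum (\<lambda>n. f n - g n) A = infsum f A - infsum g A"
    using infsum_add[OF f m] by (simp add: infsum_uminus)
qed

text \<open>Only the direction \<open>a2\<close> is collapsed: each row telescopes to its first
  entry, and a series over the multiples of \<open>a1\<close> remains. Telescoping that series as
  well gives the version for mixed differences; leaving it gives the difference relation.\<close>

lemma D2_telescope:
  fixes V :: "complex \<Rightarrow> complex"
  assumes s: "(\<lambda>n. V (lat_pt w a1 a2 n) - V (lat_pt w a1 a2 n + a2)) summable_on UNIV"
    and lim: "\<And>i. (\<lambda>j. V (lat_pt w a1 a2 (i, j))) \<longlonglongrightarrow> 0"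
  shows "(\<lambda>i. V (w + of_nat i * a1)) sums (\<Sum>\<^sub>\<infinity>n. V (lat_pt w a1 a2 n) - V (lat_pt w a1 a2 n + a2))"
proof -
  define f where "f = (\<lambda>n. V (lat_pt w a1 a2 n) - V (lat_pt w a1 a2 n + a2))"
  have S: "(f has_sum infsum f UNIV) (Sigma UNIV (\<lambda>_. UNIV))" using s by (simp add: f_def)
  have row: "((\<lambda>j. f (i, j)) has_sum V (w + of_nat i * a1)) UNIV" for i
  proof -
    have "(\<lambda>(x, y). f (x, y)) summable_on Sigma UNIV (\<lambda>_. UNIV)"
      using S[THEN has_sum_imp_summable] by (simp add: case_prod_unfold)
    then have "(\<lambda>j. f (i, j)) summable_on UNIV"
      by (rule summable_on_SigmaD1[where x = i]) simp
    then obtain t where t: "((\<lambda>j. f (i, j)) has_sum t) UNIV" unfolding summable_on_def ..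
    have "(\<lambda>j. V (lat_pt w a1 a2 (i, j)) - V (lat_pt w a1 a2 (i, Suc j))) sums (V (lat_pt w a1 a2 (i, 0)) - 0)"
      by (rule telescope_sums'[OF lim])
    moreover have "V (lat_pt w a1 a2 (i, j)) - V (lat_pt w a1 a2 (i, Suc j)) = f (i, j)" for j
      by (simp add: f_def lat_pt_def algebra_simps)
    ultimately have "(\<lambda>j. f (i, j)) sums V (lat_pt w a1 a2 (i, 0))" by simp
    with has_sum_imp_sums[OF t] have "t = V (lat_pt w a1 a2 (i, 0))" by (rule sums_unique2)
    with t show ?thesis by (simp add: lat_pt_def)
  qed
  have "((\<lambda>i. V (w + of_nat i * a1)) has_sum infsum f UNIV) UNIV"
    by (rule has_sum_SigmaD[OF S]) (rule row)
  then show ?thesis unfolding f_def by (rule has_sum_imp_sums)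
qed

lemma cross_diff_telescope:
  fixes h :: "complex \<Rightarrow> complex"
  assumes s: "(\<lambda>n. cross_diff a1 a2 h (lat_pt w a1 a2 n)) summable_on UNIV"
    and lim: "\<And>i. (\<lambda>j. h (lat_pt w a1 a2 (i, j))) \<longlonglongrightarrow> 0"
    and lim': "(\<lambda>i. h (w + of_nat i * a1)) \<longlonglongrightarrow> 0"
  shows "(\<Sum>\<^sub>\<infinity>n. cross_diff a1 a2 h (lat_pt w a1 a2 n)) = h w"
proof -
  define V where "V = (\<lambda>y. h y - h (y + a1))"
  have e: "cross_diff a1 a2 h y = V y - V (y + a2)" for y
    by (simp add: cross_diff_def V_def algebra_simps)
  have "(\<lambda>i. V (w + of_nat i * a1)) sums (\<Sum>\<^sub>\<infinity>n. cross_diff a1 a2 h (lat_pt w a1 a2 n))"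
    unfolding e
  proof (rule D2_telescope)
    show "(\<lambda>n. V (lat_pt w a1 a2 n) - V (lat_pt w a1 a2 n + a2)) summable_on UNIV"
      using s by (simp add: e)
    show "(\<lambda>j. V (lat_pt w a1 a2 (i, j))) \<longlonglongrightarrow> 0" for i
      using tendsto_diff[OF lim[of i] lim[of "Suc i"]] by (simp add: V_def lat_pt_def algebra_simps)
  qed
  moreover have "(\<lambda>i. V (w + of_nat i * a1)) sums h w"
    using telescope_sums'[OF lim'] by (simp add: V_def algebra_simps)
  ultimately show ?thesis by (rule sums_unique2)
qed

lemma powr_tendsto_0:
  assumes "Re q < 0" "filterlim (\<lambda>n. norm (y n)) at_top F" "\<And>n. y n \<noteq> (0 :: complex)"
  shows "((\<lambda>n. y n powr q) \<longlongrightarrow> 0) F"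
proof (rule Lim_null_comparison)
  show "\<forall>\<^sub>F n in F. norm (y n powr q) \<le> norm (y n) powr Re q * exp (pi * norm q)"
    using norm_powr_le[OF assms(3)] by simp
  show "((\<lambda>n. norm (y n) powr Re q * exp (pi * norm q)) \<longlongrightarrow> 0) F"
    using assms by (intro tendsto_mult_left_zero tendsto_neg_powr)
qed

lemma filterlim_norm_lat_pt:
  assumes "Re w > 0" "Re a1 > 0" "Re a2 > 0"
  shows "filterlim (\<lambda>j. norm (lat_pt w a1 a2 (i, j))) at_top sequentially"
    and "filterlim (\<lambda>i. norm (w + of_nat i * a1)) at_top sequentially"
proof -
  obtain c where c: "c > 0" "c \<le> Re w" "c \<le> Re a1" "c \<le> Re a2"
    by (rule lat_pt_constants[OF assms, of 0 0]) (rule that)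
  have "filterlim (\<lambda>j. c * real j) at_top sequentially"
    by (rule filterlim_tendsto_pos_mult_at_top[OF tendsto_const c(1) filterlim_real_sequentially])
  note lim = filterlim_at_top_mono[OF this always_eventually]
  have "c * real j \<le> norm (lat_pt w a1 a2 (i, j))" for i j
    by (rule order_trans[OF _ norm_lat_pt_lower[OF c(2-4)]]) (use c in \<open>simp add: lat_wt_def\<close>)
  then show "filterlim (\<lambda>j. norm (lat_pt w a1 a2 (i, j))) at_top sequentially"
    by (intro lim allI)
  have "c * real i \<le> norm (w + of_nat i * a1)" for i
    using order_trans[OF _ norm_lat_pt_lower[OF c(2-4), of "(i, 0)"], of "c * real i"] c
    by (simp add: lat_wt_def lat_pt_def)
  then show "filterlim (\<lambda>i. norm (w + of_nat i * a1)) at_top sequentially"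
    by (intro lim allI)
qed

lemma lat_pt_neq_0:
  assumes "Re w > 0" "Re a1 > 0" "Re a2 > 0" shows "Re (lat_pt w a1 a2 n) > 0" "lat_pt w a1 a2 n \<noteq> 0"
proof -
  obtain c where c: "c > 0" "c \<le> Re w" "c \<le> Re a1" "c \<le> Re a2"
    by (rule lat_pt_constants[OF assms, of 0 0]) (rule that)
  have "0 < c * lat_wt n" using c lat_wt_pos by simp
  also have "\<dots> \<le> Re (lat_pt w a1 a2 n)" by (rule lat_pt_lower[OF c(2-4)])
  finally show "Re (lat_pt w a1 a2 n) > 0" .
  then show "lat_pt w a1 a2 n \<noteq> 0" by force
qed

text \<open>
  The factor \<open>p (p - 1) = (s - 1) (s - 2)\<close> removes the two poles, so this continues the double
  zeta function times that factor; the value does not depend on \<open>K\<close> as long as \<open>Re p < K\<close>.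
\<close>

definition zeta2_num_at :: "nat \<Rightarrow> complex \<Rightarrow> complex \<Rightarrow> complex \<Rightarrow> complex \<Rightarrow> complex \<Rightarrow> complex" where
  "zeta2_num_at K w \<eta> a1 a2 p = todd_sum K \<eta> a1 a2 p w + (\<Sum>\<^sub>\<infinity>n. todd_rem K \<eta> a1 a2 p (lat_pt w a1 a2 n))"

text \<open>Raising the cut-off moves one term \<open>h\<close> from the remainder to the elementary
  part. The remainders lose its mixed difference, whose lattice sum is \<open>h w\<close> because
  \<open>h\<close> decays when \<open>Re p < K\<close>.\<close>

lemma zeta2_num_at_Suc:
  assumes re: "Re w > 0" "Re a1 > 0" "Re a2 > 0" and p: "Re p < K"
  shows "zeta2_num_at (Suc K) w \<eta> a1 a2 p = zeta2_num_at K w \<eta> a1 a2 p"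
proof -
  define h where "h = (\<lambda>y. todd_coeff K \<eta> a1 a2 * ffact p K * y powr (p - of_nat K))"
  have todd_sum: "todd_sum (Suc K) \<eta> a1 a2 p y = todd_sum K \<eta> a1 a2 p y + h y" for y
    by (simp add: todd_sum_def h_def)
  have e: "cross_diff a1 a2 h y = todd_rem K \<eta> a1 a2 p y - todd_rem (Suc K) \<eta> a1 a2 p y" for y
    by (simp add: todd_rem_def cross_diff_def todd_sum)
  have s1: "(\<lambda>n. todd_rem K \<eta> a1 a2 p (lat_pt w a1 a2 n)) summable_on UNIV"
    by (rule abs_summable_summable[OF todd_rem_abs_summable[OF re p]])
  have s2: "(\<lambda>n. todd_rem (Suc K) \<eta> a1 a2 p (lat_pt w a1 a2 n)) summable_on UNIV"
    by (rule abs_summable_summable[OF todd_rem_abs_summable[OF re]]) (use p in simp)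
  have z: "(\<lambda>j. h (y j)) \<longlonglongrightarrow> 0"
    if "filterlim (\<lambda>j. norm (y j)) at_top sequentially" "\<And>j. y j \<noteq> 0" for y
    unfolding h_def by (intro tendsto_mult_right_zero powr_tendsto_0 that) (use p in auto)
  have "(\<Sum>\<^sub>\<infinity>n. cross_diff a1 a2 h (lat_pt w a1 a2 n)) = h w"
  proof (rule cross_diff_telescope)
    show "(\<lambda>n. cross_diff a1 a2 h (lat_pt w a1 a2 n)) summable_on UNIV"
      unfolding e by (intro summable_on_diff s1 s2)
    show "(\<lambda>j. h (lat_pt w a1 a2 (i, j))) \<longlonglongrightarrow> 0" for i
      by (intro z filterlim_norm_lat_pt[OF re] lat_pt_neq_0[OF re])
    have "w + of_nat i * a1 = lat_pt w a1 a2 (i, 0)" for i by (simp add: lat_pt_def)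
    then show "(\<lambda>i. h (w + of_nat i * a1)) \<longlonglongrightarrow> 0"
      using filterlim_norm_lat_pt(2)[OF re] lat_pt_neq_0(2)[OF re] by (intro z) metis+
  qed
  then show ?thesis
    unfolding zeta2_num_at_def todd_sum e infsum_diff[OF s1 s2] by (simp add: algebra_simps)
qed

lemma zeta2_num_at_eq:
  assumes re: "Re w > 0" "Re a1 > 0" "Re a2 > 0" and p: "Re p < K" and K: "K \<le> K'"
  shows "zeta2_num_at K' w \<eta> a1 a2 p = zeta2_num_at K w \<eta> a1 a2 p"
  using K
proof (induction K' rule: dec_induct)
  case (step m)
  then show ?case using zeta2_num_at_Suc[OF re, of p m] p by auto
qed simp

section \<open>Continuation of the double zeta function\<close>

text \<open>The base \<open>c = 0\<close> matters, because \<open>y + \<eta>\<close> may vanish: the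
  power is then constantly 0, hence still holomorphic in the exponent.\<close>

lemma const_powr_holomorphic: "(\<lambda>p. c powr (p - d)) holomorphic_on A"
proof (cases "c = 0")
  case False
  then have "(\<lambda>p. c powr (p - d)) = (\<lambda>p. exp ((p - d) * Ln c))" by (simp add: powr_def)
  then show ?thesis by (simp add: holomorphic_intros)
qed simp

lemma ffact_holomorphic: "(\<lambda>p. ffact p k) holomorphic_on A"
  unfolding ffact_def by (intro holomorphic_intros)

lemma todd_sum_holomorphic: "(\<lambda>p. todd_sum K \<eta> a1 a2 p y) holomorphic_on A"
  unfolding todd_sum_def by (intro holomorphic_intros const_powr_holomorphic ffact_holomorphic)

lemma todd_rem_holomorphic: "(\<lambda>p. todd_rem K \<eta> a1 a2 p y) holomorphic_on A"
  unfolding todd_rem_def cross_diff_def by (intro holomorphic_intros const_powr_holomorphic todd_sum_holomorphic)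

text \<open>Besides differentiability it records that the termwise derivatives sum to the
  derivative, which is what the passage to logarithms at \<open>p = 2\<close> uses.\<close>

lemma todd_rem_sum_has_derivative:
  assumes re: "Re w > 0" "Re a1 > 0" "Re a2 > 0" and p: "Re p < K"
  shows "\<exists>D. ((\<lambda>p. \<Sum>\<^sub>\<infinity>n. todd_rem K \<eta> a1 a2 p (lat_pt w a1 a2 n)) has_field_derivative D) (at p) \<and>
     (\<lambda>m. deriv (\<lambda>p. todd_rem K \<eta> a1 a2 p (lat_pt w a1 a2 (prod_decode m))) p) sums D"
proof -
  define S where "S = {p. Re p < real K}"
  have S: "open S" unfolding S_def by (rule open_halfspace_Re_lt)
  obtain c A B where *: "c > 0" "c \<le> Re w" "c \<le> Re a1" "c \<le> Re a2"
    "A \<ge> 1" "norm \<eta> \<le> A" "norm a1 \<le> A" "norm a2 \<le> A" "\<And>k. k < K \<Longrightarrow> norm (todd_coeff k \<eta> a1 a2) \<le> B"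
    by (rule lat_pt_constants[OF re, of \<eta> K]) (rule that)
  define f where "f = (\<lambda>m p. todd_rem K \<eta> a1 a2 p (lat_pt w a1 a2 (prod_decode m)))"
  have "\<exists>g g'. \<forall>x\<in>S. (\<lambda>m. f m x) sums g x \<and> (\<lambda>m. deriv (f m) x) sums g' x \<and>
      (g has_field_derivative g' x) (at x)"
  proof (rule series_and_derivative_comparison_local[OF S])
    show "(f m has_field_derivative deriv (f m) x) (at x)" for m x
      using todd_rem_holomorphic[of K \<eta> a1 a2 "lat_pt w a1 a2 (prod_decode m)" UNIV]
      by (simp add: f_def holomorphic_derivI)
  next
    fix x assume "x \<in> S"
    \<comment> \<open>Half the distance to the line \<open>Re p = K\<close>, so that the dominating
      exponent \<open>\<tau> - K - 2\<close> is below \<open>- 2\<close> on the whole disc.\<close>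
    define d where "d = (K - Re x) / 2"
    define \<tau> where "\<tau> = Re x + d"
    have d: "d > 0" "\<tau> < K" using \<open>x \<in> S\<close> by (auto simp: d_def \<tau>_def S_def field_simps)
    define C where "C = rem_const K (norm x + d) B * (8 * A) ^ (K + 2) * c powr (\<tau> - real K - 2)"
    show "\<exists>d h. 0 < d \<and> summable h \<and> (\<forall>\<^sub>F m in sequentially. \<forall>y\<in>ball x d \<inter> S. norm (f m y) \<le> h m)"
    proof (intro exI conjI)
      show "summable (\<lambda>m. C * lat_wt (prod_decode m) powr (\<tau> - real K - 2))"
        using d by (intro summable_mult lat_wt_prod_decode_summable) auto
      show "\<forall>\<^sub>F m in sequentially. \<forall>y\<in>ball x d \<inter> S.
          norm (f m y) \<le> C * lat_wt (prod_decode m) powr (\<tau> - real K - 2)"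
        using eventually_lat_wt_prod_decode[OF *(1), of "16 * A"]
      proof eventually_elim
        case (elim m)
        show ?case
        proof
          fix y assume "y \<in> ball x d \<inter> S"
          then have y: "norm (y - x) \<le> d" by (simp add: dist_norm norm_minus_commute)
          have 1: "norm y \<le> norm x + d" using y norm_triangle_sub[of y x] by linarith
          have 2: "Re y \<le> \<tau>" using y complex_Re_le_cmod[of "y - x"] by (simp add: \<tau>_def)
          show "norm (f m y) \<le> C * lat_wt (prod_decode m) powr (\<tau> - real K - 2)"
            unfolding f_def C_def
            by (rule todd_rem_lat_pt_dominated[OF *(1-8) elim 1 2]) (use d *(9) in auto)
        qed
      qed
    qed (rule d)
  qed
  then obtain g g' where g: "\<And>x. x \<in> S \<Longrightarrow> (\<lambda>m. f m x) sums g x"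
    "\<And>x. x \<in> S \<Longrightarrow> (\<lambda>m. deriv (f m) x) sums g' x"
    "\<And>x. x \<in> S \<Longrightarrow> (g has_field_derivative g' x) (at x)" by blast
  have ge: "g x = (\<Sum>\<^sub>\<infinity>n. todd_rem K \<eta> a1 a2 x (lat_pt w a1 a2 n))" if "x \<in> S" for x
  proof -
    have "(\<lambda>n. todd_rem K \<eta> a1 a2 x (lat_pt w a1 a2 n)) summable_on UNIV"
      by (rule abs_summable_summable[OF todd_rem_abs_summable[OF re]]) (use that in \<open>simp add: S_def\<close>)
    from sums_prod_decode[OF this] g(1)[OF that] show ?thesis
      unfolding f_def by (metis sums_unique2)
  qed
  have pS: "p \<in> S" using p by (simp add: S_def)
  have "((\<lambda>p. \<Sum>\<^sub>\<infinity>n. todd_rem K \<eta> a1 a2 p (lat_pt w a1 a2 n)) has_field_derivative g' p) (at p)"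
    by (rule has_field_derivative_transform_within_open[OF g(3)[OF pS] S pS ge])
  with g(2)[OF pS] show ?thesis unfolding f_def by blast
qed

lemma zeta2_num_at_holomorphic:
  assumes "Re w > 0" "Re a1 > 0" "Re a2 > 0"
  shows "(\<lambda>p. zeta2_num_at K w \<eta> a1 a2 p) holomorphic_on {p. Re p < K}"
proof -
  have "(\<lambda>p. \<Sum>\<^sub>\<infinity>n. todd_rem K \<eta> a1 a2 p (lat_pt w a1 a2 n)) holomorphic_on {p. Re p < K}"
    unfolding holomorphic_on_open[OF open_halfspace_Re_lt]
    using todd_rem_sum_has_derivative[OF assms, of _ K \<eta>] by blast
  then show ?thesis unfolding zeta2_num_at_def by (intro holomorphic_intros todd_sum_holomorphic)
qed

text \<open>Glues the continuations to half-planes into one entire function; the cut-off only has to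
  exceed \<open>Re p\<close>.\<close>

definition zeta2_num :: "complex \<Rightarrow> complex \<Rightarrow> complex \<Rightarrow> complex \<Rightarrow> complex \<Rightarrow> complex" where
  "zeta2_num w \<eta> a1 a2 p = zeta2_num_at (nat \<lceil>norm p\<rceil> + 1) w \<eta> a1 a2 p"

lemma zeta2_num_eq:
  assumes re: "Re w > 0" "Re a1 > 0" "Re a2 > 0" and p: "Re p < K"
  shows "zeta2_num w \<eta> a1 a2 p = zeta2_num_at K w \<eta> a1 a2 p"
proof -
  define K' where "K' = nat \<lceil>norm p\<rceil> + 1"
  have p': "Re p < K'" using complex_Re_le_cmod[of p] unfolding K'_def by linarith
  have "zeta2_num_at (max K K') w \<eta> a1 a2 p = zeta2_num_at K w \<eta> a1 a2 p" by (rule zeta2_num_at_eq[OF re p]) simp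
  moreover have "zeta2_num_at (max K K') w \<eta> a1 a2 p = zeta2_num_at K' w \<eta> a1 a2 p" by (rule zeta2_num_at_eq[OF re p']) simp
  ultimately show ?thesis by (simp add: zeta2_num_def K'_def)
qed

lemma zeta2_num_holomorphic:
  assumes re: "Re w > 0" "Re a1 > 0" "Re a2 > 0"
  shows "zeta2_num w \<eta> a1 a2 holomorphic_on UNIV"
  unfolding holomorphic_on_def
proof
  fix p :: complex
  define K where "K = nat \<lceil>norm p\<rceil> + 1"
  have S: "open {p. Re p < K}" by (rule open_halfspace_Re_lt)
  have p: "p \<in> {p. Re p < K}" using complex_Re_le_cmod[of p] unfolding K_def mem_Collect_eq by linarith
  have "(\<lambda>p. zeta2_num_at K w \<eta> a1 a2 p) field_differentiable at p"
    using zeta2_num_at_holomorphic[OF re, of K \<eta>] S p holomorphic_on_imp_differentiable_at by blast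
  then obtain D where "((\<lambda>p. zeta2_num_at K w \<eta> a1 a2 p) has_field_derivative D) (at p)"
    by (auto simp: field_differentiable_def)
  then have "(zeta2_num w \<eta> a1 a2 has_field_derivative D) (at p)"
    by (rule has_field_derivative_transform_within_open[OF _ S p]) (simp add: zeta2_num_eq[OF re])
  then show "zeta2_num w \<eta> a1 a2 field_differentiable at p within UNIV"
    by (auto simp: field_differentiable_def)
qed

text \<open>The identity theorem, applied to the difference with singularities removed, gives
  equality around every point but not at it. The normalisation settles the point itself: the value
  is the limit off the poles and 0 at a pole.\<close>

lemma nicely_meromorphic_eqI:
  assumes f: "f nicely_meromorphic_on UNIV" and g: "g nicely_meromorphic_on UNIV"
    and eq: "\<exists>\<^sub>F z in at z0. f z = g z"
  shows "f = g"
proof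
  fix z
  have m: "(\<lambda>z. f z - g z) meromorphic_on UNIV"
    using f g by (auto simp: nicely_meromorphic_on_def intro!: meromorphic_intros)
  define h where "h = remove_sings (\<lambda>z. f z - g z)"
  have h: "h nicely_meromorphic_on UNIV" unfolding h_def by (rule remove_sings_nicely_meromorphic[OF m])
  have ev: "\<forall>\<^sub>F w in at z. h w = f w - g w" for z
    unfolding h_def
    by (intro eventually_remove_sings_eq_at meromorphic_on_isolated_singularity meromorphic_on_subset[OF m]) auto
  have "\<exists>\<^sub>F w in at z0. h w = 0"
    using frequently_eventually_frequently[OF eq ev[of z0]] by (rule frequently_elim1) auto
  then have h0: "h w = 0" for w
    by (rule frequently_eq_meromorphic_imp_constant[OF _ h]) auto
  have e: "\<forall>\<^sub>F w in at z. f w = g w" using ev[of z] by eventually_elim (simp add: h0)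
  have pole: "is_pole f z \<longleftrightarrow> is_pole g z" by (rule is_pole_cong[OF e refl])
  show "f z = g z"
  proof (cases "is_pole f z")
    case True
    then have "\<not> f \<midarrow>z\<rightarrow> c" "\<not> g \<midarrow>z\<rightarrow> c" for c
      using pole not_tendsto_and_filterlim_at_infinity[of "at z"] by (auto simp: is_pole_def)
    then have "f z = 0" "g z = 0" using f g by (auto simp: nicely_meromorphic_on_def)
    then show ?thesis by simp
  next
    case False
    then have "f \<midarrow>z\<rightarrow> f z" "g \<midarrow>z\<rightarrow> g z"
      using f g pole by (auto simp: nicely_meromorphic_on_def)
    moreover from this(1) have "g \<midarrow>z\<rightarrow> f z" using e by (rule Lim_transform_eventually)
    ultimately show ?thesis using LIM_unique by blast
  qed
qed

lemma zeta2_eq: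
  assumes re: "Re w > 0" "Re a1 > 0" "Re a2 > 0" and s: "s \<noteq> 1" "s \<noteq> 2" "Re s > 2 - real K"
  shows "zeta2 s (w + \<eta>) a1 a2 = zeta2_num_at K w \<eta> a1 a2 (2 - s) / ((s - 1) * (s - 2))"
proof -
  define f0 where "f0 = (\<lambda>s. zeta2_num w \<eta> a1 a2 (2 - s) / ((s - 1) * (s - 2)))"
  define f where "f = remove_sings f0"
  define S where "S = (\<lambda>s. \<Sum>\<^sub>\<infinity>(n1, n2)\<in>(UNIV :: (nat \<times> nat) set).
                    (w + \<eta> + of_nat n1 * a1 + of_nat n2 * a2) powr (- s))"
  have Z: "(\<lambda>s. zeta2_num w \<eta> a1 a2 (2 - s)) holomorphic_on A" for A
  proof -
    have "(\<lambda>s :: complex. 2 - s) holomorphic_on A" by (intro holomorphic_intros)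
    from holomorphic_on_compose_gen[OF this zeta2_num_holomorphic[OF re]] show ?thesis by (simp add: o_def)
  qed
  have "f0 meromorphic_on UNIV"
    unfolding f0_def using Z[of UNIV]
    by (intro meromorphic_intros analytic_on_imp_meromorphic_on) (auto simp: analytic_on_open)
  then have nm: "f nicely_meromorphic_on UNIV"
    unfolding f_def by (rule remove_sings_nicely_meromorphic)
  have f_eq: "f s = f0 s" if "s \<noteq> 1" "s \<noteq> 2" for s
  proof -
    have "f0 holomorphic_on - {1, 2}" unfolding f0_def by (intro holomorphic_intros Z) auto
    then have "f0 analytic_on - {1, 2}"
      by (subst analytic_on_open) (auto intro!: open_Compl finite_imp_closed)
    then have "f0 analytic_on {s}" by (rule analytic_on_subset) (use that in auto)
    then show ?thesis by (simp add: f_def)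
  qed
  have fS: "f s = S s" if s: "Re s > 2" for s
  proof -
    have s12: "s \<noteq> 1" "s \<noteq> 2" using s by auto
    \<comment> \<open>For \<open>K = 0\<close> the elementary part is empty and the remainder is the
      leading term alone. In the half-plane of convergence the construction thus returns the
      defining series times \<open>p * (p - 1) = (s - 1) * (s - 2)\<close>.\<close>
    have "zeta2_num w \<eta> a1 a2 (2 - s) = zeta2_num_at 0 w \<eta> a1 a2 (2 - s)" using s by (intro zeta2_num_eq re) simp
    also have "\<dots> = (\<Sum>\<^sub>\<infinity>n. (s - 1) * (s - 2) * (lat_pt w a1 a2 n + \<eta>) powr (- s))"
      by (simp add: zeta2_num_at_def todd_sum_def todd_rem_def cross_diff_def algebra_simps)
    also have "\<dots> = (s - 1) * (s - 2) * (\<Sum>\<^sub>\<infinity>n. (lat_pt w a1 a2 n + \<eta>) powr (- s))"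
      by (rule infsum_cmult_right')
    also have "(\<Sum>\<^sub>\<infinity>n. (lat_pt w a1 a2 n + \<eta>) powr (- s)) = S s"
      unfolding S_def by (intro infsum_cong) (auto simp: lat_pt_def algebra_simps)
    finally show ?thesis using s12 by (simp add: f_eq f0_def)
  qed
  have "zeta2 s (w + \<eta>) a1 a2 = (THE f. f nicely_meromorphic_on UNIV \<and> (\<forall>s. Re s > 2 \<longrightarrow> f s = S s)) s" for s
    unfolding zeta2_def S_def ..
  also have "(THE f. f nicely_meromorphic_on UNIV \<and> (\<forall>s. Re s > 2 \<longrightarrow> f s = S s)) = f"
  proof (rule the_equality)
    show "f nicely_meromorphic_on UNIV \<and> (\<forall>s. Re s > 2 \<longrightarrow> f s = S s)" using nm fS by blast
  next
    fix g assume g: "g nicely_meromorphic_on UNIV \<and> (\<forall>s. Re s > 2 \<longrightarrow> g s = S s)"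
    have "\<forall>\<^sub>F s in at 3. s \<in> {s. Re s > 2}"
      by (intro eventually_at_in_open' open_halfspace_Re_gt) auto
    then have "\<forall>\<^sub>F s in at 3. g s = f s" by eventually_elim (use g fS in auto)
    then have "\<exists>\<^sub>F s in at 3. g s = f s" by (rule eventually_frequently[rotated]) simp
    then show "g = f" using g nm by (intro nicely_meromorphic_eqI) auto
  qed
  also have "f s = zeta2_num w \<eta> a1 a2 (2 - s) / ((s - 1) * (s - 2))" using s by (simp add: f_eq f0_def)
  also have "zeta2_num w \<eta> a1 a2 (2 - s) = zeta2_num_at K w \<eta> a1 a2 (2 - s)" using s by (intro zeta2_num_eq re) simp
  finally show ?thesis .
qed

section \<open>The derivative at zero\<close>

primrec ffact_deriv :: "nat \<Rightarrow> complex" where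
  "ffact_deriv 0 = 0"
| "ffact_deriv (Suc k) = ffact_deriv k * (2 - of_nat k) + ffact 2 k"

lemma ffact_has_derivative: "((\<lambda>p. ffact p k) has_field_derivative ffact_deriv k) (at 2)"
proof (induction k)
  case 0
  have "(\<lambda>p. ffact p 0) = (\<lambda>_. 1)" by (simp add: fun_eq_iff)
  then show ?case by simp
next
  case (Suc k)
  show ?case unfolding ffact_Suc ffact_deriv.simps by (rule derivative_eq_intros Suc refl)+ simp
qed

text \<open>From index 3 on the product contains \<open>p - 2\<close>, so it vanishes at 2 and its
  derivative there is the product of the other factors, 2, 1 and the numbers from -1 down to
  \<open>- k\<close>.\<close>

lemma ffact_2_values: "ffact 2 (k + 3) = 0" "ffact_deriv (k + 3) = 2 * (- 1) ^ k * fact k"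
proof -
  have *: "ffact 2 0 = 1" "ffact 2 1 = 2" "ffact 2 2 = 2" "ffact 2 3 = 0"
    by (simp_all add: ffact_Suc numeral_2_eq_2 numeral_3_eq_3)
  show z: "ffact 2 (k + 3) = 0" for k
    by (induction k) (simp_all only: add_Suc ffact_Suc add_0 * mult_zero_left)
  have **: "ffact_deriv 3 = 2" by (simp add: ffact_Suc numeral_3_eq_3)
  show "ffact_deriv (k + 3) = 2 * (- 1) ^ k * fact k"
  proof (induction k)
    case (Suc k)
    have "ffact_deriv (Suc k + 3) = ffact_deriv (k + 3) * (2 - of_nat (k + 3))"
      unfolding add_Suc ffact_deriv.simps z by simp
    then show ?case unfolding Suc.IH by (simp add: algebra_simps)
  qed (simp add: **)
qed

text \<open>
  The derivative at \<open>s = 0\<close> of \<open>ffact p k * y powr (p - k) / ((s - 1) * (s - 2))\<close>, where \<open>p = 2 - s\<close>.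
\<close>

definition log_term :: "nat \<Rightarrow> complex \<Rightarrow> complex" where
  "log_term k y = (if k = 0 then y ^ 2 * (3 / 4 - Ln y / 2) else if k = 1 then y * (1 - Ln y)
     else if k = 2 then - Ln y else (- 1) ^ k * fact (k - 3) / y ^ (k - 2))"

definition log_todd :: "nat \<Rightarrow> complex \<Rightarrow> complex \<Rightarrow> complex \<Rightarrow> complex \<Rightarrow> complex" where
  "log_todd K \<eta> a1 a2 y = (\<Sum>k<K. todd_coeff k \<eta> a1 a2 * log_term k y)"

text \<open>The image of \<open>todd_rem\<close> under division by \<open>(s - 1) * (s - 2)\<close>
  and differentiation at \<open>s = 0\<close>, where \<open>(y + \<eta>) powr (- s)\<close> turns
  into \<open>- Ln (y + \<eta>)\<close>.\<close>

definition log_rem :: "nat \<Rightarrow> complex \<Rightarrow> complex \<Rightarrow> complex \<Rightarrow> complex \<Rightarrow> complex" where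
  "log_rem K \<eta> a1 a2 y = - Ln (y + \<eta>) - cross_diff a1 a2 (log_todd K \<eta> a1 a2) y"

lemma log_term_eq:
  assumes y: "y \<noteq> 0"
  shows "log_term k y = 3 / 4 * (ffact 2 k * y powr (2 - of_nat k)) -
    (ffact_deriv k * y powr (2 - of_nat k) + ffact 2 k * (y powr (2 - of_nat k) * Ln y)) / 2"
proof -
  have y2: "y powr 2 = y ^ 2" using y powr_nat[of y 2] by simp
  consider "k = 0" | "k = 1" | "k = 2" | "k \<ge> 3" by linarith
  then show ?thesis
  proof cases
    case 1 then show ?thesis using y2 by (simp add: log_term_def algebra_simps)
  next
    case 2 then show ?thesis using y by (simp add: log_term_def ffact_Suc algebra_simps)
  next
    case 3
    have "ffact 2 2 = 2" "ffact_deriv 2 = 3" by (simp_all add: numeral_2_eq_2 ffact_Suc)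
    then show ?thesis using y 3 by (simp add: log_term_def field_simps)
  next
    case 4
    then obtain j where j: "k = j + 3" using le_Suc_ex by (metis add.commute)
    have "y powr (2 - of_nat k) = y ^ 2 / y ^ k"
      using y by (simp add: powr_diff y2 powr_nat)
    also have "\<dots> = 1 / y ^ (k - 2)"
      using y 4 by (simp add: power_diff)
    finally have p: "y powr (2 - of_nat k) = 1 / y ^ (k - 2)" .
    have "log_term k y = (- 1) ^ k * fact (k - 3) / y ^ (k - 2)" using 4 by (simp add: log_term_def)
    then show ?thesis unfolding p using ffact_2_values[of j] by (simp add: j power_add)
  qed
qed

lemma const_powr_has_derivative:
  assumes "c \<noteq> 0" shows "((\<lambda>p. c powr (p - d)) has_field_derivative c powr (p - d) * Ln c) (at p)"
  unfolding powr_def using assms by (auto intro!: derivative_eq_intros)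

text \<open>
  The functional \<open>\<phi> \<mapsto> 3/4 \<phi>(2) - \<phi>'(2)/2\<close> is the derivative at \<open>s = 0\<close> of
  \<open>\<phi>(2 - s) / ((s - 1) (s - 2))\<close>.
\<close>

lemma todd_sum_log:
  assumes y: "y \<noteq> 0"
  shows "\<exists>D. ((\<lambda>p. todd_sum K \<eta> a1 a2 p y) has_field_derivative D) (at 2) \<and>
           3 / 4 * todd_sum K \<eta> a1 a2 2 y - D / 2 = log_todd K \<eta> a1 a2 y"
proof (intro exI conjI)
  show "((\<lambda>p. todd_sum K \<eta> a1 a2 p y) has_field_derivative (\<Sum>k<K. todd_coeff k \<eta> a1 a2 * (ffact_deriv k * y powr (2 - of_nat k)
        + ffact 2 k * (y powr (2 - of_nat k) * Ln y)))) (at 2)"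
    unfolding todd_sum_def
    by (rule derivative_eq_intros const_powr_has_derivative[OF y] ffact_has_derivative refl)+
       (simp add: algebra_simps)
  show "3 / 4 * todd_sum K \<eta> a1 a2 2 y - (\<Sum>k<K. todd_coeff k \<eta> a1 a2 * (ffact_deriv k * y powr (2 - of_nat k)
        + ffact 2 k * (y powr (2 - of_nat k) * Ln y))) / 2 = log_todd K \<eta> a1 a2 y"
    unfolding todd_sum_def log_todd_def log_term_eq[OF y]
    by (simp add: sum_distrib_left sum_divide_distrib sum_subtractf [symmetric] algebra_simps)
qed

lemma todd_rem_log:
  assumes re: "Re a1 > 0" "Re a2 > 0" "Re y > 0" and n: "y + \<eta> \<noteq> 0"
  shows "3 / 4 * todd_rem K \<eta> a1 a2 2 y - deriv (\<lambda>p. todd_rem K \<eta> a1 a2 p y) 2 / 2 = log_rem K \<eta> a1 a2 y"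
proof -
  have nz: "y + a1 + a2 \<noteq> 0" "y + a1 \<noteq> 0" "y + a2 \<noteq> 0" "y \<noteq> 0"
    using re by (auto simp: complex_eq_iff)
  obtain D1 D2 D3 D4 where D:
    "((\<lambda>p. todd_sum K \<eta> a1 a2 p (y + a1 + a2)) has_field_derivative D1) (at 2)"
    "((\<lambda>p. todd_sum K \<eta> a1 a2 p (y + a1)) has_field_derivative D2) (at 2)"
    "((\<lambda>p. todd_sum K \<eta> a1 a2 p (y + a2)) has_field_derivative D3) (at 2)"
    "((\<lambda>p. todd_sum K \<eta> a1 a2 p y) has_field_derivative D4) (at 2)"
    and E: "log_todd K \<eta> a1 a2 (y + a1 + a2) = 3 / 4 * todd_sum K \<eta> a1 a2 2 (y + a1 + a2) - D1 / 2"
    "log_todd K \<eta> a1 a2 (y + a1) = 3 / 4 * todd_sum K \<eta> a1 a2 2 (y + a1) - D2 / 2"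
    "log_todd K \<eta> a1 a2 (y + a2) = 3 / 4 * todd_sum K \<eta> a1 a2 2 (y + a2) - D3 / 2"
    "log_todd K \<eta> a1 a2 y = 3 / 4 * todd_sum K \<eta> a1 a2 2 y - D4 / 2"
    using todd_sum_log[OF nz(1), of K \<eta> a1 a2] todd_sum_log[OF nz(2), of K \<eta> a1 a2]
      todd_sum_log[OF nz(3), of K \<eta> a1 a2] todd_sum_log[OF nz(4), of K \<eta> a1 a2] by metis
  have "((\<lambda>p. todd_rem K \<eta> a1 a2 p y) has_field_derivative 3 + 2 * Ln (y + \<eta>) - (D1 - D2 - D3 + D4)) (at 2)"
    unfolding todd_rem_def cross_diff_def using n
    by (auto intro!: derivative_eq_intros const_powr_has_derivative D)
  then have "deriv (\<lambda>p. todd_rem K \<eta> a1 a2 p y) 2 = 3 + 2 * Ln (y + \<eta>) - (D1 - D2 - D3 + D4)"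
    by (rule DERIV_imp_deriv)
  then show ?thesis
    unfolding log_rem_def cross_diff_def E todd_rem_def using n by (simp add: algebra_simps) (simp add: field_simps)
qed

text \<open>Cauchy's inequality on the circle of radius 1/4 about \<open>p = 2\<close> bounds the
  derivative by \<open>4 * M\<close>, and \<open>3/4 + 4/2 \<le> 3\<close>. On that disc
  \<open>Re p \<le> 9/4\<close>, whence the exponent \<open>1/4 - K\<close>; for
  \<open>K = 3\<close> this is \<open>- 11/4\<close>, still summable over the lattice.\<close>

lemma log_rem_bound:
  assumes re: "Re a1 > 0" "Re a2 > 0" "Re y > 0"
    and A: "A \<ge> 1" "norm \<eta> \<le> A" "norm a1 \<le> A" "norm a2 \<le> A"
    and L: "16 * A \<le> L" "L \<le> norm y" and K: "K \<ge> 1"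
    and B: "\<And>k. k < K \<Longrightarrow> norm (todd_coeff k \<eta> a1 a2) \<le> B"
  shows "norm (log_rem K \<eta> a1 a2 y) \<le> 3 * (rem_const K (9 / 4) B * (8 * A) ^ (K + 2) * L powr (1 / 4 - real K))"
proof -
  define M where "M = rem_const K (9 / 4) B * (8 * A) ^ (K + 2) * L powr (1 / 4 - real K)"
  define \<phi> where "\<phi> = (\<lambda>p. todd_rem K \<eta> a1 a2 p y)"
  have b: "norm (\<phi> p) \<le> M" if "norm (2 - p) \<le> 1 / 4" for p
  proof -
    have "norm p \<le> norm (2 :: complex) + norm (2 - p)"
      using norm_triangle_ineq4[of 2 "2 - p"] by simp
    then have 1: "norm p \<le> 9 / 4" using that by simp
    then have 2: "Re p \<le> 9 / 4" using complex_Re_le_cmod[of p] by linarith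
    have "norm (todd_rem K \<eta> a1 a2 p y) \<le> rem_const K (9 / 4) B * (8 * A) ^ (K + 2) * L powr (9 / 4 - real K - 2)"
      by (rule todd_rem_bound'[OF re A L 1 2]) (use K B in auto)
    also have "9 / 4 - real K - 2 = 1 / 4 - real K" by simp
    finally show ?thesis by (simp add: M_def \<phi>_def)
  qed
  have "norm ((deriv ^^ 1) \<phi> 2) \<le> fact 1 * M / (1 / 4) ^ 1"
    by (rule Cauchy_inequality)
       (use b todd_rem_holomorphic in \<open>auto simp: \<phi>_def intro!: holomorphic_on_imp_continuous_on\<close>)
  then have d: "norm (deriv \<phi> 2) \<le> 4 * M" by simp
  have n: "y + \<eta> \<noteq> 0"
  proof
    assume "y + \<eta> = 0"
    then have "norm y = norm \<eta>" by (simp add: add_eq_0_iff2)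
    then show False using A L by linarith
  qed
  have "norm (log_rem K \<eta> a1 a2 y) \<le> norm (3 / 4 * \<phi> 2) + norm (deriv \<phi> 2 / 2)"
    using todd_rem_log[OF re n, of K] norm_triangle_ineq4[of "3 / 4 * \<phi> 2" "deriv \<phi> 2 / 2"]
    by (simp add: \<phi>_def)
  also have "\<dots> \<le> 3 / 4 * M + 4 * M / 2" using b[of 2] d by (simp add: norm_mult norm_divide)
  also have "\<dots> \<le> 3 * M" using order_trans[OF norm_ge_zero b[of 2]] by simp
  finally show ?thesis by (simp add: M_def)
qed

lemma zeta2_deriv_0:
  assumes re: "Re w > 0" "Re a1 > 0" "Re a2 > 0" and K: "K \<ge> 3"
    and nz: "\<And>n. lat_pt w a1 a2 n + \<eta> \<noteq> 0"
  shows "(\<lambda>m. log_rem K \<eta> a1 a2 (lat_pt w a1 a2 (prod_decode m))) sums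
           (deriv (\<lambda>s. zeta2 s (w + \<eta>) a1 a2) 0 - log_todd K \<eta> a1 a2 w)"
proof -
  define R where "R = (\<lambda>p. \<Sum>\<^sub>\<infinity>n. todd_rem K \<eta> a1 a2 p (lat_pt w a1 a2 n))"
  define y where "y = (\<lambda>m. lat_pt w a1 a2 (prod_decode m))"
  have 2: "Re 2 < real K" using K by simp
  obtain D where D: "(R has_field_derivative D) (at 2)"
    "(\<lambda>m. deriv (\<lambda>p. todd_rem K \<eta> a1 a2 p (y m)) 2) sums D"
    using todd_rem_sum_has_derivative[OF re 2, of \<eta>] unfolding R_def y_def by blast
  have w0: "w \<noteq> 0" using re by auto
  obtain D' where D': "((\<lambda>p. todd_sum K \<eta> a1 a2 p w) has_field_derivative D') (at 2)"
    "3 / 4 * todd_sum K \<eta> a1 a2 2 w - D' / 2 = log_todd K \<eta> a1 a2 w"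
    using todd_sum_log[OF w0] by blast
  have Z: "((\<lambda>p. zeta2_num_at K w \<eta> a1 a2 p) has_field_derivative (D' + D)) (at 2)"
    unfolding zeta2_num_at_def using DERIV_add[OF D'(1) D(1)] by (simp add: R_def)
  have "((\<lambda>p. zeta2_num_at K w \<eta> a1 a2 p) \<circ> (\<lambda>s. 2 - s) has_field_derivative (D' + D) * (- 1)) (at 0)"
    by (rule DERIV_chain) (use Z in \<open>auto intro!: derivative_eq_intros\<close>)
  then have Z': "((\<lambda>s. zeta2_num_at K w \<eta> a1 a2 (2 - s)) has_field_derivative - (D' + D)) (at 0)"
    by (simp add: o_def)
  \<comment> \<open>At \<open>s = 0\<close> the factor \<open>1 / ((s - 1) * (s - 2))\<close> has
    value 1/2 and derivative 3/4; the minus sign comes from \<open>p = 2 - s\<close>.\<close>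
  have "((\<lambda>s. zeta2_num_at K w \<eta> a1 a2 (2 - s) / ((s - 1) * (s - 2))) has_field_derivative
          3 / 4 * zeta2_num_at K w \<eta> a1 a2 2 - (D' + D) / 2) (at 0)"
    by (rule derivative_eq_intros Z' refl)+ (auto simp: field_simps)
  then have "((\<lambda>s. zeta2 s (w + \<eta>) a1 a2) has_field_derivative
          3 / 4 * zeta2_num_at K w \<eta> a1 a2 2 - (D' + D) / 2) (at 0)"
  proof (rule has_field_derivative_transform_within_open[where S = "ball 0 1"])
    fix s :: complex assume "s \<in> ball 0 1"
    then have "norm s < 1" by simp
    then have s: "s \<noteq> 1" "s \<noteq> 2" "Re s > - 1"
      using abs_Re_le_cmod[of s] by auto
    then have "Re s > 2 - real K" using K by simp
    with s show "zeta2_num_at K w \<eta> a1 a2 (2 - s) / ((s - 1) * (s - 2)) = zeta2 s (w + \<eta>) a1 a2"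
      by (intro zeta2_eq [OF re, symmetric])
  qed auto
  then have d: "deriv (\<lambda>s. zeta2 s (w + \<eta>) a1 a2) 0 = 3 / 4 * zeta2_num_at K w \<eta> a1 a2 2 - (D' + D) / 2"
    by (rule DERIV_imp_deriv)
  have "(\<lambda>n. todd_rem K \<eta> a1 a2 2 (lat_pt w a1 a2 n)) summable_on UNIV"
    by (rule abs_summable_summable[OF todd_rem_abs_summable[OF re 2]])
  then have "(\<lambda>m. todd_rem K \<eta> a1 a2 2 (y m)) sums R 2"
    unfolding y_def R_def by (rule sums_prod_decode)
  then have "(\<lambda>m. 3 / 4 * todd_rem K \<eta> a1 a2 2 (y m) - deriv (\<lambda>p. todd_rem K \<eta> a1 a2 p (y m)) 2 / 2) sums
      (3 / 4 * R 2 - D / 2)"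
    by (intro sums_diff sums_mult sums_divide D(2))
  moreover have "3 / 4 * todd_rem K \<eta> a1 a2 2 (y m) - deriv (\<lambda>p. todd_rem K \<eta> a1 a2 p (y m)) 2 / 2 = log_rem K \<eta> a1 a2 (y m)" for m
    using nz[of "prod_decode m"] lat_pt_neq_0(1)[OF re] re by (intro todd_rem_log) (auto simp: y_def)
  moreover have "3 / 4 * R 2 - D / 2 = deriv (\<lambda>s. zeta2 s (w + \<eta>) a1 a2) 0 - log_todd K \<eta> a1 a2 w"
    unfolding d D'(2) [symmetric] zeta2_num_at_def R_def by (simp add: algebra_simps add_divide_distrib)
  ultimately show ?thesis unfolding y_def by simp
qed

lemma cone_lattice_iff: "w + \<eta> \<in> cone_lattice a1 a2 \<longleftrightarrow> (\<exists>n. lat_pt w a1 a2 n + \<eta> = 0)"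
proof
  assume "w + \<eta> \<in> cone_lattice a1 a2"
  then obtain n1 n2 where n: "w + \<eta> = of_int n1 * a1 + of_int n2 * a2" "n1 \<le> 0" "n2 \<le> 0"
    by (auto simp: cone_lattice_def)
  then have "lat_pt w a1 a2 (nat (- n1), nat (- n2)) + \<eta> = 0"
    by (simp add: lat_pt_def of_nat_nat algebra_simps)
  then show "\<exists>n. lat_pt w a1 a2 n + \<eta> = 0" by blast
next
  assume "\<exists>n. lat_pt w a1 a2 n + \<eta> = 0"
  then obtain n where "lat_pt w a1 a2 n + \<eta> = 0" by blast
  then have "w + \<eta> = of_int (- int (fst n)) * a1 + of_int (- int (snd n)) * a2"
    by (simp add: lat_pt_def algebra_simps eq_neg_iff_add_eq_0)
  then show "w + \<eta> \<in> cone_lattice a1 a2" unfolding cone_lattice_def by (intro CollectI exI[of _ "- int (fst n)"] exI[of _ "- int (snd n)"]) auto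
qed

lemma Gamma2_rhp_eq:
  assumes re: "Re w > 0" "Re a1 > 0" "Re a2 > 0" and K: "K \<ge> 3"
    and nl: "w + \<eta> \<notin> cone_lattice a1 a2"
  shows "Gamma2_rhp (w + \<eta>) a1 a2 =
      exp (log_todd K \<eta> a1 a2 w + (\<Sum>m. log_rem K \<eta> a1 a2 (lat_pt w a1 a2 (prod_decode m))))"
    and "summable (\<lambda>m. log_rem K \<eta> a1 a2 (lat_pt w a1 a2 (prod_decode m)))"
proof -
  have nz: "lat_pt w a1 a2 n + \<eta> \<noteq> 0" for n using nl unfolding cone_lattice_iff by blast
  note s = zeta2_deriv_0[OF re K nz]
  then show "summable (\<lambda>m. log_rem K \<eta> a1 a2 (lat_pt w a1 a2 (prod_decode m)))" by (rule sums_summable)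
  show "Gamma2_rhp (w + \<eta>) a1 a2 =
      exp (log_todd K \<eta> a1 a2 w + (\<Sum>m. log_rem K \<eta> a1 a2 (lat_pt w a1 a2 (prod_decode m))))"
    using nl by (simp add: Gamma2_rhp_def sums_unique[OF s, symmetric])
qed

section \<open>Holomorphic functions of several variables\<close>

text \<open>Pointwise form of \<open>mv_holomorphic_on\<close>, so that closure rules compose like
  derivative rules with side conditions at a single point.\<close>

definition mv_diff :: "(complex ^ 'n \<Rightarrow> complex) \<Rightarrow> complex ^ 'n \<Rightarrow> bool" where
  "mv_diff f z \<longleftrightarrow> (\<exists>c :: complex ^ 'n. (f has_derivative (\<lambda>h. \<Sum>i\<in>UNIV. c $ i * h $ i)) (at z))"

lemma mv_holomorphic_on_iff: "mv_holomorphic_on f S \<longleftrightarrow> (\<forall>z\<in>S. mv_diff f z)"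
  by (simp add: mv_holomorphic_on_def mv_diff_def)

named_theorems mv_diff_intros

lemma mvdI:
  fixes f :: "complex ^ 'n \<Rightarrow> complex" and D :: "complex ^ 'n \<Rightarrow> complex"
  assumes "(f has_derivative D) (at z)" "\<And>h. D h = (\<Sum>i\<in>UNIV. c i * h $ i)"
  shows "mv_diff f z"
proof -
  have "D = (\<lambda>h. \<Sum>i\<in>UNIV. (\<chi> i. c i) $ i * h $ i)" using assms(2) by auto
  with assms(1) show ?thesis unfolding mv_diff_def by blast
qed

lemma mvdE:
  fixes f :: "complex ^ 'n \<Rightarrow> complex"
  assumes "mv_diff f z"
  obtains c where "(f has_derivative (\<lambda>h. \<Sum>i\<in>UNIV. c i * h $ i)) (at z)"
  using assms unfolding mv_diff_def by blast

lemma mv_diff_const [mv_diff_intros]: "mv_diff (\<lambda>_. k) z"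
  by (rule mvdI[where D = "\<lambda>_. 0" and c = "\<lambda>_. 0"]) auto

lemma mv_diff_nth [mv_diff_intros]:
  fixes z :: "complex ^ 'n"
  shows "mv_diff (\<lambda>p. p $ j) z"
proof (rule mvdI[where D = "\<lambda>h. h $ j" and c = "\<lambda>i. if i = j then 1 else 0"])
  show "((\<lambda>p. p $ j) has_derivative (\<lambda>h :: complex ^ 'n. h $ j)) (at z)"
    by (rule bounded_linear_imp_has_derivative[OF bounded_linear_vec_nth])
  show "h $ j = (\<Sum>i\<in>UNIV. (if i = j then 1 else 0) * h $ i)" for h :: "complex ^ 'n"
    by (simp add: if_distrib[where f = "\<lambda>x. x * _"] cong: if_cong)
qed

lemma mv_diff_add [mv_diff_intros]:
  fixes f g :: "complex ^ 'n \<Rightarrow> complex"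
  assumes "mv_diff f z" "mv_diff g z" shows "mv_diff (\<lambda>p. f p + g p) z"
proof -
  obtain c where c: "(f has_derivative (\<lambda>h. \<Sum>i\<in>UNIV. c i * h $ i)) (at z)" by (rule mvdE[OF assms(1)])
  obtain d where d: "(g has_derivative (\<lambda>h. \<Sum>i\<in>UNIV. d i * h $ i)) (at z)" by (rule mvdE[OF assms(2)])
  show ?thesis
    by (rule mvdI[OF has_derivative_add[OF c d], of "\<lambda>i. c i + d i"])
       (simp add: sum.distrib algebra_simps)
qed

lemma mv_diff_mult [mv_diff_intros]:
  fixes f g :: "complex ^ 'n \<Rightarrow> complex"
  assumes "mv_diff f z" "mv_diff g z" shows "mv_diff (\<lambda>p. f p * g p) z"
proof -
  obtain c where c: "(f has_derivative (\<lambda>h. \<Sum>i\<in>UNIV. c i * h $ i)) (at z)" by (rule mvdE[OF assms(1)])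
  obtain d where d: "(g has_derivative (\<lambda>h. \<Sum>i\<in>UNIV. d i * h $ i)) (at z)" by (rule mvdE[OF assms(2)])
  show ?thesis
    by (rule mvdI[OF has_derivative_mult[OF c d], of "\<lambda>i. f z * d i + c i * g z"])
       (simp add: sum.distrib sum_distrib_left sum_distrib_right algebra_simps)
qed

lemma mv_diff_compose:
  fixes f :: "complex ^ 'n \<Rightarrow> complex"
  assumes "mv_diff f z" "(g has_field_derivative d) (at (f z))" shows "mv_diff (\<lambda>p. g (f p)) z"
proof -
  obtain c where c: "(f has_derivative (\<lambda>h. \<Sum>i\<in>UNIV. c i * h $ i)) (at z)" by (rule mvdE[OF assms(1)])
  have g: "(g has_derivative (*) d) (at (f z))" using assms(2) by (simp add: has_field_derivative_def)
  show ?thesis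
    by (rule mvdI[OF has_derivative_compose[OF c g], of "\<lambda>i. d * c i"])
       (simp add: sum_distrib_left mult_ac)
qed

lemma mv_diff_uminus [mv_diff_intros]: assumes "mv_diff f z" shows "mv_diff (\<lambda>p. - f p) z"
  by (rule mv_diff_compose[OF assms, of uminus "- 1"]) (auto intro!: derivative_eq_intros)

lemma mv_diff_diff [mv_diff_intros]: assumes "mv_diff f z" "mv_diff g z" shows "mv_diff (\<lambda>p. f p - g p) z"
  using mv_diff_add[OF assms(1) mv_diff_uminus[OF assms(2)]] by simp

lemma mv_diff_exp [mv_diff_intros]: assumes "mv_diff f z" shows "mv_diff (\<lambda>p. exp (f p)) z"
  by (rule mv_diff_compose[OF assms, of exp]) (rule DERIV_exp)

lemma mv_diff_power [mv_diff_intros]: assumes "mv_diff f z" shows "mv_diff (\<lambda>p. f p ^ k) z"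
  by (induction k) (auto intro!: mv_diff_intros assms)

lemma mv_diff_Ln [mv_diff_intros]: assumes "mv_diff f z" "f z \<notin> \<real>\<^sub>\<le>\<^sub>0" shows "mv_diff (\<lambda>p. Ln (f p)) z"
  by (rule mv_diff_compose[OF assms(1), of Ln]) (rule has_field_derivative_Ln[OF assms(2)])

lemma mv_diff_inverse [mv_diff_intros]: assumes "mv_diff f z" "f z \<noteq> 0" shows "mv_diff (\<lambda>p. inverse (f p)) z"
  by (rule mv_diff_compose[OF assms(1), of inverse]) (rule DERIV_inverse[OF assms(2)])

lemma mv_diff_divide [mv_diff_intros]: assumes "mv_diff f z" "mv_diff g z" "g z \<noteq> 0" shows "mv_diff (\<lambda>p. f p / g p) z"
  using mv_diff_mult[OF assms(1) mv_diff_inverse[OF assms(2,3)]] by (simp add: divide_inverse)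

lemma mv_diff_prod [mv_diff_intros]:
  assumes "\<And>i. i \<in> I \<Longrightarrow> mv_diff (f i) z" shows "mv_diff (\<lambda>p. \<Prod>i\<in>I. f i p) z"
  using assms by (induction I rule: infinite_finite_induct) (auto intro!: mv_diff_intros)

lemma mv_diff_imp_isCont: assumes "mv_diff f z" shows "isCont f z"
  using assms by (auto simp: mv_diff_def intro: has_derivative_continuous)

lemma mv_diff_transform:
  assumes "mv_diff f z" "open U" "z \<in> U" "\<And>p. p \<in> U \<Longrightarrow> f p = g p" shows "mv_diff g z"
  using assms unfolding mv_diff_def by (meson has_derivative_transform_within_open)

section \<open>Cauchy estimates and Weierstrass's theorem in several variables\<close>

lemma norm_axis: "norm (axis j t) = norm t"
proof -
  have "(\<Sum>i\<in>UNIV. (norm (axis j t $ i))\<^sup>2) = (\<Sum>i\<in>UNIV. if i = j then (norm t)\<^sup>2 else 0)"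
    by (intro sum.cong) (auto simp: axis_def)
  then show ?thesis by (simp add: norm_vec_def L2_set_def)
qed

text \<open>The one-variable Cauchy inequality on the circle of radius \<open>r / 2\<close> in the
  complex line through \<open>p0\<close> along the j-th axis.\<close>

lemma mv_diff_partial_bound:
  fixes f :: "complex ^ 'n \<Rightarrow> complex"
  assumes f: "\<And>p. p \<in> ball p0 r \<Longrightarrow> mv_diff f p" and r: "r > 0"
    and M: "\<And>p. p \<in> ball p0 r \<Longrightarrow> norm (f p) \<le> M"
    and c: "(f has_derivative (\<lambda>h. \<Sum>i\<in>UNIV. c i * h $ i)) (at p0)"
  shows "norm (c j) \<le> 2 * M / r"
proof -
  define \<gamma> where "\<gamma> = (\<lambda>t. p0 + axis j t)"
  have \<gamma>i: "\<gamma> t $ i = p0 $ i + (if i = j then t else 0)" for t i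
    by (simp add: \<gamma>_def axis_def)
  have ax: "axis j t $ i = (if i = j then t else 0)" for t :: complex and i
    by (simp add: axis_def)
  have "bounded_linear (axis j :: complex \<Rightarrow> complex ^ 'n)"
    by (rule bounded_linear_intro[where K = 1]) (auto simp: vec_eq_iff ax norm_axis)
  then have \<gamma>': "(\<gamma> has_derivative axis j) (at t)" for t
    unfolding \<gamma>_def by (auto intro!: derivative_eq_intros bounded_linear_imp_has_derivative)
  have b: "\<gamma> t \<in> ball p0 r" if "norm t < r" for t
    using that by (simp add: \<gamma>_def dist_norm norm_axis)
  have deriv: "((\<lambda>t. f (\<gamma> t)) has_field_derivative d j) (at t)"
    if "(f has_derivative (\<lambda>h. \<Sum>i\<in>UNIV. d i * h $ i)) (at (\<gamma> t))" for t d
  proof -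
    have "((\<lambda>t. f (\<gamma> t)) has_derivative (\<lambda>t. \<Sum>i\<in>UNIV. d i * axis j t $ i)) (at t)"
      by (rule has_derivative_compose[OF \<gamma>' that])
    also have "(\<lambda>t. \<Sum>i\<in>UNIV. d i * axis j t $ i) = (*) (d j)"
      by (auto simp: ax if_distrib[where f = "\<lambda>x. _ * x"] cong: if_cong)
    finally show ?thesis by (simp add: has_field_derivative_def)
  qed
  have hol: "(\<lambda>t. f (\<gamma> t)) holomorphic_on ball 0 r"
    unfolding holomorphic_on_open[OF open_ball]
  proof
    fix t :: complex assume "t \<in> ball 0 r"
    then have "mv_diff f (\<gamma> t)" by (intro f b) simp
    then obtain d where "(f has_derivative (\<lambda>h. \<Sum>i\<in>UNIV. d i * h $ i)) (at (\<gamma> t))" by (rule mvdE)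
    from deriv[OF this] show "\<exists>f'. ((\<lambda>t. f (\<gamma> t)) has_field_derivative f') (at t)" by blast
  qed
  have "norm ((deriv ^^ 1) (\<lambda>t. f (\<gamma> t)) 0) \<le> fact 1 * M / (r / 2) ^ 1"
  proof (rule Cauchy_inequality)
    show "(\<lambda>t. f (\<gamma> t)) holomorphic_on ball 0 (r / 2)"
      by (rule holomorphic_on_subset[OF hol]) (use r in auto)
    show "continuous_on (cball 0 (r / 2)) (\<lambda>t. f (\<gamma> t))"
      by (rule holomorphic_on_imp_continuous_on, rule holomorphic_on_subset[OF hol]) (use r in auto)
    show "norm (f (\<gamma> x)) \<le> M" if "norm (0 - x) = r / 2" for x
      using that r by (intro M b) auto
  qed (use r in auto)
  moreover have "\<gamma> 0 = p0" by (simp add: \<gamma>_def)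
  then have "deriv (\<lambda>t. f (\<gamma> t)) 0 = c j" using c by (intro DERIV_imp_deriv deriv) simp
  ultimately show ?thesis by (simp add: mult.commute)
qed

text \<open>Weierstrass's theorem: on the ball of half the radius the Cauchy bound dominates the
  partial derivatives by \<open>4 / r * M m\<close>, so the differentiated series converges
  uniformly.\<close>

lemma mv_diff_suminf:
  fixes f :: "nat \<Rightarrow> complex ^ 'n \<Rightarrow> complex"
  assumes f: "\<And>m p. p \<in> ball p0 r \<Longrightarrow> mv_diff (f m) p" and r: "r > 0"
    and M: "\<And>m p. p \<in> ball p0 r \<Longrightarrow> norm (f m p) \<le> M m" and sM: "summable M"
  shows "mv_diff (\<lambda>p. \<Sum>m. f m p) p0"
proof -
  define S where "S = ball p0 (r / 2)"
  have sub: "ball p (r / 2) \<subseteq> ball p0 r" if "p \<in> S" for p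
  proof
    fix q assume "q \<in> ball p (r / 2)"
    then show "q \<in> ball p0 r"
      using that dist_triangle[of p0 q p] by (auto simp: S_def)
  qed
  define c where "c = (\<lambda>m p i. (SOME c :: complex ^ 'n.
    (f m has_derivative (\<lambda>h. \<Sum>i\<in>UNIV. c $ i * h $ i)) (at p)) $ i)"
  have c: "(f m has_derivative (\<lambda>h. \<Sum>i\<in>UNIV. c m p i * h $ i)) (at p)" if "p \<in> ball p0 r" for m p
    unfolding c_def by (rule someI_ex[OF f[OF that, unfolded mv_diff_def]])
  have cb: "norm (c m p i) \<le> 4 / r * M m" if p: "p \<in> S" for m p i
  proof -
    have "p \<in> ball p (r / 2)" using r by simp
    then have pb: "p \<in> ball p0 r" using sub[OF p] by blast
    have "norm (c m p i) \<le> 2 * M m / (r / 2)"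
      by (rule mv_diff_partial_bound[OF _ _ _ c[OF pb]]) (use sub[OF p] f M r in auto)
    then show ?thesis by simp
  qed
  define C where "C = (\<lambda>p i. \<Sum>m. c m p i)"
  have ul: "uniform_limit S (\<lambda>n p. \<Sum>m<n. c m p i) (\<lambda>p. C p i) sequentially" for i
    unfolding C_def by (rule Weierstrass_m_test[OF cb summable_mult[OF sM]])
  have "\<exists>g. \<forall>x\<in>S. (\<lambda>m. f m x) sums g x \<and> (g has_derivative (\<lambda>h. \<Sum>i\<in>UNIV. C x i * h $ i)) (at x within S)"
  proof (rule has_derivative_series[where f' = "\<lambda>m x h. \<Sum>i\<in>UNIV. c m x i * h $ i"
      and g' = "\<lambda>x h. \<Sum>i\<in>UNIV. C x i * h $ i" and x = p0 and l = "\<Sum>m. f m p0"])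
    show "convex S" "p0 \<in> S" using r by (auto simp: S_def)
    show "(f m has_derivative (\<lambda>h. \<Sum>i\<in>UNIV. c m x i * h $ i)) (at x within S)" if "x \<in> S" for m x
    proof (rule has_derivative_at_withinI, rule c)
      have "x \<in> ball x (r / 2)" using r by simp
      then show "x \<in> ball p0 r" using sub[OF that] by blast
    qed
    have "p0 \<in> ball p0 r" using r by simp
    then have "summable (\<lambda>m. norm (f m p0))"
      by (intro summable_comparison_test'[OF sM, of 0]) (use M in auto)
    then show "(\<lambda>m. f m p0) sums (\<Sum>m. f m p0)" by (rule summable_sums[OF summable_norm_cancel])
    fix e :: real assume e: "e > 0"
    \<comment> \<open>The uniform bounds hold for each coordinate; dividing by the dimension turns
      them into a bound for the linear maps.\<close>
    define e' where "e' = e / CARD('n)"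
    have e': "e' > 0" using e by (simp add: e'_def)
    have "\<forall>\<^sub>F n in sequentially. \<forall>i\<in>UNIV. \<forall>x\<in>S. dist (\<Sum>m<n. c m x i) (C x i) < e'"
      using ul e' by (intro eventually_ball_finite) (auto simp: uniform_limit_iff)
    then show "\<forall>\<^sub>F n in sequentially. \<forall>x\<in>S. \<forall>h. norm ((\<Sum>m<n. \<Sum>i\<in>UNIV. c m x i * h $ i) - (\<Sum>i\<in>UNIV. C x i * h $ i)) \<le> e * norm h"
    proof eventually_elim
      case (elim n)
      show ?case
      proof (intro ballI allI)
        fix x h :: "complex ^ 'n" assume x: "x \<in> S"
        have "(\<Sum>m<n. \<Sum>i\<in>UNIV. c m x i * h $ i) = (\<Sum>i\<in>UNIV. (\<Sum>m<n. c m x i) * h $ i)"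
          by (subst sum.swap) (simp add: sum_distrib_right)
        then have "norm ((\<Sum>m<n. \<Sum>i\<in>UNIV. c m x i * h $ i) - (\<Sum>i\<in>UNIV. C x i * h $ i))
            = norm (\<Sum>i\<in>UNIV. ((\<Sum>m<n. c m x i) - C x i) * h $ i)"
          by (simp add: sum_subtractf algebra_simps)
        also have "\<dots> \<le> (\<Sum>i\<in>(UNIV :: 'n set). e' * norm h)"
        proof (rule order_trans[OF norm_sum sum_mono])
          fix i :: 'n
          show "norm (((\<Sum>m<n. c m x i) - C x i) * h $ i) \<le> e' * norm h"
            unfolding norm_mult using elim x e'
            by (intro mult_mono Finite_Cartesian_Product.norm_nth_le) (auto simp: dist_norm less_imp_le)
        qed
        also have "\<dots> = e * norm h" by (simp add: e'_def)
        finally show "norm ((\<Sum>m<n. \<Sum>i\<in>UNIV. c m x i * h $ i) - (\<Sum>i\<in>UNIV. C x i * h $ i)) \<le> e * norm h" .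
      qed
    qed
  qed
  then obtain g where g: "\<And>x. x \<in> S \<Longrightarrow> (\<lambda>m. f m x) sums g x"
    "\<And>x. x \<in> S \<Longrightarrow> (g has_derivative (\<lambda>h. \<Sum>i\<in>UNIV. C x i * h $ i)) (at x within S)" by blast
  have S: "open S" "p0 \<in> S" using r by (auto simp: S_def)
  have "(g has_derivative (\<lambda>h. \<Sum>i\<in>UNIV. C p0 i * h $ i)) (at p0)"
    using g(2)[OF S(2)] at_within_open[OF S(2,1)] by simp
  then have "mv_diff g p0" by (rule mvdI) simp
  then show ?thesis
    by (rule mv_diff_transform[OF _ S]) (use g(1) sums_unique in auto)
qed

section \<open>Homogeneity\<close>

definition log_todd3 :: "complex \<Rightarrow> complex \<Rightarrow> complex \<Rightarrow> complex \<Rightarrow> complex" where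
  "log_todd3 \<eta> a1 a2 y = 1 / (a1 * a2) * (y ^ 2 * (3 / 4 - Ln y / 2)) + todd_coeff1 \<eta> a1 a2 * (y * (1 - Ln y))
     - todd_coeff2 \<eta> a1 a2 * Ln y"

lemma log_todd_3:
  assumes a: "a1 \<noteq> 0" "a2 \<noteq> 0"
  shows "log_todd 3 \<eta> a1 a2 y = log_todd3 \<eta> a1 a2 y"
proof -
  have "log_todd 3 \<eta> a1 a2 y = todd_coeff 0 \<eta> a1 a2 * log_term 0 y + todd_coeff 1 \<eta> a1 a2 * log_term 1 y + todd_coeff 2 \<eta> a1 a2 * log_term 2 y"
    by (simp add: log_todd_def numeral_3_eq_3 numeral_2_eq_2)
  then show ?thesis unfolding todd_coeff_explicit[OF a] log_todd3_def by (simp add: log_term_def)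
qed

lemma log_rem_3:
  assumes "a1 \<noteq> 0" "a2 \<noteq> 0"
  shows "log_rem 3 \<eta> a1 a2 y = - Ln (y + \<eta>) - cross_diff a1 a2 (log_todd3 \<eta> a1 a2) y"
  by (simp add: log_rem_def cross_diff_def log_todd_3[OF assms])

text \<open>Exponentiation removes the branch of \<open>Ln (y + \<eta>)\<close>. The expression
  under \<open>inverse\<close> still makes sense at \<open>y + \<eta> = 0\<close> and is the factor
  in the product for the reciprocal double gamma function.\<close>

lemma exp_log_rem_3:
  assumes "a1 \<noteq> 0" "a2 \<noteq> 0" "y + \<eta> \<noteq> 0"
  shows "exp (log_rem 3 \<eta> a1 a2 y) = inverse ((y + \<eta>) * exp (cross_diff a1 a2 (log_todd3 \<eta> a1 a2) y))"
  using assms(3) by (simp add: log_rem_3[OF assms(1,2)] exp_diff exp_minus field_simps)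

lemma mult_bernoulli_2:
  assumes a: "a1 \<noteq> 0" "a2 \<noteq> 0" shows "mult_bernoulli 2 x [a1, a2] = 2 * todd_coeff2 x a1 a2"
  using todd_coeff_explicit(3)[OF a, of x] by (simp add: todd_coeff_def)

text \<open>Taylor expansion of half the second Bernoulli polynomial. The left side is minus the
  coefficient of \<open>Ln y\<close> in \<open>log_todd3\<close>, which is why this polynomial
  governs both homogeneity and the exponential factor of \<open>F_fun\<close>.\<close>

lemma todd_coeff2_shift:
  assumes a: "a1 \<noteq> 0" "a2 \<noteq> 0"
  shows "y ^ 2 / (2 * (a1 * a2)) + todd_coeff1 \<eta> a1 a2 * y + todd_coeff2 \<eta> a1 a2 = todd_coeff2 (y + \<eta>) a1 a2"
  using a unfolding todd_coeff1_def todd_coeff2_def by (simp add: divide_simps) (simp add: algebra_simps power2_eq_square)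

text \<open>The quadratic part \<open>y^2 / (2 * a1 * a2)\<close> has mixed difference 1 and linear
  terms have none. Rescaling therefore changes the mixed difference of \<open>log_todd3\<close> by
  exactly one logarithm of the scale.\<close>

lemma cross_diff_todd_coeff2:
  assumes a: "a1 \<noteq> 0" "a2 \<noteq> 0"
  shows "cross_diff a1 a2 (\<lambda>y. todd_coeff2 (y + \<eta>) a1 a2) y = 1"
  using a unfolding cross_diff_def todd_coeff2_def by (simp add: divide_simps) (simp add: algebra_simps power2_eq_square)

lemma todd_coeff2_scale:
  assumes "\<mu> \<noteq> 0" shows "todd_coeff2 (\<mu> * \<eta>) (\<mu> * a1) (\<mu> * a2) = todd_coeff2 \<eta> a1 a2"
proof -
  have "todd_coeff2 (\<mu> * \<eta>) (\<mu> * a1) (\<mu> * a2) =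
      (\<mu>\<^sup>2 * (\<eta>\<^sup>2 / 2 - \<eta> * (a1 + a2) / 2 + (a1\<^sup>2 + a2\<^sup>2) / 12 + a1 * a2 / 4)) / (\<mu>\<^sup>2 * (a1 * a2))"
    unfolding todd_coeff2_def by (rule arg_cong2[where f = "(/)"]) (simp_all add: algebra_simps power2_eq_square)
  also have "\<dots> = todd_coeff2 \<eta> a1 a2" unfolding todd_coeff2_def using assms by (subst mult_divide_mult_cancel_left) auto
  finally show ?thesis .
qed

lemma log_todd3_scale:
  assumes a: "a1 \<noteq> 0" "a2 \<noteq> 0" "\<mu> \<noteq> 0" and L: "Ln (\<mu> * y) = L + Ln y"
  shows "log_todd3 (\<mu> * \<eta>) (\<mu> * a1) (\<mu> * a2) (\<mu> * y) = log_todd3 \<eta> a1 a2 y - L * todd_coeff2 (y + \<eta>) a1 a2"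
proof -
  have 0: "1 / ((\<mu> * a1) * (\<mu> * a2)) * ((\<mu> * y) ^ 2 * c) = 1 / (a1 * a2) * (y ^ 2 * c)" for c
    using a by (simp add: power2_eq_square)
  have 1: "todd_coeff1 (\<mu> * \<eta>) (\<mu> * a1) (\<mu> * a2) * (\<mu> * y * c) = todd_coeff1 \<eta> a1 a2 * (y * c)" for c
  proof -
    have "todd_coeff1 (\<mu> * \<eta>) (\<mu> * a1) (\<mu> * a2) = \<mu> * (\<eta> - (a1 + a2) / 2) / (\<mu> * (\<mu> * (a1 * a2)))"
      unfolding todd_coeff1_def by (rule arg_cong2[where f = "(/)"]) (simp_all add: algebra_simps add_divide_distrib)
    also have "\<dots> = todd_coeff1 \<eta> a1 a2 / \<mu>" using a by (simp add: todd_coeff1_def)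
    finally show ?thesis using a by simp
  qed
  show ?thesis
    unfolding log_todd3_def L 0 1 todd_coeff2_scale[OF a(3)] todd_coeff2_shift[OF a(1,2), symmetric]
    by (simp add: algebra_simps)
qed

text \<open>The difference of the two logarithms has imaginary part below \<pi> in absolute value,
  so it is the principal logarithm of its exponential \<mu>.\<close>

lemma Ln_mult_rhp:
  assumes "Re y > 0" "Re (\<mu> * y) > 0" shows "Ln (\<mu> * y) = Ln \<mu> + Ln y"
proof -
  define d where "d = Ln (\<mu> * y) - Ln y"
  have nz: "y \<noteq> 0" "\<mu> * y \<noteq> 0" using assms by (auto simp: complex_eq_iff)
  then have e: "exp d = \<mu>" by (simp add: d_def exp_diff)
  have "\<bar>Im (Ln y)\<bar> < pi / 2" "\<bar>Im (Ln (\<mu> * y))\<bar> < pi / 2"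
    using Re_Ln_pos_lt[OF nz(1)] Re_Ln_pos_lt[OF nz(2)] assms by auto
  then have "Ln (exp d) = d" by (intro Ln_exp) (auto simp: d_def)
  then show ?thesis unfolding e by (simp add: d_def)
qed

lemma exp_suminf_eq:
  fixes f g :: "nat \<Rightarrow> complex"
  assumes "summable f" "summable g" "\<And>m. exp (f m) = exp (g m)"
  shows "exp (suminf f) = exp (suminf g)"
proof (rule LIMSEQ_unique)
  show "(\<lambda>n. exp (\<Sum>m<n. f m)) \<longlonglongrightarrow> exp (suminf f)"
    by (intro tendsto_exp summable_LIMSEQ assms)
  show "(\<lambda>n. exp (\<Sum>m<n. f m)) \<longlonglongrightarrow> exp (suminf g)"
    using tendsto_exp[OF summable_LIMSEQ[OF assms(2)]] by (simp add: exp_sum assms(3))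
qed

lemma lat_pt_scale: "lat_pt (\<mu> * w) (\<mu> * a1) (\<mu> * a2) n = \<mu> * lat_pt w a1 a2 n"
  by (simp add: lat_pt_def algebra_simps)

lemma cone_lattice_scale:
  assumes "\<mu> \<noteq> 0"
  shows "\<mu> * x \<in> cone_lattice (\<mu> * a1) (\<mu> * a2) \<longleftrightarrow> x \<in> cone_lattice a1 a2"
proof -
  have "\<mu> * x = of_int n1 * (\<mu> * a1) + of_int n2 * (\<mu> * a2) \<longleftrightarrow> x = of_int n1 * a1 + of_int n2 * a2" for n1 n2
    using assms mult_left_cancel[of \<mu> x "of_int n1 * a1 + of_int n2 * a2"] by (simp add: algebra_simps)
  then show ?thesis unfolding cone_lattice_def by simp
qed

text \<open>
  The principal logarithms of \<open>\<mu> (y + \<eta>)\<close> and \<open>y + \<eta>\<close> need not differ by exactly \<open>Ln \<mu>\<close>, so only the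
  exponentials of the terms of the two series agree.
\<close>

lemma Gamma2_rhp_scale:
  assumes re: "Re a1 > 0" "Re a2 > 0" "Re (\<mu> * a1) > 0" "Re (\<mu> * a2) > 0"
  shows "Gamma2_rhp (\<mu> * x) (\<mu> * a1) (\<mu> * a2) = exp (- (todd_coeff2 x a1 a2 * Ln \<mu>)) * Gamma2_rhp x a1 a2"
proof (cases "x \<in> cone_lattice a1 a2")
  case False
  have nz: "\<mu> \<noteq> 0" "a1 \<noteq> 0" "a2 \<noteq> 0" using re by auto
  \<comment> \<open>Base point \<open>a1\<close>: it lies in the right half-plane before and after
    scaling, whatever \<open>x\<close> is.\<close>
  define \<eta> where "\<eta> = x - a1"
  define y where "y = (\<lambda>m. lat_pt a1 a1 a2 (prod_decode m))"
  have x: "a1 + \<eta> = x" "\<mu> * a1 + \<mu> * \<eta> = \<mu> * x" by (simp_all add: \<eta>_def algebra_simps)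
  have yD: "lat_pt a1 a1 a2 (prod_decode m) = y m" for m by (simp add: y_def)
  have \<mu>y: "lat_pt (\<mu> * a1) (\<mu> * a1) (\<mu> * a2) (prod_decode m) = \<mu> * y m" for m
    by (simp add: y_def lat_pt_scale)
  have nl: "a1 + \<eta> \<notin> cone_lattice a1 a2" "\<mu> * a1 + \<mu> * \<eta> \<notin> cone_lattice (\<mu> * a1) (\<mu> * a2)"
    unfolding x cone_lattice_scale[OF nz(1)] by (rule False)+
  note G = Gamma2_rhp_eq[OF re(1,1,2) order_refl nl(1), unfolded log_todd_3[OF nz(2,3)] x yD]
  note G' = Gamma2_rhp_eq[OF re(3,3,4) order_refl nl(2), unfolded log_todd_3[OF no_zero_divisors[OF nz(1,2)] no_zero_divisors[OF nz(1,3)]] x \<mu>y]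
  have Ln: "Ln (\<mu> * z) = Ln \<mu> + Ln z" if "Re z > 0" "Re (\<mu> * z) > 0" for z
    by (rule Ln_mult_rhp) (use that in auto)
  have "exp (log_rem 3 (\<mu> * \<eta>) (\<mu> * a1) (\<mu> * a2) (\<mu> * y m)) = exp (log_rem 3 \<eta> a1 a2 (y m))" for m
  proof -
    have ry: "Re (y m) > 0" unfolding y_def by (intro lat_pt_neq_0 re)
    have r\<mu>y: "Re (\<mu> * y m) > 0" unfolding \<mu>y[symmetric] by (intro lat_pt_neq_0 re)
    have yn: "y m + \<eta> \<noteq> 0" using nl(1) unfolding cone_lattice_iff y_def by blast
    have s: "log_todd3 (\<mu> * \<eta>) (\<mu> * a1) (\<mu> * a2) (\<mu> * z) = log_todd3 \<eta> a1 a2 z - Ln \<mu> * todd_coeff2 (z + \<eta>) a1 a2"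
      if "z \<in> {y m, y m + a1, y m + a2, y m + a1 + a2}" for z
    proof (rule log_todd3_scale[OF nz(2,3,1) Ln])
      show "Re z > 0" using that ry re by auto
      show "Re (\<mu> * z) > 0" using that r\<mu>y re by (auto simp: algebra_simps)
    qed
    have "cross_diff (\<mu> * a1) (\<mu> * a2) (log_todd3 (\<mu> * \<eta>) (\<mu> * a1) (\<mu> * a2)) (\<mu> * y m) =
        cross_diff a1 a2 (\<lambda>z. log_todd3 (\<mu> * \<eta>) (\<mu> * a1) (\<mu> * a2) (\<mu> * z)) (y m)"
      by (simp add: cross_diff_def algebra_simps)
    also have "\<dots> = cross_diff a1 a2 (log_todd3 \<eta> a1 a2) (y m) - Ln \<mu> * cross_diff a1 a2 (\<lambda>z. todd_coeff2 (z + \<eta>) a1 a2) (y m)"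
      by (simp only: cross_diff_def s insert_iff simp_thms) (simp add: algebra_simps)
    also have "\<dots> = cross_diff a1 a2 (log_todd3 \<eta> a1 a2) (y m) - Ln \<mu>" by (simp add: cross_diff_todd_coeff2[OF nz(2,3)])
    \<comment> \<open>The summand \<open>- Ln \<mu>\<close> offsets the factor \<mu> in
      \<open>\<mu> * (y m + \<eta>)\<close>, so the exponentials of the terms agree.\<close>
    finally have D: "cross_diff (\<mu> * a1) (\<mu> * a2) (log_todd3 (\<mu> * \<eta>) (\<mu> * a1) (\<mu> * a2)) (\<mu> * y m) =
        cross_diff a1 a2 (log_todd3 \<eta> a1 a2) (y m) - Ln \<mu>" .
    have "\<mu> * y m + \<mu> * \<eta> = \<mu> * (y m + \<eta>)" by (simp add: algebra_simps)
    then show ?thesis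
      using nz yn by (subst exp_log_rem_3, simp, simp, simp)
        (subst exp_log_rem_3, simp, simp, simp, simp add: D exp_diff)
  qed
  then have "exp (\<Sum>m. log_rem 3 (\<mu> * \<eta>) (\<mu> * a1) (\<mu> * a2) (\<mu> * y m)) = exp (\<Sum>m. log_rem 3 \<eta> a1 a2 (y m))"
    by (rule exp_suminf_eq[OF G'(2) G(2)])
  moreover have "log_todd3 (\<mu> * \<eta>) (\<mu> * a1) (\<mu> * a2) (\<mu> * a1) = log_todd3 \<eta> a1 a2 a1 - Ln \<mu> * todd_coeff2 x a1 a2"
    using log_todd3_scale[OF nz(2,3,1) Ln, of a1 \<eta>] re x by simp
  ultimately show ?thesis
    unfolding G(1) G'(1) exp_add by (simp only: exp_diff exp_minus) (simp add: field_simps)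
next
  case True
  have "\<mu> \<noteq> 0" using re by auto
  with True show ?thesis by (simp add: Gamma2_rhp_def cone_lattice_scale)
qed

section \<open>Rotation of the parameters into the right half-plane\<close>

lemma slit_iff: "z \<in> slit \<longleftrightarrow> z \<notin> \<real>\<^sub>\<le>\<^sub>0" and slit_nonzero: "z \<in> slit \<Longrightarrow> z \<noteq> 0"
  by (auto simp: slit_def)

lemma rhp_in_slit: "Re z > 0 \<Longrightarrow> z \<in> slit"
  by (auto simp: slit_iff complex_nonpos_Reals_iff)

lemma slit_Im_Ln: assumes "z \<in> slit" shows "\<bar>Im (Ln z)\<bar> < pi"
  using assms slit_nonzero[OF assms] Im_Ln_less_pi[of z] mpi_less_Im_Ln[of z]
  by (auto simp: slit_iff)

text \<open>Two rotations differ by \<open>\<mu> = l' / l\<close>, which maps one pair of parameters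
  in the right half-plane to another. The conditions on logarithms force
  \<open>Ln \<mu> = Ln l' - Ln l\<close>, which the prefactors compensate.\<close>

lemma Gamma2_via_indep:
  assumes "rotates_to_rhp l a1 a2" "rotates_to_rhp l' a1 a2" "a1 \<noteq> 0" "a2 \<noteq> 0"
  shows "Gamma2_via l x a1 a2 = Gamma2_via l' x a1 a2"
proof -
  note l = assms(1)[unfolded rotates_to_rhp_def] and l' = assms(2)[unfolded rotates_to_rhp_def]
  have nz: "l \<noteq> 0" "l' \<noteq> 0" using l l' slit_nonzero by auto
  define \<mu> where "\<mu> = l' / l"
  have \<mu>: "\<mu> * (l * z) = l' * z" for z using nz by (simp add: \<mu>_def)
  have Ln: "Ln \<mu> = Ln l' - Ln l"
    using Ln_mult_rhp[of "l * a1" \<mu>] l l' unfolding \<mu> by simp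
  have "Gamma2_rhp (l' * x) (l' * a1) (l' * a2) =
      exp (- (todd_coeff2 x a1 a2 * (Ln l' - Ln l))) * Gamma2_rhp (l * x) (l * a1) (l * a2)"
    using Gamma2_rhp_scale[of "l * a1" "l * a2" \<mu> "l * x"] l l'
    by (simp add: \<mu> Ln todd_coeff2_scale[OF nz(1)])
  then show ?thesis
    unfolding Gamma2_via_def mult_bernoulli_2[OF assms(3,4)]
    by (simp add: exp_add[symmetric] mult.assoc[symmetric] algebra_simps)
qed

lemma admissible_Im:
  assumes "admissible_params a1 a2" shows "\<bar>Im (Ln a2) - Im (Ln a1)\<bar> < pi / 2"
proof -
  note a = assms[unfolded admissible_params_def]
  then have "a2 / a1 \<noteq> 0" by auto
  then have "\<bar>Im (Ln (a2 / a1))\<bar> < pi / 2" using Re_Ln_pos_lt a by blast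
  then show ?thesis using a by simp
qed

lemma admissible_iff:
  "admissible_params a1 a2 \<longleftrightarrow> a1 \<in> slit \<and> a2 \<in> slit \<and> \<bar>Im (Ln a2) - Im (Ln a1)\<bar> < pi / 2"
proof (intro iffI)
  assume "a1 \<in> slit \<and> a2 \<in> slit \<and> \<bar>Im (Ln a2) - Im (Ln a1)\<bar> < pi / 2"
  then have a: "a1 \<in> slit" "a2 \<in> slit" and i: "\<bar>Im (Ln a2) - Im (Ln a1)\<bar> < pi / 2" by auto
  have nz: "a1 \<noteq> 0" "a2 \<noteq> 0" using a slit_nonzero by auto
  define d where "d = Ln a2 - Ln a1"
  have e: "exp d = a2 / a1" using nz by (simp add: d_def exp_diff)
  have "- pi < Im d" "Im d \<le> pi" using i pi_gt_zero unfolding d_def abs_less_iff by auto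
  then have "Ln (exp d) = d" by (rule Ln_exp)
  then have L: "Ln (a2 / a1) = Ln a2 - Ln a1" unfolding e by (simp add: d_def)
  moreover have "Re (a2 / a1) > 0"
    using Re_Ln_pos_lt[of "a2 / a1"] nz i unfolding L by simp
  ultimately show "admissible_params a1 a2" using a by (simp add: admissible_params_def)
next
  assume "admissible_params a1 a2"
  from admissible_Im[OF this] this show "a1 \<in> slit \<and> a2 \<in> slit \<and> \<bar>Im (Ln a2) - Im (Ln a1)\<bar> < pi / 2"
    by (auto simp: admissible_params_def)
qed

text \<open>Rotating by minus the mean of the two arguments makes them symmetric about zero, at
  distance less than \<pi>/4.\<close>

lemma rotates_to_rhp_exists:
  assumes "admissible_params a1 a2" shows "\<exists>l. rotates_to_rhp l a1 a2"
proof -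
  note a = assms[unfolded admissible_iff]
  have nz: "a1 \<noteq> 0" "a2 \<noteq> 0" using a slit_nonzero by auto
  define t where "t = (Im (Ln a1) + Im (Ln a2)) / 2"
  define d where "d = (Im (Ln a1) - Im (Ln a2)) / 2"
  define l where "l = exp (- (\<i> * of_real t))"
  have tp: "\<bar>t\<bar> < pi" using slit_Im_Ln[of a1] slit_Im_Ln[of a2] a by (auto simp: t_def)
  have Lnl: "Ln l = - (\<i> * of_real t)" unfolding l_def using tp by (intro Ln_exp) auto
  have l: "l \<in> slit"
  proof -
    have "Im (Ln l) \<noteq> pi" "l \<noteq> 0" using tp by (auto simp: Lnl l_def)
    then show ?thesis
      using Im_Ln_eq_pi[of l] by (auto simp: slit_iff complex_nonpos_Reals_iff complex_eq_iff)
  qed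
  have L: "Ln (l * b) = Ln l + Ln b \<and> Re (l * b) > 0" if "b \<noteq> 0" "\<bar>Im (Ln b) - t\<bar> < pi / 2" for b
  proof -
    have l0: "l \<noteq> 0" by (simp add: l_def)
    have Iml: "Im (Ln l) = - t" by (simp add: Lnl)
    have "Ln (l * b) = Ln l + Ln b"
      using that pi_gt_zero unfolding abs_less_iff by (intro Ln_times_simple l0) (simp_all add: Iml)
    moreover have "Re (l * b) > 0"
      using Re_Ln_pos_lt[of "l * b"] that calculation l0 by (simp add: Iml)
    ultimately show ?thesis by blast
  qed
  have "\<bar>Im (Ln a1) - t\<bar> < pi / 2" "\<bar>Im (Ln a2) - t\<bar> < pi / 2"
    using a unfolding t_def abs_less_iff by (auto simp: field_simps)
  then have "rotates_to_rhp l a1 a2"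
    using L[OF nz(1)] L[OF nz(2)] l by (simp add: rotates_to_rhp_def)
  then show ?thesis ..
qed

text \<open>For parameters in the right half-plane \<open>l = 1\<close> is a valid rotation, so both
  branches of the definition fall under independence of \<open>l\<close>.\<close>

lemma Gamma2_eq_via:
  assumes "admissible_params a1 a2" "rotates_to_rhp l a1 a2"
  shows "Gamma2 x a1 a2 = Gamma2_via l x a1 a2"
proof -
  have nz: "a1 \<noteq> 0" "a2 \<noteq> 0" using assms(1) slit_nonzero by (auto simp: admissible_params_def)
  show ?thesis
  proof (cases "Re a1 > 0 \<and> Re a2 > 0")
    case True
    have "rotates_to_rhp 1 a1 a2" using True by (auto simp: rotates_to_rhp_def rhp_in_slit)
    from Gamma2_via_indep[OF this assms(2) nz] True show ?thesis
      by (simp add: Gamma2_def) (simp add: Gamma2_via_def)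
  next
    case False
    show ?thesis
      unfolding Gamma2_def if_not_P[OF False]
      by (rule Gamma2_via_indep[OF someI_ex[OF rotates_to_rhp_exists[OF assms(1)]] assms(2) nz])
  qed
qed

section \<open>Holomorphy of the reciprocal\<close>

lemma mv_diff_log_todd3 [mv_diff_intros]:
  assumes "mv_diff \<eta> p" "mv_diff a1 p" "mv_diff a2 p" "mv_diff y p" "a1 p \<noteq> 0" "a2 p \<noteq> 0" "y p \<notin> \<real>\<^sub>\<le>\<^sub>0"
  shows "mv_diff (\<lambda>p. log_todd3 (\<eta> p) (a1 p) (a2 p) (y p)) p"
  unfolding log_todd3_def todd_coeff1_def todd_coeff2_def by (intro mv_diff_intros assms no_zero_divisors) auto

text \<open>Holomorphy in the parameters needs one constant for a whole neighbourhood, hence a bound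
  through \<open>c\<close> and \<open>A\<close> alone.\<close>

lemma todd_coeff_norm_le:
  assumes c: "c > 0" "c \<le> 1" "c \<le> Re a1" "c \<le> Re a2"
    and A: "A \<ge> 1" "norm \<eta> \<le> A" "norm a1 \<le> A" "norm a2 \<le> A" and k: "k < 3"
  shows "norm (todd_coeff k \<eta> a1 a2) \<le> 2 * A\<^sup>2 / c\<^sup>2"
proof -
  have nz: "a1 \<noteq> 0" "a2 \<noteq> 0" using c by auto
  have "c \<le> norm a1" "c \<le> norm a2" using c complex_Re_le_cmod order_trans by blast+
  then have d: "c\<^sup>2 \<le> norm (a1 * a2)" using c by (simp add: norm_mult power2_eq_square mult_mono)
  have q: "norm (N / (a1 * a2)) \<le> 2 * A\<^sup>2 / c\<^sup>2" if "norm N \<le> 2 * A\<^sup>2" for N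
    unfolding norm_divide using that d c by (intro frac_le) auto
  have A2: "1 \<le> A\<^sup>2" "A \<le> A\<^sup>2" using A mult_mono[of 1 A 1 A] by (auto simp: power2_eq_square)
  have s: "norm (a1 + a2) \<le> 2 * A" using norm_triangle_ineq[of a1 a2] A by linarith
  have m: "norm (x * y) \<le> X * Y" if "norm x \<le> X" "norm y \<le> Y" for x y :: complex and X Y
    unfolding norm_mult using that norm_ge_zero order_trans by (intro mult_mono) blast+
  consider "k = 0" | "k = 1" | "k = 2" using k by linarith
  then show ?thesis
  proof cases
    case 1
    then show ?thesis using q[of 1] A2 unfolding 1 todd_coeff_explicit[OF nz] by simp
  next
    case 2
    have "norm (\<eta> - (a1 + a2) / 2) \<le> norm \<eta> + norm ((a1 + a2) / 2)" by (rule norm_triangle_ineq4)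
    also have "\<dots> \<le> 2 * A\<^sup>2" using A s A2 by (simp add: norm_divide)
    finally show ?thesis unfolding 2 todd_coeff_explicit[OF nz] todd_coeff1_def by (rule q)
  next
    case 3
    have n1: "norm (\<eta>\<^sup>2 / 2) \<le> A\<^sup>2 / 2"
      using m[OF A(2) A(2)] by (simp add: norm_divide norm_power norm_mult power2_eq_square)
    have n2: "norm (\<eta> * (a1 + a2) / 2) \<le> A\<^sup>2"
      using m[OF A(2) s] by (simp add: norm_divide norm_mult power2_eq_square)
    have n3: "norm ((a1\<^sup>2 + a2\<^sup>2) / 12) \<le> A\<^sup>2 / 6"
      using m[OF A(3) A(3)] m[OF A(4) A(4)] norm_triangle_ineq[of "a1\<^sup>2" "a2\<^sup>2"]
      by (simp add: norm_divide norm_mult power2_eq_square)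
    have n4: "norm (a1 * a2 / 4) \<le> A\<^sup>2 / 4"
      using m[OF A(3) A(4)] by (simp add: norm_divide norm_mult power2_eq_square)
    have "norm (\<eta>\<^sup>2 / 2 - \<eta> * (a1 + a2) / 2 + (a1\<^sup>2 + a2\<^sup>2) / 12 + a1 * a2 / 4) \<le>
        norm (\<eta>\<^sup>2 / 2) + norm (\<eta> * (a1 + a2) / 2) + norm ((a1\<^sup>2 + a2\<^sup>2) / 12) + norm (a1 * a2 / 4)"
      by (smt (verit) norm_triangle_ineq norm_triangle_ineq4)
    also have "\<dots> \<le> 2 * A\<^sup>2" using n1 n2 n3 n4 A2 by linarith
    finally show ?thesis unfolding 3 todd_coeff_explicit[OF nz] todd_coeff2_def by (rule q)
  qed
qed

lemma log_rem_lat_pt_bound: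
  assumes c: "c > 0" "c \<le> 1" "c \<le> Re w" "c \<le> Re a1" "c \<le> Re a2"
    and A: "A \<ge> 1" "norm \<eta> \<le> A" "norm a1 \<le> A" "norm a2 \<le> A"
    and n: "c * lat_wt n \<ge> 16 * A"
  shows "norm (log_rem 3 \<eta> a1 a2 (lat_pt w a1 a2 n)) \<le>
     3 * (rem_const 3 (9 / 4) (2 * A\<^sup>2 / c\<^sup>2) * (8 * A) ^ 5 * c powr (- 11 / 4)) * lat_wt n powr (- 11 / 4)"
proof -
  have re: "Re w > 0" "Re a1 > 0" "Re a2 > 0" using c by auto
  have "norm (log_rem 3 \<eta> a1 a2 (lat_pt w a1 a2 n)) \<le>
    3 * (rem_const 3 (9 / 4) (2 * A\<^sup>2 / c\<^sup>2) * (8 * A) ^ (3 + 2) * (c * lat_wt n) powr (1 / 4 - real 3))"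
    by (rule log_rem_bound[OF re(2,3) lat_pt_neq_0(1)[OF re] A n norm_lat_pt_lower[OF c(3-5)]])
       (use todd_coeff_norm_le[OF c(1,2,4,5) A] in auto)
  then show ?thesis using c by (simp add: powr_mult)
qed

lemma mv_diff_tendsto:
  assumes "mv_diff f p0" shows "(f \<longlongrightarrow> f p0) (nhds p0)"
  using mv_diff_imp_isCont[OF assms] by (simp add: isCont_def tendsto_at_iff_tendsto_nhds)

text \<open>The product is expanded at the base point \<open>w = 1\<close>, with \<open>\<eta> = x - 1\<close>.\<close>

lemma mv_diff_inverse_Gamma2_rhp:
  fixes x b1 b2 :: "complex ^ 'n \<Rightarrow> complex"
  assumes V: "open V" "p0 \<in> V"
    and mv: "\<And>p. p \<in> V \<Longrightarrow> mv_diff x p" "\<And>p. p \<in> V \<Longrightarrow> mv_diff b1 p" "\<And>p. p \<in> V \<Longrightarrow> mv_diff b2 p"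
    and re: "Re (b1 p0) > 0" "Re (b2 p0) > 0"
  shows "mv_diff (\<lambda>p. inverse (Gamma2_rhp (x p) (b1 p) (b2 p))) p0"
proof -
  define c where "c = min 1 (min (Re (b1 p0)) (Re (b2 p0))) / 2"
  define A where "A = 1 + norm (b1 p0) + norm (b2 p0) + norm (x p0 - 1)"
  have c: "c > 0" "c \<le> 1" "c < Re (b1 p0)" "c < Re (b2 p0)" using re by (auto simp: c_def min_def)
  have A: "A \<ge> 1" "norm (b1 p0) < A" "norm (b2 p0) < A" "norm (x p0 - 1) < A"
    using norm_ge_zero[of "b1 p0"] norm_ge_zero[of "b2 p0"] norm_ge_zero[of "x p0 - 1"]
    unfolding A_def by linarith+
  have lim: "(x \<longlongrightarrow> x p0) (nhds p0)" "(b1 \<longlongrightarrow> b1 p0) (nhds p0)" "(b2 \<longlongrightarrow> b2 p0) (nhds p0)"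
    using mv V by (auto intro: mv_diff_tendsto)
  have "\<forall>\<^sub>F p in nhds p0. p \<in> V" using V by (rule eventually_nhds_in_open)
  moreover have "\<forall>\<^sub>F p in nhds p0. c < Re (b1 p)"
    by (rule order_tendstoD(1)[OF tendsto_Re[OF lim(2)] c(3)])
  moreover have "\<forall>\<^sub>F p in nhds p0. c < Re (b2 p)"
    by (rule order_tendstoD(1)[OF tendsto_Re[OF lim(3)] c(4)])
  moreover have "\<forall>\<^sub>F p in nhds p0. norm (b1 p) < A"
    by (rule order_tendstoD(2)[OF tendsto_norm[OF lim(2)] A(2)])
  moreover have "\<forall>\<^sub>F p in nhds p0. norm (b2 p) < A"
    by (rule order_tendstoD(2)[OF tendsto_norm[OF lim(3)] A(3)])
  moreover have "\<forall>\<^sub>F p in nhds p0. norm (x p - 1) < A"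
    by (rule order_tendstoD(2)[OF tendsto_norm[OF tendsto_diff[OF lim(1) tendsto_const]] A(4)])
  ultimately have "\<forall>\<^sub>F p in nhds p0. p \<in> V \<and> c < Re (b1 p) \<and> c < Re (b2 p) \<and> norm (b1 p) < A \<and>
      norm (b2 p) < A \<and> norm (x p - 1) < A" by eventually_elim auto
  then obtain r where r: "r > 0" and P: "\<And>p. p \<in> ball p0 r \<Longrightarrow> p \<in> V \<and> c < Re (b1 p) \<and> c < Re (b2 p) \<and>
      norm (b1 p) < A \<and> norm (b2 p) < A \<and> norm (x p - 1) < A"
    unfolding eventually_nhds_metric by (auto simp: dist_commute)
  define y where "y = (\<lambda>m p. lat_pt 1 (b1 p) (b2 p) (prod_decode m))"
  define t where "t = (\<lambda>m p. log_rem 3 (x p - 1) (b1 p) (b2 p) (y m p))"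
  \<comment> \<open>From index \<open>m0\<close> on, \<open>y m p + (x p - 1)\<close> stays in the
    right half-plane for all \<open>p\<close> in the ball, so the logarithmic terms are holomorphic.
    Earlier indices keep the plain factors \<open>E\<close>, which carry all the zeros.\<close>
  obtain m0 where m0: "\<And>m. m \<ge> m0 \<Longrightarrow> c * lat_wt (prod_decode m) \<ge> 16 * A"
    using eventually_lat_wt_prod_decode[OF c(1), of "16 * A"] by (auto simp: eventually_sequentially)
  have ball: "mv_diff x p" "mv_diff b1 p" "mv_diff b2 p" "b1 p \<noteq> 0" "b2 p \<noteq> 0" "Re (b1 p) > 0" "Re (b2 p) > 0"
    "Re (y m p) > 0" if "p \<in> ball p0 r" for p m
  proof -
    note P = P[OF that]
    show re: "Re (b1 p) > 0" "Re (b2 p) > 0" using P c by linarith+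
    then show "b1 p \<noteq> 0" "b2 p \<noteq> 0" by auto
    show "Re (y m p) > 0" unfolding y_def using re by (intro lat_pt_neq_0) auto
  qed (use P[OF that] mv in auto)
  have my: "mv_diff (y m) p" if "p \<in> ball p0 r" for m p
    unfolding y_def lat_pt_def by (intro mv_diff_intros ball[OF that])
  have yb: "norm (y m p) \<ge> 16 * A" "Re (y m p + (x p - 1)) > 0" if "p \<in> ball p0 r" "m \<ge> m0" for m p
  proof -
    have "c * lat_wt (prod_decode m) \<le> Re (y m p)"
      unfolding y_def using P[OF that(1)] c by (intro lat_pt_lower) auto
    then have 1: "16 * A \<le> Re (y m p)" using m0[OF that(2)] by linarith
    then show "norm (y m p) \<ge> 16 * A" using complex_Re_le_cmod order_trans by blast
    have "\<bar>Re (x p - 1)\<bar> < A" using P[OF that(1)] abs_Re_le_cmod[of "x p - 1"] by linarith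
    then show "Re (y m p + (x p - 1)) > 0" using 1 A(1) by (simp add: abs_less_iff)
  qed
  have slit: "z \<notin> \<real>\<^sub>\<le>\<^sub>0" if "Re z > 0" for z using that by (auto simp: complex_nonpos_Reals_iff)
  have mDD: "mv_diff (\<lambda>p. cross_diff (b1 p) (b2 p) (log_todd3 (x p - 1) (b1 p) (b2 p)) (y m p)) p" if p: "p \<in> ball p0 r" for m p
    unfolding cross_diff_def using ball[OF p] my[OF p]
    by (intro mv_diff_intros slit) (auto intro: add_pos_pos)
  have mt: "mv_diff (t m) p" if p: "p \<in> ball p0 r" "m \<ge> m0" for m p
  proof (rule mv_diff_transform[of "\<lambda>p. - Ln (y m p + (x p - 1)) - cross_diff (b1 p) (b2 p) (log_todd3 (x p - 1) (b1 p) (b2 p)) (y m p)"])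
    show "mv_diff (\<lambda>p. - Ln (y m p + (x p - 1)) - cross_diff (b1 p) (b2 p) (log_todd3 (x p - 1) (b1 p) (b2 p)) (y m p)) p"
      by (intro mv_diff_intros mDD slit yb p my ball)
    show "- Ln (y m q + (x q - 1)) - cross_diff (b1 q) (b2 q) (log_todd3 (x q - 1) (b1 q) (b2 q)) (y m q) = t m q"
      if "q \<in> ball p0 r" for q
      unfolding t_def using ball[OF that] by (simp add: log_rem_3)
  qed (use p in auto)
  define C where "C = 3 * (rem_const 3 (9 / 4) (2 * A\<^sup>2 / c\<^sup>2) * (8 * A) ^ 5 * c powr (- 11 / 4))"
  have tb: "norm (t m p) \<le> C * lat_wt (prod_decode m) powr (- 11 / 4)" if "p \<in> ball p0 r" "m \<ge> m0" for m p
    unfolding t_def y_def C_def using P[OF that(1)] c A m0[OF that(2)]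
    by (intro log_rem_lat_pt_bound) auto
  have sC: "summable (\<lambda>m. C * lat_wt (prod_decode (m + m0)) powr (- 11 / 4))"
    by (intro summable_mult summable_ignore_initial_segment lat_wt_prod_decode_summable) simp
  have mS: "mv_diff (\<lambda>p. \<Sum>m. t (m + m0) p) p0"
    by (rule mv_diff_suminf[OF _ r _ sC]) (rule mt tb; simp)+
  define E where "E = (\<lambda>m p. (y m p + (x p - 1)) * exp (cross_diff (b1 p) (b2 p) (log_todd3 (x p - 1) (b1 p) (b2 p)) (y m p)))"
  have p0: "p0 \<in> ball p0 r" using r by simp
  have "mv_diff (\<lambda>p. exp (- log_todd3 (x p - 1) (b1 p) (b2 p) 1) * (\<Prod>m<m0. E m p) * exp (- (\<Sum>m. t (m + m0) p))) p0"
    unfolding E_def by (intro mv_diff_intros mS mDD p0 my ball) auto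
  then show ?thesis
  proof (rule mv_diff_transform[OF _ open_ball p0])
    fix p assume p: "p \<in> ball p0 r"
    have re: "Re (b1 p) > 0" "Re (b2 p) > 0" "Re 1 > 0" and nz: "b1 p \<noteq> 0" "b2 p \<noteq> 0"
      using ball[OF p] by auto
    show "exp (- log_todd3 (x p - 1) (b1 p) (b2 p) 1) * (\<Prod>m<m0. E m p) * exp (- (\<Sum>m. t (m + m0) p)) =
        inverse (Gamma2_rhp (x p) (b1 p) (b2 p))"
    proof (cases "x p \<in> cone_lattice (b1 p) (b2 p)")
      \<comment> \<open>At a pole \<open>Gamma2_rhp\<close> is 0 by convention, and so is its
        \<open>inverse\<close>. The left side vanishes as well, because the vanishing factor has
        index below \<open>m0\<close>.\<close>
      case True
      then obtain n where n: "lat_pt 1 (b1 p) (b2 p) n + (x p - 1) = 0"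
        using cone_lattice_iff[of 1 "x p - 1"] by auto
      define m where "m = prod_encode n"
      have e: "y m p + (x p - 1) = 0" using n by (simp add: m_def y_def)
      then have "\<not> m \<ge> m0" using yb(2)[OF p, of m] by fastforce
      then have "(\<Prod>m<m0. E m p) = 0" using e by (intro prod_zero) (auto simp: E_def intro!: bexI[of _ m])
      with True show ?thesis by (simp add: Gamma2_rhp_def)
    next
      case False
      have x: "1 + (x p - 1) = x p" by simp
      have nl: "1 + (x p - 1) \<notin> cone_lattice (b1 p) (b2 p)" using False by simp
      note G = Gamma2_rhp_eq[OF re(3,1,2) order_refl nl, unfolded log_todd_3[OF nz] x]
      have s: "summable (\<lambda>m. t m p)" using G(2) by (simp add: t_def y_def)
      have "exp (- t m p) = E m p" for m
      proof -
        have "y m p + (x p - 1) \<noteq> 0" using nl unfolding cone_lattice_iff y_def by blast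
        then show ?thesis unfolding E_def t_def exp_minus by (simp add: exp_log_rem_3[OF nz])
      qed
      then have "(\<Prod>m<m0. E m p) = exp (- (\<Sum>m<m0. t m p))"
        by (simp only: sum_negf[symmetric] exp_sum[OF finite_lessThan])
      moreover have "(\<Sum>m. t m p) = (\<Sum>m. t (m + m0) p) + (\<Sum>m<m0. t m p)"
        by (rule suminf_split_initial_segment[OF s])
      moreover have "Gamma2_rhp (x p) (b1 p) (b2 p) = exp (log_todd3 (x p - 1) (b1 p) (b2 p) 1 + (\<Sum>m. t m p))"
        using G(1) by (simp add: t_def y_def)
      ultimately show ?thesis by (simp add: exp_minus[symmetric] exp_add[symmetric] algebra_simps)
    qed
  qed
qed

section \<open>Zeros, poles and symmetries\<close>

lemma F_fun_eq:
  assumes "admissible_params a1 a2" "rotates_to_rhp l a1 a2"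
  shows "F_fun w \<eta> a1 a2 = Gamma2_rhp (l * (w + \<eta>)) (l * a1) (l * a2) *
     exp (todd_coeff2 (w + \<eta>) a1 a2 * (Ln l + Ln w) +
       (- (3 * w\<^sup>2 / (4 * a1 * a2)) - \<eta> * w / (a1 * a2) + w * (a1 + a2) / (2 * a1 * a2)))"
proof -
  have nz: "a1 \<noteq> 0" "a2 \<noteq> 0" using assms(1) slit_nonzero by (auto simp: admissible_params_def)
  have *: "exp (b * (x + y) + E) = exp (2 * b / 2 * x) * exp (2 * b / 2 * y) * exp E" for b x y E :: complex
    by (simp add: exp_add distrib_left)
  show ?thesis
    unfolding F_fun_def Gamma2_eq_via[OF assms] Gamma2_via_def mult_bernoulli_2[OF nz] *
    by (simp only: mult_ac)
qed

text \<open>The value 0 marks the poles and nothing else, since \<open>Gamma2_rhp\<close> is an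
  exponential elsewhere. With \<open>inverse 0 = 0\<close>, \<open>inverse (F_vec p)\<close> is thus
  the true reciprocal on the whole domain.\<close>

lemma F_fun_eq_0_iff:
  assumes "admissible_params a1 a2"
  shows "F_fun w \<eta> a1 a2 = 0 \<longleftrightarrow> w + \<eta> \<in> cone_lattice a1 a2"
proof -
  obtain l where l: "rotates_to_rhp l a1 a2" using rotates_to_rhp_exists[OF assms] ..
  then have "l \<noteq> 0" by (auto simp: rotates_to_rhp_def slit_def)
  then show ?thesis unfolding F_fun_eq[OF assms l] by (simp add: Gamma2_rhp_def cone_lattice_scale)
qed

lemma F_vec_eq_0_iff: "p \<in> F_domain \<Longrightarrow> F_vec p = 0 \<longleftrightarrow> p \<in> F_polar_set"
  by (simp add: F_vec_def F_domain_def F_polar_set_def F_fun_eq_0_iff)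

lemma eventually_slit:
  assumes "(f \<longlongrightarrow> z) F" "z \<in> slit" shows "\<forall>\<^sub>F p in F. f p \<in> slit"
  using assms by (intro topological_tendstoD) (auto simp: slit_def)

lemma rotates_iff:
  assumes "a1 \<in> slit" "a2 \<in> slit" "l \<in> slit"
  shows "rotates_to_rhp l a1 a2 \<longleftrightarrow>
    \<bar>Im (Ln l) + Im (Ln a1)\<bar> < pi / 2 \<and> \<bar>Im (Ln l) + Im (Ln a2)\<bar> < pi / 2"
proof -
  have nz: "l \<noteq> 0" "a1 \<noteq> 0" "a2 \<noteq> 0" using assms slit_nonzero by auto
  have "(Re (l * a) > 0 \<and> Ln (l * a) = Ln l + Ln a) \<longleftrightarrow> \<bar>Im (Ln l) + Im (Ln a)\<bar> < pi / 2"
    if "a \<noteq> 0" for a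
  proof
    assume "Re (l * a) > 0 \<and> Ln (l * a) = Ln l + Ln a"
    then show "\<bar>Im (Ln l) + Im (Ln a)\<bar> < pi / 2"
      using Re_Ln_pos_lt[of "l * a"] nz that by simp
  next
    assume i: "\<bar>Im (Ln l) + Im (Ln a)\<bar> < pi / 2"
    then have "- pi < Im (Ln l) + Im (Ln a)" "Im (Ln l) + Im (Ln a) \<le> pi"
      using pi_gt_zero unfolding abs_less_iff by auto
    then have L: "Ln (l * a) = Ln l + Ln a" using nz that by (intro Ln_times_simple) auto
    then show "Re (l * a) > 0 \<and> Ln (l * a) = Ln l + Ln a"
      using Re_Ln_pos_lt[of "l * a"] nz that i by simp
  qed
  then show ?thesis using nz assms by (auto simp: rotates_to_rhp_def)
qed

text \<open>Admissibility and the rotation property are strict inequalities between continuous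
  arguments, so one constant \<open>l\<close> serves a neighbourhood and the local formula for
  \<open>F_vec\<close> involves no choice.\<close>

lemma eventually_F_domain:
  fixes p0 :: "complex ^ 4"
  assumes p0: "p0 \<in> F_domain" and l: "rotates_to_rhp l (p0 $ 3) (p0 $ 4)"
  shows "\<forall>\<^sub>F p in nhds p0. p \<in> F_domain \<and> rotates_to_rhp l (p $ 3) (p $ 4)"
proof -
  have s: "p0 $ 1 \<in> slit" "p0 $ 3 \<in> slit" "p0 $ 4 \<in> slit" "l \<in> slit"
    and d: "\<bar>Im (Ln (p0 $ 4)) - Im (Ln (p0 $ 3))\<bar> < pi / 2"
    using p0 l by (auto simp: F_domain_def admissible_iff rotates_to_rhp_def)
  note r = l[unfolded rotates_iff[OF s(2,3,4)]]
  have n: "((\<lambda>p. p $ i) \<longlongrightarrow> p0 $ i) (nhds p0)" for i by (rule mv_diff_tendsto[OF mv_diff_nth])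
  have L: "((\<lambda>p. Im (Ln (p $ i))) \<longlongrightarrow> Im (Ln (p0 $ i))) (nhds p0)" if "p0 $ i \<in> slit" for i
    using that by (intro tendsto_intros n) (auto simp: slit_def)
  have "\<forall>\<^sub>F p :: complex ^ 4 in nhds p0. p $ 1 \<in> slit" by (rule eventually_slit[OF n s(1)])
  moreover have "\<forall>\<^sub>F p :: complex ^ 4 in nhds p0. p $ 3 \<in> slit" by (rule eventually_slit[OF n s(2)])
  moreover have "\<forall>\<^sub>F p :: complex ^ 4 in nhds p0. p $ 4 \<in> slit" by (rule eventually_slit[OF n s(3)])
  moreover have "\<forall>\<^sub>F p :: complex ^ 4 in nhds p0. \<bar>Im (Ln (p $ 4)) - Im (Ln (p $ 3))\<bar> < pi / 2"
    by (rule order_tendstoD(2)[OF tendsto_rabs[OF tendsto_diff[OF L L]] d]) (rule s)+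
  moreover have "\<forall>\<^sub>F p :: complex ^ 4 in nhds p0. \<bar>Im (Ln l) + Im (Ln (p $ 3))\<bar> < pi / 2"
    by (rule order_tendstoD(2)[OF tendsto_rabs[OF tendsto_add[OF tendsto_const L]]]) (use r s in auto)
  moreover have "\<forall>\<^sub>F p :: complex ^ 4 in nhds p0. \<bar>Im (Ln l) + Im (Ln (p $ 4))\<bar> < pi / 2"
    by (rule order_tendstoD(2)[OF tendsto_rabs[OF tendsto_add[OF tendsto_const L]]]) (use r s in auto)
  ultimately show ?thesis
    by eventually_elim (use s in \<open>simp add: F_domain_def admissible_iff rotates_iff\<close>)
qed

lemma F_domain_rotates:
  fixes p :: "complex ^ 4"
  assumes "p \<in> F_domain" obtains l where "rotates_to_rhp l (p $ 3) (p $ 4)"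
  using assms rotates_to_rhp_exists unfolding F_domain_def by blast

lemma open_F_domain: "open F_domain"
  unfolding open_subopen[of F_domain]
proof
  fix p assume p: "p \<in> F_domain"
  obtain l where l: "rotates_to_rhp l (p $ 3) (p $ 4)" by (rule F_domain_rotates[OF p])
  show "\<exists>T. open T \<and> p \<in> T \<and> T \<subseteq> F_domain"
    using eventually_F_domain[OF p l] unfolding eventually_nhds by blast
qed

lemma mv_diff_inverse_F_vec:
  assumes p0: "p0 \<in> F_domain" shows "mv_diff (\<lambda>p. inverse (F_vec p)) p0"
proof -
  obtain l where l: "rotates_to_rhp l (p0 $ 3) (p0 $ 4)" by (rule F_domain_rotates[OF p0])
  obtain V where V: "open V" "p0 \<in> V"
    and P: "\<And>p :: complex ^ 4. p \<in> V \<Longrightarrow> p \<in> F_domain \<and> rotates_to_rhp l (p $ 3) (p $ 4)"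
    using eventually_F_domain[OF p0 l] unfolding eventually_nhds by blast
  define e where "e = (\<lambda>p :: complex ^ 4. (- (3 * (p $ 1)\<^sup>2 / (4 * p $ 3 * p $ 4)) - p $ 2 * p $ 1 / (p $ 3 * p $ 4)
      + p $ 1 * (p $ 3 + p $ 4) / (2 * p $ 3 * p $ 4)))"
  have G: "mv_diff (\<lambda>p. inverse (Gamma2_rhp (l * (p $ 1 + p $ 2)) (l * p $ 3) (l * p $ 4))) p0"
    by (rule mv_diff_inverse_Gamma2_rhp[OF V]) (use l in \<open>auto intro!: mv_diff_intros simp: rotates_to_rhp_def\<close>)
  have nz: "p0 $ 3 \<noteq> 0" "p0 $ 4 \<noteq> 0" and w: "p0 $ 1 \<notin> \<real>\<^sub>\<le>\<^sub>0"
    using p0 slit_nonzero by (auto simp: F_domain_def admissible_iff slit_iff)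
  have "mv_diff (\<lambda>p. inverse (Gamma2_rhp (l * (p $ 1 + p $ 2)) (l * p $ 3) (l * p $ 4)) *
      exp (- (todd_coeff2 (p $ 1 + p $ 2) (p $ 3) (p $ 4) * (Ln l + Ln (p $ 1)) + e p))) p0"
    unfolding e_def todd_coeff2_def by (intro mv_diff_intros G no_zero_divisors nz w) auto
  then show ?thesis
  proof (rule mv_diff_transform[OF _ V])
    fix p assume "p \<in> V"
    note P = P[OF this]
    have "F_vec p = Gamma2_rhp (l * (p $ 1 + p $ 2)) (l * p $ 3) (l * p $ 4) *
      exp (todd_coeff2 (p $ 1 + p $ 2) (p $ 3) (p $ 4) * (Ln l + Ln (p $ 1)) + e p)"
      using P by (simp add: F_vec_def F_domain_def F_fun_eq[of _ _ l] e_def)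
    then show "inverse (Gamma2_rhp (l * (p $ 1 + p $ 2)) (l * p $ 3) (l * p $ 4)) *
      exp (- (todd_coeff2 (p $ 1 + p $ 2) (p $ 3) (p $ 4) * (Ln l + Ln (p $ 1)) + e p)) = inverse (F_vec p)"
      by (simp only: exp_minus inverse_mult_distrib)
  qed
qed

text \<open>The domain does not constrain \<eta>, so it suffices to move this coordinate: a ball is
  uncountable, the cone lattice countable.\<close>

lemma F_domain_dense:
  assumes O: "open W" "W \<subseteq> F_domain" "p \<in> W"
  obtains q where "q \<in> W" "q \<notin> F_polar_set"
proof -
  obtain r where r: "r > 0" "ball p r \<subseteq> W" using O open_contains_ball by blast
  have "countable (cone_lattice (p $ 3) (p $ 4))"
  proof (rule countable_subset)
    show "cone_lattice (p $ 3) (p $ 4) \<subseteq> range (\<lambda>(n1 :: int, n2 :: int). of_int n1 * p $ 3 + of_int n2 * p $ 4)"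
      by (auto simp: cone_lattice_def)
  qed simp
  then have "\<not> ball (p $ 1 + p $ 2) r \<subseteq> cone_lattice (p $ 3) (p $ 4)"
    using uncountable_ball[OF r(1), of "p $ 1 + p $ 2"] by (intro notI) (drule countable_subset, simp_all)
  then obtain z where z: "z \<in> ball (p $ 1 + p $ 2) r" "z \<notin> cone_lattice (p $ 3) (p $ 4)" by blast
  define t where "t = z - (p $ 1 + p $ 2)"
  define q where "q = p + axis 2 t"
  have "norm t < r" using z by (simp add: t_def dist_norm norm_minus_commute)
  then have "q \<in> ball p r" by (simp add: q_def dist_norm norm_axis)
  moreover have "q \<notin> F_polar_set"
    using z by (simp add: F_polar_set_def q_def axis_def t_def)
  ultimately show thesis using r that by blast
qed

lemma mv_diff_F_vec:
  assumes p: "p \<in> F_domain" "p \<notin> F_polar_set" shows "mv_diff F_vec p"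
  using mv_diff_inverse[OF mv_diff_inverse_F_vec[OF p(1)]] p by (simp add: F_vec_eq_0_iff)

lemma mv_meromorphic_F_vec: "mv_meromorphic_on F_vec F_domain"
  unfolding mv_meromorphic_on_def
proof
  fix p assume p: "p \<in> F_domain"
  have "F_domain \<subseteq> closure {p \<in> F_domain. inverse (F_vec p) \<noteq> 0}"
  proof
    fix p assume p: "p \<in> F_domain"
    show "p \<in> closure {p \<in> F_domain. inverse (F_vec p) \<noteq> 0}"
      unfolding closure_iff_nhds_not_empty
    proof (intro allI impI)
      fix A V assume A: "V \<subseteq> A" "open V" "p \<in> V"
      have "open (V \<inter> F_domain)" "V \<inter> F_domain \<subseteq> F_domain" "p \<in> V \<inter> F_domain"
        using A p open_F_domain by auto
      then obtain q where "q \<in> V \<inter> F_domain" "q \<notin> F_polar_set" by (rule F_domain_dense)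
      then show "{p \<in> F_domain. inverse (F_vec p) \<noteq> 0} \<inter> A \<noteq> {}"
        using A by (auto simp: F_vec_eq_0_iff)
    qed
  qed
  then show "\<exists>U g h. open U \<and> p \<in> U \<and> U \<subseteq> F_domain \<and> mv_holomorphic_on g U \<and> mv_holomorphic_on h U \<and>
      U \<subseteq> closure {p \<in> U. h p \<noteq> 0} \<and> (\<forall>p\<in>U. h p \<noteq> 0 \<longrightarrow> F_vec p = g p / h p)"
    using p open_F_domain mv_diff_inverse_F_vec
    by (intro exI[of _ F_domain] exI[of _ "\<lambda>_. 1"] exI[of _ "\<lambda>p. inverse (F_vec p)"])
       (auto simp: mv_holomorphic_on_iff divide_inverse intro: mv_diff_const)
qed

text \<open>A regular value 0 would make \<open>g q * inverse (F_vec q)\<close> small near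
  \<open>p\<close>, yet it equals 1 wherever \<open>g\<close> agrees with \<open>F_vec\<close> off
  the polar set, and such points accumulate at \<open>p\<close>. The argument covers polar
  \<open>p\<close> too.\<close>

lemma not_mv_zero_F_vec:
  assumes p: "p \<in> F_domain" shows "\<not> mv_zero F_vec p"
proof
  assume "mv_zero F_vec p"
  then obtain U g where U: "open U" "p \<in> U" "mv_holomorphic_on g U" "g p = 0"
    "U \<subseteq> closure (interior {p. F_vec p = g p})"
    unfolding mv_zero_def mv_regular_value_def by blast
  have "mv_diff g p" using U by (simp add: mv_holomorphic_on_iff)
  from mv_diff_tendsto[OF mv_diff_mult[OF this mv_diff_inverse_F_vec[OF p]]]
  have "((\<lambda>q. g q * inverse (F_vec q)) \<longlongrightarrow> 0) (nhds p)" using U(4) by simp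
  then have "\<forall>\<^sub>F q in nhds p. norm (g q * inverse (F_vec q)) < 1"
    using order_tendstoD(2)[OF tendsto_norm_zero, of _ "nhds p" 1] by auto
  then obtain W where W: "open W" "p \<in> W" "\<And>q. q \<in> W \<Longrightarrow> norm (g q * inverse (F_vec q)) < 1"
    unfolding eventually_nhds by blast
  have "p \<in> closure (interior {p. F_vec p = g p})" using U by blast
  then obtain q0 where q0: "q0 \<in> W \<inter> F_domain \<inter> interior {p. F_vec p = g p}"
    using W p open_F_domain open_Int_closure_eq_empty[of "W \<inter> F_domain" "interior {p. F_vec p = g p}"]
    by blast
  have "open (W \<inter> F_domain \<inter> interior {p. F_vec p = g p})" using W open_F_domain by auto
  then obtain q where q: "q \<in> W \<inter> F_domain \<inter> interior {p. F_vec p = g p}" "q \<notin> F_polar_set"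
    by (rule F_domain_dense[OF _ _ q0]) auto
  then have "F_vec q = g q" "F_vec q \<noteq> 0" using interior_subset[of "{p. F_vec p = g p}"] by (auto simp: F_vec_eq_0_iff)
  then have "g q * inverse (F_vec q) = 1" by simp
  then show False using W(3)[of q] q by simp
qed

lemma mv_pole_F_vec:
  assumes p: "p \<in> F_domain" "mv_pole F_vec p" shows "p \<in> F_polar_set"
proof (rule ccontr)
  assume np: "p \<notin> F_polar_set"
  have "(F_vec \<longlongrightarrow> F_vec p) (nhds p)" by (rule mv_diff_tendsto[OF mv_diff_F_vec[OF p(1) np]])
  moreover have "F_vec p \<noteq> 0" using p np by (simp add: F_vec_eq_0_iff)
  ultimately have "\<forall>\<^sub>F q in nhds p. F_vec q \<in> - {0}" by (intro topological_tendstoD) auto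
  then obtain W where W: "open W" "p \<in> W" "\<And>q. q \<in> W \<Longrightarrow> F_vec q \<noteq> 0"
    unfolding eventually_nhds by blast
  have "mv_holomorphic_on F_vec (W \<inter> F_domain)"
    unfolding mv_holomorphic_on_iff
  proof
    fix z assume z: "z \<in> W \<inter> F_domain"
    then show "mv_diff F_vec z" using W(3)[of z] F_vec_eq_0_iff[of z] by (intro mv_diff_F_vec) blast+
  qed
  then have "mv_regular_value F_vec p (F_vec p)"
    unfolding mv_regular_value_def using W p open_F_domain
    by (intro exI[of _ "W \<inter> F_domain"] exI[of _ F_vec]) auto
  then show False using p(2) by (auto simp: mv_pole_def)
qed

section \<open>Symmetry and homogeneity\<close>

lemma mult_bernoulli_commute: "mult_bernoulli k x [a1, a2] = mult_bernoulli k x [a2, a1]"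
  by (simp add: mult_bernoulli_def mult.commute)

lemma cone_lattice_commute: "cone_lattice a1 a2 = cone_lattice a2 a1"
  unfolding cone_lattice_def by (auto simp: add.commute) (metis add.commute)+

lemma zeta2_commute: "zeta2 s x a1 a2 = zeta2 s x a2 a1"
proof -
  have "(\<Sum>\<^sub>\<infinity>(n1, n2)\<in>UNIV. (x + of_nat n1 * a1 + of_nat n2 * a2) powr (- s)) =
        (\<Sum>\<^sub>\<infinity>(n1, n2)\<in>UNIV. (x + of_nat n1 * a2 + of_nat n2 * a1) powr (- s))" for s
    using infsum_reindex_bij_betw[of prod.swap UNIV UNIV "\<lambda>(n1, n2). (x + of_nat n1 * a2 + of_nat n2 * a1) powr (- s)"]
    by (simp add: case_prod_unfold algebra_simps)
  then show ?thesis unfolding zeta2_def by simp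
qed

lemma Gamma2_commute: "Gamma2 x a1 a2 = Gamma2 x a2 a1"
proof -
  have G: "Gamma2_rhp x a1 a2 = Gamma2_rhp x a2 a1" for x a1 a2
    unfolding Gamma2_rhp_def cone_lattice_commute[of a1 a2] zeta2_commute[of _ x a1 a2] ..
  have V: "Gamma2_via l x a1 a2 = Gamma2_via l x a2 a1" for l
    unfolding Gamma2_via_def mult_bernoulli_commute[of _ x a1 a2] G[of _ "l * a1" "l * a2"] ..
  have R: "(\<lambda>l. rotates_to_rhp l a1 a2) = (\<lambda>l. rotates_to_rhp l a2 a1)"
    by (auto simp: rotates_to_rhp_def fun_eq_iff)
  show ?thesis unfolding Gamma2_def R V G[of x a1 a2] by (simp add: conj_commute)
qed

lemma F_fun_commute: "F_fun w \<eta> a1 a2 = F_fun w \<eta> a2 a1"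
  unfolding F_fun_def Gamma2_commute[of "w + \<eta>" a1 a2] mult_bernoulli_commute[of 2 "w + \<eta>" a1 a2]
  by (simp add: mult_ac add_ac)

text \<open>The difference of the two sides is continuous in \<open>l\<close> with values in the
  integer multiples of \<open>2 * pi * \<i>\<close>, hence constant on the connected set, and it is
  0 at \<open>l = 1\<close>.\<close>

lemma Ln_diff_constant:
  assumes C: "connected C" "1 \<in> C" "\<And>l. l \<in> C \<Longrightarrow> l \<noteq> 0 \<and> l * w \<in> slit \<and> l * a \<in> slit" and l: "l \<in> C"
  shows "Ln (l * w) - Ln w = Ln (l * a) - Ln a"
proof -
  define \<phi> where "\<phi> = (\<lambda>l. Ln (l * w) - Ln w - (Ln (l * a) - Ln a))"
  have nz: "w \<noteq> 0" "a \<noteq> 0" using C(3)[OF C(2)] slit_nonzero by auto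
  have e: "exp (\<phi> l) = 1" if "l \<in> C" for l
    using C(3)[OF that] nz by (simp add: \<phi>_def exp_diff)
  have "\<phi> constant_on C"
  proof (rule continuous_discrete_range_constant[OF C(1)])
    show "continuous_on C \<phi>"
      unfolding \<phi>_def using C(3) by (intro continuous_intros) (auto simp: slit_def)
    show "\<exists>e>0. \<forall>y. y \<in> C \<and> \<phi> y \<noteq> \<phi> x \<longrightarrow> e \<le> norm (\<phi> y - \<phi> x)" if x: "x \<in> C" for x
    proof (intro exI[of _ "2 * pi"] conjI allI impI)
      fix y assume y: "y \<in> C \<and> \<phi> y \<noteq> \<phi> x"
      have "exp (\<phi> y) = exp (\<phi> x)" using e x y by simp
      then obtain n :: int where n: "\<phi> y = \<phi> x + of_int (2 * n) * pi * \<i>" unfolding exp_eq by auto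
      then have "n \<noteq> 0" using y by auto
      then have "1 \<le> \<bar>real_of_int n\<bar>" by linarith
      moreover have "norm (\<phi> y - \<phi> x) = 2 * pi * \<bar>real_of_int n\<bar>"
        unfolding n by (simp add: norm_mult)
      ultimately show "2 * pi \<le> norm (\<phi> y - \<phi> x)" by simp
    qed simp
  qed
  then have "\<phi> l = \<phi> 1" using l C(2) unfolding constant_on_def by metis
  then show ?thesis by (simp add: \<phi>_def)
qed

lemma F_fun_homogeneous:
  assumes w: "w \<in> slit" and a: "admissible_params a1 a2"
    and l: "l \<in> connected_component_set {l. l \<noteq> 0 \<and> l * w \<in> slit \<and> l * a1 \<in> slit \<and> l * a2 \<in> slit} 1"
  shows "F_fun (l * w) (l * \<eta>) (l * a1) (l * a2) = F_fun w \<eta> a1 a2"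
proof -
  define S where "S = {l. l \<noteq> 0 \<and> l * w \<in> slit \<and> l * a1 \<in> slit \<and> l * a2 \<in> slit}"
  define C where "C = connected_component_set S 1"
  have as: "a1 \<in> slit" "a2 \<in> slit" using a by (auto simp: admissible_params_def)
  have "1 \<in> S" using w as by (simp add: S_def)
  then have C: "connected C" "1 \<in> C" "l \<in> C" "C \<subseteq> S"
    using l[folded S_def] connected_component_subset[of S 1]
    by (simp_all add: C_def connected_component_refl)
  have CS: "\<And>l. l \<in> C \<Longrightarrow> l \<noteq> 0 \<and> l * w \<in> slit \<and> l * a1 \<in> slit \<and> l * a2 \<in> slit"
    using C(4) by (auto simp: S_def)
  \<comment> \<open>The common increment of all three logarithms. It is a logarithm of
    \<open>l\<close>, but not necessarily the principal one.\<close>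
  define d where "d = Ln (l * w) - Ln w"
  have d1: "Ln (l * a1) = Ln a1 + d"
    using Ln_diff_constant[OF C(1,2) _ C(3), of w a1] CS by (simp add: d_def algebra_simps)
  have d2: "Ln (l * a2) = Ln a2 + d"
    using Ln_diff_constant[OF C(1,2) _ C(3), of w a2] CS by (simp add: d_def algebra_simps)
  have l0: "l \<noteq> 0" and sl: "l * a1 \<in> slit" "l * a2 \<in> slit" using CS[OF C(3)] by auto
  have a': "admissible_params (l * a1) (l * a2)"
    using a sl unfolding admissible_iff d1 d2 by simp
  obtain m where m: "rotates_to_rhp m a1 a2" using rotates_to_rhp_exists[OF a] ..
  obtain m' where m': "rotates_to_rhp m' (l * a1) (l * a2)" using rotates_to_rhp_exists[OF a'] ..
  note mm = m[unfolded rotates_to_rhp_def] m'[unfolded rotates_to_rhp_def]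
  have m0: "m \<noteq> 0" using mm slit_nonzero by auto
  \<comment> \<open>\<open>m\<close> rotates the old parameters and \<open>m'\<close> the scaled
    ones; \<mu> compares the two results inside the right half-plane, where the scaling law is
    available.\<close>
  define \<mu> where "\<mu> = m' * l / m"
  have \<mu>: "m' * (l * z) = \<mu> * (m * z)" for z using m0 by (simp add: \<mu>_def)
  have L: "Ln \<mu> = Ln m' - Ln m + d"
  proof -
    have "Ln (\<mu> * (m * a1)) = Ln \<mu> + Ln (m * a1)"
      by (rule Ln_mult_rhp) (use mm in \<open>auto simp only: \<mu>[symmetric]\<close>)
    moreover have "Ln (m' * (l * a1)) = Ln m' + Ln (l * a1)" "Ln (m * a1) = Ln m + Ln a1"
      using mm by blast+
    ultimately show ?thesis unfolding \<mu>[symmetric] d1 by (simp add: algebra_simps)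
  qed
  define b where "b = todd_coeff2 (w + \<eta>) a1 a2"
  have bl: "todd_coeff2 (l * w + l * \<eta>) (l * a1) (l * a2) = b" "todd_coeff2 (m * (w + \<eta>)) (m * a1) (m * a2) = b"
    using todd_coeff2_scale[OF l0, of "w + \<eta>"] todd_coeff2_scale[OF m0, of "w + \<eta>"] by (simp_all add: b_def distrib_left)
  have G: "Gamma2_rhp (m' * (l * w + l * \<eta>)) (m' * (l * a1)) (m' * (l * a2)) =
      exp (- (b * Ln \<mu>)) * Gamma2_rhp (m * (w + \<eta>)) (m * a1) (m * a2)"
  proof -
    have "Gamma2_rhp (\<mu> * (m * (w + \<eta>))) (\<mu> * (m * a1)) (\<mu> * (m * a2)) =
      exp (- (b * Ln \<mu>)) * Gamma2_rhp (m * (w + \<eta>)) (m * a1) (m * a2)"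
      unfolding bl(2)[symmetric]
      by (rule Gamma2_rhp_scale) (use mm in \<open>auto simp only: \<mu>[symmetric]\<close>)
    then show ?thesis unfolding \<mu>[symmetric] by (simp only: distrib_left)
  qed
  define e where "e = - (3 * w\<^sup>2 / (4 * a1 * a2)) - \<eta> * w / (a1 * a2) + w * (a1 + a2) / (2 * a1 * a2)"
  have el: "- (3 * (l * w)\<^sup>2 / (4 * (l * a1) * (l * a2))) - l * \<eta> * (l * w) / (l * a1 * (l * a2))
      + l * w * (l * a1 + l * a2) / (2 * (l * a1) * (l * a2)) = e"
  proof -
    have "3 * (l * w)\<^sup>2 / (4 * (l * a1) * (l * a2)) = 3 * w\<^sup>2 / (4 * a1 * a2)"
      "l * \<eta> * (l * w) / (l * a1 * (l * a2)) = \<eta> * w / (a1 * a2)"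
      using l0 by (simp_all add: power2_eq_square)
    moreover have "l * w * (l * a1 + l * a2) / (2 * (l * a1) * (l * a2)) = w * (a1 + a2) / (2 * a1 * a2)"
    proof -
      have "l * w * (l * a1 + l * a2) / (2 * (l * a1) * (l * a2)) =
          (l * l) * (w * (a1 + a2)) / ((l * l) * (2 * a1 * a2))"
        by (rule arg_cong2[where f = "(/)"]) (simp_all add: algebra_simps)
      then show ?thesis using l0 by simp
    qed
    ultimately show ?thesis by (simp add: e_def)
  qed
  show ?thesis
    unfolding F_fun_eq[OF a m] F_fun_eq[OF a' m'] G bl el L b_def[symmetric] e_def[symmetric]
    by (simp add: d_def exp_add[symmetric] algebra_simps)
qed

section \<open>The difference relation\<close>

definition stirling_quot :: "nat \<Rightarrow> real" where
  "stirling_quot n = fact n / exp ((real n + 1 / 2) * ln (real n) - real n)"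

text \<open>The duplication formula for \<open>fact (2 * m)\<close> reduces the quotient to Gauss's
  product at 1/2, as in Wallis's formula.\<close>

lemma stirling_quot_double:
  assumes m: "m > 0"
  shows "stirling_quot (2 * m) / (stirling_quot m)\<^sup>2 =
    rGamma_series (1 / 2) m * (real m / (real m + 1 / 2)) / sqrt 2"
proof -
  define l where "l = ln (real m)"
  have l2: "ln (real (2 * m)) = ln 2 + l" using m by (simp add: l_def ln_mult)
  have el: "exp (l / 2) * exp (l / 2) = real m" using m by (simp add: l_def exp_add[symmetric])
  have "exp ((2 * real m) * ln 2) = (2 :: real) ^ (2 * m)"
    by (metis exp_of_nat_mult exp_ln zero_less_numeral of_nat_mult of_nat_numeral)
  moreover have "exp (ln 2 / 2) = sqrt (2 :: real)"
    by (simp add: ln_sqrt[symmetric])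
  ultimately have e2: "exp ((2 * real m + 1 / 2) * ln 2) = 2 ^ (2 * m) * sqrt 2"
    by (simp add: distrib_right exp_add)
  have "exp ((real (2 * m) + 1 / 2) * ln (real (2 * m)) - real (2 * m)) =
     exp ((2 * real m + 1 / 2) * ln 2) * exp ((2 * real m + 1 / 2) * l - 2 * real m)"
    unfolding l2 by (simp add: exp_add[symmetric] algebra_simps)
  also have "exp ((2 * real m + 1 / 2) * l - 2 * real m) =
      (exp ((real m + 1 / 2) * l - real m))\<^sup>2 / exp (l / 2)"
    by (simp add: power2_eq_square exp_add[symmetric] exp_diff[symmetric] algebra_simps)
  finally have "stirling_quot (2 * m) / (stirling_quot m)\<^sup>2 =
      fact (2 * m) * exp (l / 2) / (2 ^ (2 * m) * sqrt 2 * (fact m)\<^sup>2)"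
    unfolding stirling_quot_def e2 l_def[symmetric] by (simp add: power_divide)
  also have "fact (2 * m) = (2 ^ (2 * m) * pochhammer (1 / 2) m * fact m :: real)" by (rule fact_double)
  also have "2 ^ (2 * m) * pochhammer (1 / 2) m * fact m * exp (l / 2) / (2 ^ (2 * m) * sqrt 2 * (fact m)\<^sup>2)
      = pochhammer (1 / 2) m * exp (l / 2) / fact m / sqrt 2"
    by (simp add: power2_eq_square)
  also have "pochhammer (1 / 2) m * exp (l / 2) / fact m = rGamma_series (1 / 2) m * (real m / (real m + 1 / 2))"
  proof -
    have m2: "real m + 1 / 2 \<noteq> 0" using m by (simp add: add_pos_pos less_imp_neq[THEN not_sym])
    have "rGamma_series (1 / 2) m = pochhammer (1 / 2) m * (real m + 1 / 2) / (fact m * exp (l / 2))"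
      unfolding rGamma_series_def pochhammer_Suc Suc_eq_plus1[symmetric] by (simp add: l_def add.commute)
    then have "rGamma_series (1 / 2) m * (real m / (real m + 1 / 2)) = pochhammer (1 / 2) m * real m / (fact m * exp (l / 2))"
      using m2 by simp
    also have "\<dots> = pochhammer (1 / 2) m * exp (l / 2) / fact m"
      unfolding el[symmetric] by simp
    finally show ?thesis ..
  qed
  finally show ?thesis .
qed

text \<open>Given a nonzero limit \<sigma>, the quotient tends to \<open>1 / \<sigma>\<close> and
  also to \<open>1 / (\<Gamma>(1/2) * sqrt 2)\<close>.\<close>

lemma stirling_constant:
  assumes S: "(\<lambda>n. complex_of_real (stirling_quot n)) \<longlonglongrightarrow> \<sigma>" and \<sigma>: "\<sigma> \<noteq> 0"
  shows "\<sigma> = of_real (sqrt (2 * pi))"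
proof -
  have S2: "(\<lambda>m. complex_of_real (stirling_quot (2 * m))) \<longlonglongrightarrow> \<sigma>"
    using LIMSEQ_subseq_LIMSEQ[OF S, of "\<lambda>m. 2 * m"] by (simp add: strict_mono_def o_def)
  have "(\<lambda>m. of_real (stirling_quot (2 * m)) / (of_real (stirling_quot m))\<^sup>2) \<longlonglongrightarrow> \<sigma> / \<sigma>\<^sup>2"
    by (intro tendsto_intros S S2) (use \<sigma> in simp)
  moreover have "(\<lambda>m. complex_of_real (stirling_quot (2 * m)) / (of_real (stirling_quot m))\<^sup>2) \<longlonglongrightarrow> of_real (1 / sqrt (2 * pi))"
  proof (rule Lim_transform_eventually)
    have "(\<lambda>m. real m / (real m + 1 / 2)) \<longlonglongrightarrow> 1" by real_asymp
    from tendsto_divide[OF tendsto_mult[OF rGamma_series_LIMSEQ[of "1 / 2 :: real"] this] tendsto_const, of "sqrt 2"]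
    have "(\<lambda>m. rGamma_series (1 / 2) m * (real m / (real m + 1 / 2)) / sqrt 2) \<longlonglongrightarrow> 1 / sqrt (2 * pi)"
      by (simp add: rGamma_inverse_Gamma Gamma_one_half_real real_sqrt_mult field_simps)
    then show "(\<lambda>m. complex_of_real (rGamma_series (1 / 2) m * (real m / (real m + 1 / 2)) / sqrt 2)) \<longlonglongrightarrow> of_real (1 / sqrt (2 * pi))"
      by (rule tendsto_of_real)
    show "\<forall>\<^sub>F m in sequentially. complex_of_real (rGamma_series (1 / 2) m * (real m / (real m + 1 / 2)) / sqrt 2) =
        of_real (stirling_quot (2 * m)) / (of_real (stirling_quot m))\<^sup>2"
      using eventually_gt_at_top[of 0]
    proof eventually_elim
      case (elim m)
      show ?case unfolding stirling_quot_double[OF elim, symmetric] by simp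
    qed
  qed
  ultimately have "\<sigma> / \<sigma>\<^sup>2 = of_real (1 / sqrt (2 * pi))" by (rule LIMSEQ_unique)
  then have "inverse \<sigma> = inverse (of_real (sqrt (2 * pi)))"
    using \<sigma> by (simp add: power2_eq_square field_simps)
  then show ?thesis by simp
qed

text \<open>The existence of the limit is assumed; the telescoped series supplies it later. It
  forces the Stirling quotients to converge, so only their constant has to be computed.\<close>

lemma pochhammer_limit:
  fixes z \<rho> :: complex
  assumes z: "z \<notin> \<int>\<^sub>\<le>\<^sub>0" and \<rho>: "\<rho> \<noteq> 0"
    and lim: "(\<lambda>n. pochhammer z (n + 1) * exp (of_real (n + 2) - of_real ((n + 2) * ln (n + 2))
       - (z - 3 / 2) * of_real (ln (n + 2)))) \<longlonglongrightarrow> \<rho>"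
  shows "\<rho> = of_real (sqrt (2 * pi)) / Gamma z"
proof -
  define q where "q = (\<lambda>n. pochhammer z (n + 1) * exp (of_real (n + 2) - of_real ((n + 2) * ln (n + 2))
       - (z - 3 / 2) * of_real (ln (n + 2))))"
  \<comment> \<open>The mismatch between \<open>n\<close> in Gauss's product and
    \<open>n + 2\<close> in the hypothesis; it tends to 0 because
    \<open>n * ln (n / (n + 2))\<close> tends to -2.\<close>
  define e where "e = (\<lambda>n. of_real (2 + (real n + 1 / 2) * (ln n - ln (n + 2))) + z * of_real (ln n - ln (n + 2)))"
  have "(\<lambda>n. (2 + (real n + 1 / 2) * (ln n - ln (real n + 2)))) \<longlonglongrightarrow> 0" by real_asymp
  moreover have "(\<lambda>n. ln n - ln (real n + 2)) \<longlonglongrightarrow> 0" by real_asymp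
  ultimately have "e \<longlonglongrightarrow> of_real 0 + z * of_real 0"
    unfolding e_def by (intro tendsto_intros) (simp_all add: add.commute)
  then have e: "(\<lambda>n. exp (e n)) \<longlonglongrightarrow> 1" using tendsto_exp by fastforce
  have rG: "rGamma z \<noteq> 0" using z by (simp add: rGamma_eq_zero_iff)
  have qe: "q n = rGamma_series z n * of_real (stirling_quot n) * exp (e n)" if "n > 0" for n
  proof -
    define l where "l = complex_of_real (ln n)"
    have s: "complex_of_real (stirling_quot n) = fact n / exp ((of_nat n + 1 / 2) * l - of_nat n)"
      by (simp add: stirling_quot_def l_def exp_of_real[symmetric])
    have "rGamma_series z n * of_real (stirling_quot n) * exp (e n) =
       pochhammer z (n + 1) * (exp (e n) / (exp (z * l) * exp ((of_nat n + 1 / 2) * l - of_nat n)))"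
      unfolding rGamma_series_def s by (simp add: l_def)
    also have "exp (e n) / (exp (z * l) * exp ((of_nat n + 1 / 2) * l - of_nat n)) =
      exp (e n - (z * l + ((of_nat n + 1 / 2) * l - of_nat n)))"
      by (simp add: exp_add exp_diff)
    also have "e n - (z * l + ((of_nat n + 1 / 2) * l - of_nat n)) =
      of_real (n + 2) - of_real ((n + 2) * ln (n + 2)) - (z - 3 / 2) * of_real (ln (n + 2))"
      unfolding e_def of_real_mult of_real_add of_real_diff l_def[symmetric]
      by (simp add: algebra_simps)
    finally show ?thesis by (simp add: q_def add.commute)
  qed
  have q: "q \<longlonglongrightarrow> \<rho>" using lim unfolding q_def of_nat_add of_nat_numeral .
  have "(\<lambda>n. q n / (rGamma_series z n * exp (e n))) \<longlonglongrightarrow> \<rho> / (rGamma z * 1)"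
    by (intro tendsto_intros e rGamma_series_LIMSEQ q) (use rG in simp)
  moreover have "\<forall>\<^sub>F n in sequentially. rGamma_series z n \<noteq> 0"
    using tendsto_imp_eventually_ne[OF rGamma_series_LIMSEQ rG] .
  then have "\<forall>\<^sub>F n in sequentially. q n / (rGamma_series z n * exp (e n)) = of_real (stirling_quot n)"
    using eventually_gt_at_top[of 0] by eventually_elim (simp add: qe)
  ultimately have "(\<lambda>n. complex_of_real (stirling_quot n)) \<longlonglongrightarrow> \<rho> / rGamma z"
    using Lim_transform_eventually by fastforce
  from stirling_constant[OF this] have "\<rho> / rGamma z = of_real (sqrt (2 * pi))" using \<rho> rG by simp
  then have "\<rho> = of_real (sqrt (2 * pi)) * rGamma z" using rG by (simp add: field_simps)
  then show ?thesis by (simp add: rGamma_inverse_Gamma divide_inverse)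
qed

lemma log_rem_summable_on:
  assumes re: "Re w > 0" "Re a1 > 0" "Re a2 > 0"
  shows "(\<lambda>n. log_rem 3 \<eta> a1 a2 (lat_pt w a1 a2 n)) summable_on UNIV"
proof -
  define c where "c = min 1 (min (Re w) (min (Re a1) (Re a2)))"
  define A where "A = 1 + norm \<eta> + norm a1 + norm a2"
  have c: "c > 0" "c \<le> 1" "c \<le> Re w" "c \<le> Re a1" "c \<le> Re a2" using re by (auto simp: c_def)
  have A: "A \<ge> 1" "norm \<eta> \<le> A" "norm a1 \<le> A" "norm a2 \<le> A" by (auto simp: A_def)
  show ?thesis
    by (rule abs_summable_summable, rule lat_wt_dominated_abs_summable[OF c(1) _ log_rem_lat_pt_bound[OF c A]]) auto
qed

text \<open>\<open>G\<close> solves \<open>G (y + a) - G y = - Ln (y + \<eta>)\<close> up to a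
  vanishing error: its main part has derivative \<open>- Ln y / a\<close>, and the corrections are
  logarithms of quantities tending to 1.\<close>

lemma one_dim_remainder_tendsto_0:
  fixes y :: "nat \<Rightarrow> complex"
  assumes y: "filterlim (\<lambda>j. norm (y j)) at_top sequentially" and re: "\<And>j. Re (y j) > 0"
    and a: "a \<noteq> 0" "Re a > 0"
    and G: "G = (\<lambda>y. y * (1 - Ln y) / a - \<kappa> * Ln y)"
  shows "(\<lambda>j. Ln (y j + \<eta>) + G (y j + a) - G (y j)) \<longlonglongrightarrow> 0"
proof -
  have yi: "filterlim y at_infinity sequentially" using y by (simp add: filterlim_at_infinity_conv_norm_at_top)
  have lim0: "(\<lambda>j. b / y j) \<longlonglongrightarrow> 0" for b by (rule tendsto_divide_0[OF tendsto_const yi])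
  have Lb: "(\<lambda>j. Ln (1 + b / y j)) \<longlonglongrightarrow> 0" for b
    using tendsto_Ln[OF tendsto_add[OF tendsto_const lim0[of b]], of 1] by simp
  have y0: "y j \<noteq> 0" for j using re[of j] by auto
  have "filterlim (\<lambda>j. a / y j) (at 0) sequentially"
    using lim0[of a] a y0 by (auto simp: filterlim_at)
  moreover have "((\<lambda>h. (Ln (1 + h) - Ln 1) / h) \<longlongrightarrow> 1) (at 0)"
    using has_field_derivative_Ln[of 1] unfolding DERIV_def by simp
  ultimately have Q: "(\<lambda>j. (Ln (1 + a / y j) - Ln 1) / (a / y j)) \<longlonglongrightarrow> 1"
    by (rule filterlim_compose[rotated])
  have "(\<lambda>j. Ln (1 + \<eta> / y j) - Ln (1 + a / y j) + (1 - (Ln (1 + a / y j) - Ln 1) / (a / y j)) - \<kappa> * Ln (1 + a / y j))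
      \<longlonglongrightarrow> 0 - 0 + (1 - 1) - \<kappa> * 0"
    by (intro tendsto_intros Lb Q)
  then have L: "(\<lambda>j. Ln (1 + \<eta> / y j) - Ln (1 + a / y j) + (1 - (Ln (1 + a / y j) - Ln 1) / (a / y j)) - \<kappa> * Ln (1 + a / y j))
      \<longlonglongrightarrow> 0" by simp
  have small: "\<forall>\<^sub>F j in sequentially. norm (b / y j) < 1" for b
    using order_tendstoD(2)[OF tendsto_norm_zero[OF lim0[of b]], of 1] by simp
  show ?thesis
  proof (rule Lim_transform_eventually[OF L])
    show "\<forall>\<^sub>F j in sequentially. Ln (1 + \<eta> / y j) - Ln (1 + a / y j) + (1 - (Ln (1 + a / y j) - Ln 1) / (a / y j)) - \<kappa> * Ln (1 + a / y j) =
        Ln (y j + \<eta>) + G (y j + a) - G (y j)"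
      using small[of a] small[of \<eta>]
    proof eventually_elim
      case (elim j)
      have e: "Ln (y j + \<eta>) = Ln (y j) + Ln (1 + \<eta> / y j)" "Ln (y j + a) = Ln (y j) + Ln (1 + a / y j)"
        by (rule Ln_add_rhp[OF re]; use elim in simp)+
      show ?case unfolding G e using a y0[of j] by (simp add: field_simps)
    qed
  qed
qed

text \<open>
  With the base point \<open>w = a1\<close> the telescoped product runs over the multiples of \<open>a1\<close>, and the
  logarithms that remain are those of positive integers.
\<close>

lemma Gamma2_rhp_shift:
  assumes re: "Re a1 > 0" "Re a2 > 0" and x: "x \<notin> cone_lattice a1 a2"
  shows "Gamma2_rhp (x + a2) a1 a2 = Gamma2_rhp x a1 a2 / Gamma1 x a1"
proof -
  have nz: "a1 \<noteq> 0" "a2 \<noteq> 0" using re by auto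
  define \<eta> where "\<eta> = x - a1"
  define \<eta>' where "\<eta>' = \<eta> + a2"
  \<comment> \<open>This is \<open>mult_bernoulli 1 \<eta> [a1]\<close>, the increment of
    \<open>todd_coeff2\<close> when \<eta> grows by \<open>a2\<close>. Correspondingly
    \<open>G\<close> is the increment of \<open>log_todd3\<close>.\<close>
  define \<kappa> where "\<kappa> = \<eta> / a1 - 1 / 2"
  define G where "G = (\<lambda>y. y * (1 - Ln y) / a1 - \<kappa> * Ln y)"
  define V where "V = (\<lambda>y. Ln (y + \<eta>) + G (y + a1) - G y)"
  have x': "a1 + \<eta> = x" "a1 + \<eta>' = x + a2" by (simp_all add: \<eta>_def \<eta>'_def)
  have xs: "x + a2 \<notin> cone_lattice a1 a2"
  proof
    assume "x + a2 \<in> cone_lattice a1 a2"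
    then obtain n1 n2 where n: "x + a2 = of_int n1 * a1 + of_int n2 * a2" "n1 \<le> 0" "n2 \<le> 0"
      by (auto simp: cone_lattice_def)
    then have "x = of_int n1 * a1 + of_int (n2 - 1) * a2" by (simp add: algebra_simps)
    with n have "x \<in> cone_lattice a1 a2" unfolding cone_lattice_def
      by (intro CollectI exI[of _ n1] exI[of _ "n2 - 1"]) auto
    then show False using x by blast
  qed
  have b1: "todd_coeff1 \<eta>' a1 a2 = todd_coeff1 \<eta> a1 a2 + 1 / a1"
    using nz by (simp add: todd_coeff1_def \<eta>'_def field_simps)
  have b2: "todd_coeff2 \<eta>' a1 a2 = todd_coeff2 \<eta> a1 a2 + \<kappa>"
    using nz unfolding todd_coeff2_def \<eta>'_def \<kappa>_def by (simp add: divide_simps) (simp add: algebra_simps power2_eq_square)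
  have g: "log_todd3 \<eta>' a1 a2 y = log_todd3 \<eta> a1 a2 y + G y" for y
    unfolding log_todd3_def b1 b2 G_def by (simp add: algebra_simps diff_divide_distrib)
  have TV: "log_rem 3 \<eta>' a1 a2 y - log_rem 3 \<eta> a1 a2 y = V y - V (y + a2)" for y
    unfolding log_rem_3[OF nz] V_def cross_diff_def g by (simp add: \<eta>'_def algebra_simps)
  have s: "(\<lambda>n. log_rem 3 \<eta> a1 a2 (lat_pt a1 a1 a2 n)) summable_on UNIV" "(\<lambda>n. log_rem 3 \<eta>' a1 a2 (lat_pt a1 a1 a2 n)) summable_on UNIV"
    by (rule log_rem_summable_on[OF re(1) re])+
  define S where "S = (\<Sum>\<^sub>\<infinity>n. V (lat_pt a1 a1 a2 n) - V (lat_pt a1 a1 a2 n + a2))"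
  have S: "S = (\<Sum>m. log_rem 3 \<eta>' a1 a2 (lat_pt a1 a1 a2 (prod_decode m))) - (\<Sum>m. log_rem 3 \<eta> a1 a2 (lat_pt a1 a1 a2 (prod_decode m)))"
    unfolding S_def TV[symmetric] infsum_diff[OF s(2,1)]
    using sums_prod_decode[OF s(1)] sums_prod_decode[OF s(2)] by (simp add: sums_iff)
  have "(\<lambda>i. V (a1 + of_nat i * a1)) sums S"
    unfolding S_def
  proof (rule D2_telescope)
    show "(\<lambda>n. V (lat_pt a1 a1 a2 n) - V (lat_pt a1 a1 a2 n + a2)) summable_on UNIV"
      unfolding TV[symmetric] by (rule summable_on_diff[OF s(2,1)])
    show "(\<lambda>j. V (lat_pt a1 a1 a2 (i, j))) \<longlonglongrightarrow> 0" for i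
      unfolding V_def
      by (rule one_dim_remainder_tendsto_0[OF filterlim_norm_lat_pt(1) _ nz(1) re(1) G_def])
         (use re in \<open>auto intro!: lat_pt_neq_0\<close>)
  qed
  then have lim: "(\<lambda>N. exp (\<Sum>i<N. V (a1 + of_nat i * a1))) \<longlonglongrightarrow> exp S"
    unfolding sums_def by (rule tendsto_exp)
  define z where "z = x / a1"
  have zx: "x = z * a1" using nz by (simp add: z_def)
  have xi: "x + of_nat i * a1 \<noteq> 0" for i
  proof
    assume "x + of_nat i * a1 = 0"
    then have "x = of_int (- int i) * a1 + of_int 0 * a2" by (simp add: add_eq_0_iff2)
    then have "x \<in> cone_lattice a1 a2" unfolding cone_lattice_def
      by (intro CollectI exI[of _ "- int i"] exI[of _ 0]) auto
    then show False using x by blast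
  qed
  have z: "z \<notin> \<int>\<^sub>\<le>\<^sub>0"
  proof
    assume "z \<in> \<int>\<^sub>\<le>\<^sub>0"
    then obtain i where "z = - of_nat i" by (elim nonpos_Ints_cases')
    then show False using xi[of i] by (simp add: zx)
  qed
  have P: "exp (\<Sum>i<N. V (a1 + of_nat i * a1)) =
      a1 ^ N * pochhammer z N * exp (G (of_nat (N + 1) * a1) - G a1)" for N
  proof -
    have "V (a1 + of_nat i * a1) = Ln (x + of_nat i * a1) + (G (of_nat (Suc i + 1) * a1) - G (of_nat (i + 1) * a1))" for i
      by (simp add: V_def \<eta>_def algebra_simps)
    then have "(\<Sum>i<N. V (a1 + of_nat i * a1)) = (\<Sum>i<N. Ln (x + of_nat i * a1)) + (G (of_nat (N + 1) * a1) - G a1)"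
      using sum_lessThan_telescope[of "\<lambda>i. G (of_nat (i + 1) * a1)" N] by (simp add: sum.distrib)
    moreover have "exp (\<Sum>i<N. Ln (x + of_nat i * a1)) = (\<Prod>i<N. x + of_nat i * a1)"
      by (simp add: exp_sum xi)
    moreover have "(\<Prod>i<N. x + of_nat i * a1) = (\<Prod>i<N. a1 * (z + of_nat i))"
      by (intro prod.cong) (simp_all add: zx algebra_simps)
    moreover have "\<dots> = a1 ^ N * pochhammer z N"
      by (simp add: prod.distrib pochhammer_prod atLeast0LessThan)
    ultimately show ?thesis by (simp add: exp_add)
  qed
  define L where "L = Ln a1"
  \<comment> \<open>Collects the powers of \<open>a1\<close> left in the telescoped product;
    dividing by it leaves a sequence in \<open>z\<close> and integers only.\<close>
  define E where "E = exp ((1 / 2 - z) * L)"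
  have Q: "exp (\<Sum>i<n + 1. V (a1 + of_nat i * a1)) * exp (G a1) / E =
     pochhammer z (n + 1) * exp (of_real (n + 2) - of_real ((n + 2) * ln (n + 2))
       - (z - 3 / 2) * of_real (ln (n + 2)))" for n
  proof -
    define M where "M = complex_of_real (real n + 2)"
    define l where "l = complex_of_real (ln (n + 2))"
    have "Ln (of_real (real (n + 2)) * a1) = of_real (ln (real (n + 2))) + L"
      unfolding L_def by (subst Ln_times_of_real) (use nz Ln_of_real[of "real (n + 2)"] in auto)
    then have LM: "Ln (M * a1) = l + L" by (simp add: M_def l_def add.commute)
    have aM: "of_nat (n + 1 + 1) * a1 = M * a1" by (simp add: M_def)
    have \<kappa>: "\<kappa> = z - 3 / 2" using nz by (simp add: \<kappa>_def z_def \<eta>_def field_simps)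
    have GM: "G (M * a1) = M * (1 - (l + L)) - (z - 3 / 2) * (l + L)"
      unfolding G_def LM \<kappa> using nz by simp
    have an: "a1 ^ (n + 1) = exp ((M - 1) * L)"
    proof -
      have "M - 1 = of_nat (n + 1)" by (simp add: M_def)
      moreover have "exp L = a1" using nz by (simp add: L_def)
      ultimately show ?thesis by (simp only: exp_of_nat_mult)
    qed
    have "exp (\<Sum>i<n + 1. V (a1 + of_nat i * a1)) * exp (G a1) / E =
        pochhammer z (n + 1) * (exp ((M - 1) * L) * exp (G (M * a1) - G a1) * exp (G a1) / E)"
      unfolding P aM an by simp
    also have "exp ((M - 1) * L) * exp (G (M * a1) - G a1) * exp (G a1) / E =
       exp ((M - 1) * L + G (M * a1) - (1 / 2 - z) * L)"
      unfolding E_def by (simp add: exp_add exp_diff)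
    also have "(M - 1) * L + G (M * a1) - (1 / 2 - z) * L = M - M * l - (z - 3 / 2) * l"
      unfolding GM by (simp add: algebra_simps)
    finally show ?thesis by (simp add: M_def l_def add.commute)
  qed
  have "(\<lambda>n. exp (\<Sum>i<n + 1. V (a1 + of_nat i * a1)) * exp (G a1) / E) \<longlonglongrightarrow> exp S * exp (G a1) / E"
    by (intro tendsto_intros LIMSEQ_ignore_initial_segment[OF lim]) (simp add: E_def)
  then have \<rho>: "exp S * exp (G a1) / E = of_real (sqrt (2 * pi)) / Gamma z"
    unfolding Q by (intro pochhammer_limit[OF z]) (simp_all add: E_def add.commute)
  have "Gamma2_rhp (x + a2) a1 a2 = Gamma2_rhp x a1 a2 * exp (S + G a1)"
    using Gamma2_rhp_eq(1)[OF re(1,1,2) order_refl, of \<eta>] Gamma2_rhp_eq(1)[OF re(1,1,2) order_refl, of \<eta>'] x xs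
    unfolding x' log_todd_3[OF nz] g S by (simp add: exp_add[symmetric] algebra_simps)
  also have "exp (S + G a1) = E * (of_real (sqrt (2 * pi)) / Gamma z)"
    using \<rho> by (simp add: exp_add E_def field_simps)
  also have "\<dots> = inverse (Gamma1 x a1)"
  proof -
    have "inverse E = a1 powr (x / a1 - 1 / 2)"
      using nz by (simp add: E_def powr_def z_def L_def exp_minus[symmetric] algebra_simps)
    then have "E = inverse (a1 powr (x / a1 - 1 / 2))" by (metis inverse_inverse_eq)
    then show ?thesis by (simp add: Gamma1_def z_def field_simps)
  qed
  finally show ?thesis by (simp add: divide_inverse)
qed

lemma mult_bernoulli_1:
  assumes a: "a \<noteq> 0" shows "mult_bernoulli 1 x [a] = x / a - 1 / 2"
proof -
  define D where "D = fps_exp a - 1"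
  define N where "N = fps_X * fps_exp x"
  have D0: "D \<noteq> 0" "subdegree D = 1" using subdegree_fps_exp_minus_1[OF a] by (simp_all add: D_def)
  have "D dvd N" using fps_dvd_iff[of D N] D0 by (auto simp: N_def subdegree_mult)
  then have e: "N div D * D = N" by simp
  define q where "q = fps_nth (N div D)"
  have b: "mult_bernoulli 1 x [a] = q 1" by (simp add: mult_bernoulli_def q_def N_def D_def)
  have Dn: "fps_nth D 0 = 0" "fps_nth D (Suc 0) = a" "fps_nth D (Suc (Suc 0)) = a\<^sup>2 / 2"
    by (simp_all add: D_def power2_eq_square)
  have "fps_nth (N div D * D) 1 = q 0 * a" by (simp add: fps_mult_nth_1 Dn q_def)
  moreover have "fps_nth N 1 = 1" by (simp add: N_def)
  ultimately have q0: "q 0 * a = 1" using e by simp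
  have "fps_nth (N div D * D) 2 = q 0 * (a\<^sup>2 / 2) + q 1 * a"
    by (simp add: fps_mult_nth q_def numeral_2_eq_2 Dn power2_eq_square)
  moreover have "fps_nth N 2 = x" by (simp add: N_def)
  ultimately have "q 0 * (a\<^sup>2 / 2) + q 1 * a = x" using e by simp
  moreover have "q 0 * (a\<^sup>2 / 2) = (q 0 * a) * a / 2" by (simp add: power2_eq_square)
  ultimately have "a / 2 + q 1 * a = x" using q0 by simp
  then show ?thesis unfolding b using a by (simp add: field_simps)
qed

text \<open>Three changes combine: \<open>Gamma2_rhp\<close> is divided by \<open>Gamma1\<close>,
  the Bernoulli exponent grows by \<open>k\<close>, and the last exponent drops by
  \<open>w / a1\<close>. Undoing the rotation in \<open>Gamma1\<close> yields
  \<open>exp (k * Ln l)\<close>, which cancels the contribution of \<open>Ln l\<close>.\<close>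

lemma F_fun_shift:
  assumes a: "admissible_params a1 a2" and x: "w + \<eta> \<notin> cone_lattice a1 a2"
  shows "F_fun w (\<eta> + a2) a1 a2 / F_fun w \<eta> a1 a2 = inverse (Lambda_fun w \<eta> a1)"
proof -
  obtain l where l: "rotates_to_rhp l a1 a2" using rotates_to_rhp_exists[OF a] ..
  note ll = l[unfolded rotates_to_rhp_def]
  have nz: "a1 \<noteq> 0" "a2 \<noteq> 0" "l \<noteq> 0" using a ll slit_nonzero by (auto simp: admissible_params_def)
  define x where "x = w + \<eta>"
  define k where "k = x / a1 - 1 / 2"
  define e where "e = (\<lambda>\<eta>. - (3 * w\<^sup>2 / (4 * a1 * a2)) - \<eta> * w / (a1 * a2) + w * (a1 + a2) / (2 * a1 * a2))"
  have e_app: "- (3 * w\<^sup>2 / (4 * a1 * a2)) - \<eta> * w / (a1 * a2) + w * (a1 + a2) / (2 * a1 * a2) = e \<eta>" for \<eta>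
    by (simp add: e_def)
  have b: "todd_coeff2 (x + a2) a1 a2 = todd_coeff2 x a1 a2 + k"
    using nz unfolding todd_coeff2_def k_def by (simp add: divide_simps) (simp add: algebra_simps power2_eq_square)
  have ee: "e (\<eta> + a2) = e \<eta> - w / a1" using nz by (simp add: e_def field_simps)
  have lx: "l * x \<notin> cone_lattice (l * a1) (l * a2)"
    using assms(2) by (simp add: cone_lattice_scale nz x_def)
  have G0: "Gamma2_rhp (l * x) (l * a1) (l * a2) \<noteq> 0" using lx by (simp add: Gamma2_rhp_def)
  have GG: "Gamma2_rhp (l * (x + a2)) (l * a1) (l * a2) = Gamma2_rhp (l * x) (l * a1) (l * a2) / Gamma1 (l * x) (l * a1)"
    using Gamma2_rhp_shift[OF _ _ lx] ll by (simp add: distrib_left)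
  have G1: "Gamma1 (l * x) (l * a1) = Gamma1 x a1 * exp (k * Ln l)"
    using ll nz by (simp add: Gamma1_def powr_def k_def exp_add[symmetric] algebra_simps add_divide_distrib)
  have w: "w + (\<eta> + a2) = x + a2" by (simp add: x_def)
  have "F_fun w (\<eta> + a2) a1 a2 / F_fun w \<eta> a1 a2 =
      inverse (Gamma1 (l * x) (l * a1)) * exp (k * (Ln l + Ln w) - w / a1)"
    unfolding F_fun_eq[OF a l] w x_def[symmetric] GG b e_app ee
    using G0 by (simp add: distrib_right exp_add exp_diff field_simps)
  also have "\<dots> = inverse (Gamma1 x a1 * exp (- k * Ln w) * exp (w / a1))"
    unfolding G1 by (simp add: distrib_left exp_add exp_diff exp_minus field_simps)
  also have "\<dots> = inverse (Lambda_fun w \<eta> a1)"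
    unfolding Lambda_fun_def mult_bernoulli_1[OF nz(1)] x_def[symmetric] k_def ..
  finally show ?thesis .
qed

section \<open>The asymptotic expansion\<close>

lemma closed_sector_Re_ge:
  assumes ab: "- (pi / 2) < \<alpha>" "\<beta> < pi / 2" and w: "w \<in> closed_sector \<alpha> \<beta>"
  shows "min (cos \<alpha>) (cos \<beta>) * norm w \<le> Re w"
proof -
  have A: "\<alpha> \<le> Arg w" "Arg w \<le> \<beta>" "w \<noteq> 0" using w by (auto simp: closed_sector_def)
  have "Re w = norm w * cos (Arg w)"
    using arg_cong[OF Arg_eq[OF A(3)], of Re] by (simp add: Re_exp)
  moreover have "min (cos \<alpha>) (cos \<beta>) \<le> cos (Arg w)"
  proof (cases "Arg w \<ge> 0")
    case True
    have "cos \<beta> \<le> cos (Arg w)" using True A ab pi_gt_zero by (intro cos_monotone_0_pi_le) auto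
    then show ?thesis by simp
  next
    case False
    have "cos (- \<alpha>) \<le> cos (- Arg w)" using False A ab pi_gt_zero by (intro cos_monotone_0_pi_le) auto
    then show ?thesis by simp
  qed
  ultimately show ?thesis by (simp add: mult.commute mult_left_mono)
qed

text \<open>The exponential factors of \<open>F_fun\<close> are the reciprocal of
  \<open>exp (log_todd3 \<eta> a1 a2 w)\<close>: the polynomial terms match directly, and the
  coefficient of \<open>Ln w\<close> does so by the shift formula.\<close>

lemma F_fun_rhp:
  assumes re: "Re w > 0" "Re a1 > 0" "Re a2 > 0" and nl: "w + \<eta> \<notin> cone_lattice a1 a2"
  shows "F_fun w \<eta> a1 a2 = exp (\<Sum>m. log_rem 3 \<eta> a1 a2 (lat_pt w a1 a2 (prod_decode m)))"
proof -
  have nz: "a1 \<noteq> 0" "a2 \<noteq> 0" using re by auto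
  define S where "S = (\<Sum>m. log_rem 3 \<eta> a1 a2 (lat_pt w a1 a2 (prod_decode m)))"
  have G: "Gamma2 (w + \<eta>) a1 a2 = exp (log_todd3 \<eta> a1 a2 w + S)"
    using Gamma2_rhp_eq(1)[OF re order_refl nl] re by (simp add: Gamma2_def S_def log_todd_3[OF nz])
  have b1: "todd_coeff1 \<eta> a1 a2 * w = \<eta> * w / (a1 * a2) - w * (a1 + a2) / (2 * a1 * a2)"
    by (simp add: todd_coeff1_def diff_divide_distrib add_divide_distrib algebra_simps)
  have "log_todd3 \<eta> a1 a2 w = 3 * w\<^sup>2 / (4 * a1 * a2) + todd_coeff1 \<eta> a1 a2 * w
      - Ln w * (w ^ 2 / (2 * (a1 * a2)) + todd_coeff1 \<eta> a1 a2 * w + todd_coeff2 \<eta> a1 a2)"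
    by (simp add: log_todd3_def algebra_simps diff_divide_distrib)
  then have "log_todd3 \<eta> a1 a2 w = 3 * w\<^sup>2 / (4 * a1 * a2) + (\<eta> * w / (a1 * a2) - w * (a1 + a2) / (2 * a1 * a2))
      - Ln w * todd_coeff2 (w + \<eta>) a1 a2"
    unfolding todd_coeff2_shift[OF nz] unfolding b1 .
  then show ?thesis
    unfolding F_fun_def G mult_bernoulli_2[OF nz] S_def[symmetric]
    by (simp add: exp_add[symmetric] algebra_simps)
qed

definition log_F_coeff :: "complex \<Rightarrow> complex \<Rightarrow> complex \<Rightarrow> nat \<Rightarrow> complex" where
  "log_F_coeff \<eta> a1 a2 k = (- 1) ^ k * mult_bernoulli (k + 2) \<eta> [a1, a2] / of_nat (k * (k + 1) * (k + 2))"

lemma todd_coeff_log_term_log_F_coeff: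
  assumes k: "k \<ge> 1" shows "todd_coeff (k + 2) \<eta> a1 a2 * log_term (k + 2) w = log_F_coeff \<eta> a1 a2 k / w ^ k"
proof -
  obtain j where j: "k = Suc j" using k by (cases k) auto
  have "fact (k + 2) = (of_nat (k * (k + 1) * (k + 2)) * fact j :: complex)"
    by (simp add: j algebra_simps)
  moreover have "k + 2 - 3 = j" by (simp add: j)
  ultimately show ?thesis using k by (simp add: todd_coeff_def log_term_def log_F_coeff_def)
qed

lemma log_todd_expansion:
  assumes "a1 \<noteq> 0" "a2 \<noteq> 0"
  shows "log_todd (N + 4) \<eta> a1 a2 w = log_todd3 \<eta> a1 a2 w + (\<Sum>k=1..Suc N. log_F_coeff \<eta> a1 a2 k / w ^ k)"
proof (induction N)
  case 0
  have "log_todd 4 \<eta> a1 a2 w = log_todd 3 \<eta> a1 a2 w + todd_coeff (1 + 2) \<eta> a1 a2 * log_term (1 + 2) w"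
    by (simp add: log_todd_def eval_nat_numeral)
  then show ?case unfolding todd_coeff_log_term_log_F_coeff[OF order_refl] log_todd_3[OF assms] by simp
next
  case (Suc N)
  have "log_todd (Suc N + 4) \<eta> a1 a2 w = log_todd (N + 4) \<eta> a1 a2 w + todd_coeff (Suc (Suc N) + 2) \<eta> a1 a2 * log_term (Suc (Suc N) + 2) w"
  proof -
    have "Suc N + 4 = Suc (N + 4)" "Suc (Suc N) + 2 = N + 4" by simp_all
    then show ?thesis unfolding log_todd_def by (simp only: sum.lessThan_Suc)
  qed
  also have "todd_coeff (Suc (Suc N) + 2) \<eta> a1 a2 * log_term (Suc (Suc N) + 2) w = log_F_coeff \<eta> a1 a2 (Suc (Suc N)) / w ^ Suc (Suc N)"
    by (rule todd_coeff_log_term_log_F_coeff) simp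
  finally show ?case unfolding Suc.IH by (simp add: add.assoc)
qed

lemma log_F_expansion:
  assumes re: "Re a1 > 0" "Re a2 > 0" and ab: "- (pi / 2) < \<alpha>" "\<alpha> \<le> \<beta>" "\<beta> < pi / 2"
  shows "\<exists>C W. \<forall>w\<in>closed_sector \<alpha> \<beta>. norm w \<ge> W \<longrightarrow>
     F_fun w \<eta> a1 a2 = exp (\<Sum>m. log_rem 3 \<eta> a1 a2 (lat_pt w a1 a2 (prod_decode m))) \<and>
     norm ((\<Sum>m. log_rem 3 \<eta> a1 a2 (lat_pt w a1 a2 (prod_decode m))) - (\<Sum>k=1..N. log_F_coeff \<eta> a1 a2 k / w ^ k))
       \<le> C * norm (1 / w ^ Suc N)"
proof -
  have nz: "a1 \<noteq> 0" "a2 \<noteq> 0" using re by auto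
  define \<kappa> where "\<kappa> = min (cos \<alpha>) (cos \<beta>)"
  have \<kappa>: "\<kappa> > 0" using ab cos_gt_zero_pi[of \<alpha>] cos_gt_zero_pi[of \<beta>] by (auto simp: \<kappa>_def)
  define c where "c = min \<kappa> (min (Re a1) (Re a2))"
  have c: "c > 0" "c \<le> \<kappa>" "c \<le> Re a1" "c \<le> Re a2" using re \<kappa> by (auto simp: c_def)
  \<comment> \<open>One term more than the expansion needs. The decay exponent
    \<open>1/4 - K\<close> equals \<open>- (N + 1) - 11/4\<close>: \<open>N + 1\<close> powers go to
    \<open>w\<close>, and \<open>11/4 > 2\<close> are left to sum over the lattice. The surplus term
    joins the error constant.\<close>
  define K where "K = N + 4"
  obtain A B where A: "A \<ge> 1" "norm \<eta> \<le> A" "norm a1 \<le> A" "norm a2 \<le> A"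
    and B: "\<And>k. k < K \<Longrightarrow> norm (todd_coeff k \<eta> a1 a2) \<le> B"
    by (rule lat_pt_constants[OF re(1) re, of \<eta> K]) (rule that)
  \<comment> \<open>Beyond \<open>W\<close> every lattice point has norm at least
    \<open>16 * A\<close>, so the bound holds for all terms and no point cancels \<eta>.\<close>
  define W where "W = max 1 (16 * A / c)"
  define C0 where "C0 = 3 * (rem_const K (9 / 4) B * (8 * A) ^ (K + 2) * c powr (1 / 4 - real K))"
  define D where "D = (\<Sum>m. lat_wt (prod_decode m) powr (- 11 / 4))"
  have B0: "B \<ge> 0" by (rule order_trans[OF norm_ge_zero B[of 0]]) (simp add: K_def)
  have C0: "C0 \<ge> 0" unfolding C0_def using A rem_const_nonneg[of "9 / 4" K B] B0 by simp
  have "F_fun w \<eta> a1 a2 = exp (\<Sum>m. log_rem 3 \<eta> a1 a2 (lat_pt w a1 a2 (prod_decode m))) \<and>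
     norm ((\<Sum>m. log_rem 3 \<eta> a1 a2 (lat_pt w a1 a2 (prod_decode m))) - (\<Sum>k=1..N. log_F_coeff \<eta> a1 a2 k / w ^ k))
       \<le> (norm (log_F_coeff \<eta> a1 a2 (Suc N)) + C0 * D) * norm (1 / w ^ Suc N)"
    if w: "w \<in> closed_sector \<alpha> \<beta>" "norm w \<ge> W" for w
  proof -
    have w1: "norm w \<ge> 1" "c * norm w \<ge> 16 * A" using w(2) c by (auto simp: W_def field_simps)
    have "\<kappa> * norm w \<le> Re w" unfolding \<kappa>_def by (rule closed_sector_Re_ge[OF ab(1,3) w(1)])
    moreover have "c * norm w \<le> \<kappa> * norm w" using c by (intro mult_right_mono) auto
    ultimately have Rew: "c * norm w \<le> Re w" by linarith
    then have rew: "Re w > 0" using w1 A by linarith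
    \<comment> \<open>Unlike \<open>lat_wt\<close> this weight retains \<open>norm w\<close>, so
      that the decay can be split between \<open>w\<close> and the lattice indices.\<close>
    define L where "L = (\<lambda>n :: nat \<times> nat. norm w + real (fst n) + real (snd n))"
    have L1: "L n \<ge> norm w" "L n \<ge> lat_wt n" "L n > 0" for n using w1 by (auto simp: L_def lat_wt_def)
    have yL: "c * L n \<le> norm (lat_pt w a1 a2 n)" for n
    proof -
      have "real (fst n) * c \<le> real (fst n) * Re a1" "real (snd n) * c \<le> real (snd n) * Re a2"
        by (intro mult_left_mono c; simp)+
      then have "c * L n \<le> Re (lat_pt w a1 a2 n)" using Rew by (simp add: L_def lat_pt_def algebra_simps)
      then show ?thesis using complex_Re_le_cmod order_trans by blast
    qed
    have AL: "16 * A \<le> c * L n" for n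
      using w1(2) mult_left_mono[OF L1(1)[of n], of c] c by linarith
    have nl: "w + \<eta> \<notin> cone_lattice a1 a2"
    proof
      assume "w + \<eta> \<in> cone_lattice a1 a2"
      then obtain n where "lat_pt w a1 a2 n + \<eta> = 0" unfolding cone_lattice_iff by blast
      then have "norm (lat_pt w a1 a2 n) = norm \<eta>" by (simp add: add_eq_0_iff2)
      then show False using AL[of n] yL[of n] A by linarith
    qed
    have nz': "lat_pt w a1 a2 n + \<eta> \<noteq> 0" for n using nl unfolding cone_lattice_iff by blast
    have T: "norm (log_rem K \<eta> a1 a2 (lat_pt w a1 a2 n)) \<le> C0 * norm (1 / w ^ Suc N) * lat_wt n powr (- 11 / 4)" for n
    proof -
      have "norm (log_rem K \<eta> a1 a2 (lat_pt w a1 a2 n)) \<le>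
          3 * (rem_const K (9 / 4) B * (8 * A) ^ (K + 2) * (c * L n) powr (1 / 4 - real K))"
        by (rule log_rem_bound[OF re lat_pt_neq_0(1)[OF rew re] A AL yL]) (use B in \<open>auto simp: K_def\<close>)
      also have "\<dots> = C0 * L n powr (1 / 4 - real K)"
        using c L1(3)[of n] by (simp add: C0_def powr_mult)
      also have "L n powr (1 / 4 - real K) = L n powr (- real (Suc N)) * L n powr (- 11 / 4)"
        by (simp add: K_def powr_add[symmetric])
      also have "C0 * (L n powr (- real (Suc N)) * L n powr (- 11 / 4)) \<le>
          C0 * (norm w powr (- real (Suc N)) * lat_wt n powr (- 11 / 4))"
        using L1[of n] w1 lat_wt_pos[of n] by (intro mult_left_mono mult_mono powr_mono2' C0) auto
      also have "norm w powr (- real (Suc N)) = norm (1 / w ^ Suc N)"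
      proof -
        have "norm w powr real (Suc N) = norm w ^ Suc N" by (rule powr_realpow) (use w1 in linarith)
        then show ?thesis by (simp only: powr_minus norm_divide norm_one norm_power inverse_eq_divide)
      qed
      finally show ?thesis by (simp add: mult_ac)
    qed
    define J where "J = (\<Sum>m. log_rem 3 \<eta> a1 a2 (lat_pt w a1 a2 (prod_decode m)))"
    define R where "R = (\<Sum>m. log_rem K \<eta> a1 a2 (lat_pt w a1 a2 (prod_decode m)))"
    have sD: "summable (\<lambda>m. lat_wt (prod_decode m) powr (- 11 / 4))" by (rule lat_wt_prod_decode_summable) simp
    have "norm R \<le> (\<Sum>m. C0 * norm (1 / w ^ Suc N) * lat_wt (prod_decode m) powr (- 11 / 4))"
      unfolding R_def by (intro norm_suminf_le T summable_mult sD)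
    also have "\<dots> = C0 * D * norm (1 / w ^ Suc N)"
      unfolding D_def by (subst suminf_mult[OF sD]) (simp add: mult_ac)
    finally have R: "norm R \<le> C0 * D * norm (1 / w ^ Suc N)" .
    have "J + log_todd 3 \<eta> a1 a2 w = R + log_todd K \<eta> a1 a2 w"
      using zeta2_deriv_0[OF rew re order_refl nz'] zeta2_deriv_0[OF rew re, of K, OF _ nz']
      unfolding J_def R_def by (simp add: K_def sums_iff)
    then have "J - (\<Sum>k=1..N. log_F_coeff \<eta> a1 a2 k / w ^ k) = log_F_coeff \<eta> a1 a2 (Suc N) * (1 / w ^ Suc N) + R"
      unfolding K_def log_todd_expansion[OF nz] log_todd_3[OF nz] by (simp add: algebra_simps)
    then have "norm (J - (\<Sum>k=1..N. log_F_coeff \<eta> a1 a2 k / w ^ k)) \<le>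
        norm (log_F_coeff \<eta> a1 a2 (Suc N)) * norm (1 / w ^ Suc N) + C0 * D * norm (1 / w ^ Suc N)"
      using norm_triangle_ineq[of "log_F_coeff \<eta> a1 a2 (Suc N) * (1 / w ^ Suc N)" R] R
      unfolding norm_mult by simp
    then show ?thesis
      using F_fun_rhp[OF rew re nl] unfolding J_def by (simp add: distrib_right)
  qed
  then show ?thesis by blast
qed

text \<open>The expansion is known for the series \<open>J w\<close>, which need not be the
  principal logarithm. Its case \<open>N = 0\<close> makes \<open>J w\<close> smaller than 1 far
  out, where the two agree.\<close>

lemma F_fun_asymptotics:
  assumes re: "Re a1 > 0" "Re a2 > 0" and ab: "- (pi / 2) < \<alpha>" "\<alpha> \<le> \<beta>" "\<beta> < pi / 2"
  shows "asymp_expansion_in (\<lambda>w. Ln (F_fun w \<eta> a1 a2)) (log_F_coeff \<eta> a1 a2) (closed_sector \<alpha> \<beta>)"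
  unfolding asymp_expansion_in_def
proof
  fix N
  define J where "J = (\<lambda>w. \<Sum>m. log_rem 3 \<eta> a1 a2 (lat_pt w a1 a2 (prod_decode m)))"
  obtain C W where CW: "\<And>w. w \<in> closed_sector \<alpha> \<beta> \<Longrightarrow> norm w \<ge> W \<Longrightarrow>
     F_fun w \<eta> a1 a2 = exp (J w) \<and>
     norm (J w - (\<Sum>k=1..N. log_F_coeff \<eta> a1 a2 k / w ^ k)) \<le> C * norm (1 / w ^ Suc N)"
    using log_F_expansion[OF re ab, of \<eta> N] unfolding J_def by blast
  obtain C' W' where CW': "\<And>w. w \<in> closed_sector \<alpha> \<beta> \<Longrightarrow> norm w \<ge> W' \<Longrightarrow>
     norm (J w - (\<Sum>k=1..0. log_F_coeff \<eta> a1 a2 k / w ^ k)) \<le> C' * norm (1 / w ^ Suc 0)"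
    using log_F_expansion[OF re ab, of \<eta> 0] unfolding J_def by blast
  show "(\<lambda>w. Ln (F_fun w \<eta> a1 a2) - (\<Sum>k=1..N. log_F_coeff \<eta> a1 a2 k / w ^ k))
      \<in> O[inf at_infinity (principal (closed_sector \<alpha> \<beta>))](\<lambda>w. 1 / w ^ Suc N)"
  proof (rule bigoI)
    show "\<forall>\<^sub>F w in inf at_infinity (principal (closed_sector \<alpha> \<beta>)).
        norm (Ln (F_fun w \<eta> a1 a2) - (\<Sum>k=1..N. log_F_coeff \<eta> a1 a2 k / w ^ k)) \<le> C * norm (1 / w ^ Suc N)"
      unfolding eventually_inf_principal eventually_at_infinity
    proof (intro exI allI impI)
      fix w assume w: "max W (max W' (max 1 (C' + 1))) \<le> norm w" and s: "w \<in> closed_sector \<alpha> \<beta>"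
      then have w': "norm w \<ge> W" "norm w \<ge> W'" "norm w \<ge> 1" "norm w \<ge> C' + 1" by auto
      have "norm (J w) \<le> C' / norm w" using CW'[OF s w'(2)] by (simp add: norm_divide)
      also have "\<dots> < 1" using w' by (simp add: divide_less_eq)
      finally have "\<bar>Im (J w)\<bar> < 1" using abs_Im_le_cmod[of "J w"] by linarith
      then have "Ln (exp (J w)) = J w"
        using pi_gt3 by (intro Ln_exp) (auto simp: abs_less_iff)
      then show "norm (Ln (F_fun w \<eta> a1 a2) - (\<Sum>k=1..N. log_F_coeff \<eta> a1 a2 k / w ^ k)) \<le> C * norm (1 / w ^ Suc N)"
        using CW[OF s w'(1)] by simp
    qed
  qed
qed

text \<open>Single-valuedness appears as existence of a rotation together with independence of it.
  In the homogeneity relation the scale stays in the component of 1: elsewhere the logarithms of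
  \<open>l * w\<close> and \<open>l * a1\<close> can shift by amounts that differ by a multiple of
  \<open>2 * pi * \<i>\<close>, which can leave an exponential of the Bernoulli polynomial as an
  extra factor.\<close>

theorem proposition2p2:
  shows
    \<comment> \<open>(a)\<close>
    "((\<forall>w\<in>slit. \<forall>\<eta> a1 a2. admissible_params a1 a2 \<longrightarrow>
         (\<exists>l. rotates_to_rhp l a1 a2) \<and>
         (\<forall>l. rotates_to_rhp l a1 a2 \<longrightarrow>
            Gamma2 (w + \<eta>) a1 a2 = Gamma2_via l (w + \<eta>) a1 a2)) \<and>
      open F_domain \<and>
      mv_meromorphic_on F_vec F_domain \<and>
      (\<forall>p\<in>F_domain. \<not> mv_zero F_vec p) \<and>
      (\<forall>p\<in>F_domain. mv_pole F_vec p \<longrightarrow> p \<in> F_polar_set) \<and>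
      mv_holomorphic_on F_vec (F_domain - F_polar_set))
    \<and>
    \<comment> \<open>(b)\<close>
     ((\<forall>w \<eta> a1 a2. w \<in> slit \<and> admissible_params a1 a2 \<longrightarrow>
         F_fun w \<eta> a1 a2 = F_fun w \<eta> a2 a1) \<and>
      (\<forall>w \<eta> a1 a2 l. w \<in> slit \<and> admissible_params a1 a2 \<and>
         l \<in> connected_component_set
               {l. l \<noteq> 0 \<and> l * w \<in> slit \<and> l * a1 \<in> slit \<and> l * a2 \<in> slit} 1 \<longrightarrow>
         F_fun (l * w) (l * \<eta>) (l * a1) (l * a2) = F_fun w \<eta> a1 a2))
    \<and>
    \<comment> \<open>(c)\<close>
     (\<forall>w \<eta> a1 a2. w \<in> slit \<and> admissible_params a1 a2 \<and> w + \<eta> \<notin> cone_lattice a1 a2 \<longrightarrow>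
        F_fun w (\<eta> + a2) a1 a2 / F_fun w \<eta> a1 a2 = inverse (Lambda_fun w \<eta> a1))
    \<and>
    \<comment> \<open>(d)\<close>
     (\<forall>\<eta> a1 a2. Re a1 > 0 \<and> Re a2 > 0 \<longrightarrow>
        (\<forall>\<alpha> \<beta>. - (pi / 2) < \<alpha> \<and> \<alpha> \<le> \<beta> \<and> \<beta> < pi / 2 \<longrightarrow>
           asymp_expansion_in (\<lambda>w. Ln (F_fun w \<eta> a1 a2))
             (\<lambda>k. (- 1) ^ k * mult_bernoulli (k + 2) \<eta> [a1, a2]
                    / of_nat (k * (k + 1) * (k + 2)))
             (closed_sector \<alpha> \<beta>)))"
proof (intro conjI allI impI ballI)
  fix w \<eta> a1 a2
  assume "w \<in> slit" and a: "admissible_params a1 a2"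
  show "\<exists>l. rotates_to_rhp l a1 a2" by (rule rotates_to_rhp_exists[OF a])
  show "Gamma2 (w + \<eta>) a1 a2 = Gamma2_via l (w + \<eta>) a1 a2" if "rotates_to_rhp l a1 a2" for l
    by (rule Gamma2_eq_via[OF a that])
next
  show "open F_domain" by (rule open_F_domain)
  show "mv_meromorphic_on F_vec F_domain" by (rule mv_meromorphic_F_vec)
  show "\<not> mv_zero F_vec p" if "p \<in> F_domain" for p by (rule not_mv_zero_F_vec[OF that])
  show "p \<in> F_polar_set" if "p \<in> F_domain" "mv_pole F_vec p" for p by (rule mv_pole_F_vec[OF that])
  show "mv_holomorphic_on F_vec (F_domain - F_polar_set)"
    by (auto simp: mv_holomorphic_on_iff intro: mv_diff_F_vec)
next
  fix w \<eta> a1 a2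
  show "F_fun w \<eta> a1 a2 = F_fun w \<eta> a2 a1" by (rule F_fun_commute)
next
  fix w \<eta> a1 a2 l
  assume "w \<in> slit \<and> admissible_params a1 a2 \<and> l \<in> connected_component_set
               {l. l \<noteq> 0 \<and> l * w \<in> slit \<and> l * a1 \<in> slit \<and> l * a2 \<in> slit} 1"
  then show "F_fun (l * w) (l * \<eta>) (l * a1) (l * a2) = F_fun w \<eta> a1 a2"
    by (intro F_fun_homogeneous) auto
next
  fix w \<eta> a1 a2
  assume "w \<in> slit \<and> admissible_params a1 a2 \<and> w + \<eta> \<notin> cone_lattice a1 a2"
  then show "F_fun w (\<eta> + a2) a1 a2 / F_fun w \<eta> a1 a2 = inverse (Lambda_fun w \<eta> a1)"
    by (intro F_fun_shift) auto
next
  fix \<eta> a1 a2 \<alpha> \<beta>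
  assume "Re a1 > 0 \<and> Re a2 > 0" "- (pi / 2) < \<alpha> \<and> \<alpha> \<le> \<beta> \<and> \<beta> < pi / 2"
  then show "asymp_expansion_in (\<lambda>w. Ln (F_fun w \<eta> a1 a2))
             (\<lambda>k. (- 1) ^ k * mult_bernoulli (k + 2) \<eta> [a1, a2]
                    / of_nat (k * (k + 1) * (k + 2)))
             (closed_sector \<alpha> \<beta>)"
    using F_fun_asymptotics[of a1 a2 \<alpha> \<beta> \<eta>] unfolding log_F_coeff_def by blast
qed

end
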